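(* Let $T>0$ and $s\in\mathbb{R}$. Assume that $a\in L_1^\infty([0,T])$ satisfies $\inf_{t\in[0,T]}a(t)=a_0>0$ and that $q\in L^\infty([0,T])$ is real-valued. Let $f\in L^2([0,T];\mathrm{H}^s_{\mathcal{H}})$. If $(v_0,v_1)\in \mathrm{H}^{1+s}_{\mathcal{H}}\times \mathrm{H}^{s}_{\mathcal{H}}$, then the Cauchy problem $$\partial_t^2 v(t,x)+a(t)\mathcal{H}v(t,x)+q(t)v(t,x)=f(t,x),\quad (t,x)\in[0,T]\times\mathbb{R}^n,$$ $$v(0,x)=v_0(x),\qquad \partial_t v(0,x)=v_1(x),\quad x\in\mathbb{R}^n,$$ has a unique solution $v\in C([0,T];\mathrm{H}^{1+s}_{\mathcal{H}})\cap C^1([0,T];\mathrm{H}^{s}_{\mathcal{H}})$, and it satisfies $$\|v(t,\cdot)\|_{\mathrm{H}^{1+s}_{\mathcal{H}}}^2+\|v_t(t,\cdot)\|_{\mathrm{H}^{s}_{\mathcal{H}}}^2\le C\Big(\|v_0\|_{\mathrm{H}^{1+s}_{\mathcal{H}}}^2+\|v_1\|_{\mathrm{H}^{s}_{\mathcal{H}}}^2+\|f\|^2_{L^2([0,T];\mathrm{H}^s_{\mathcal{H}})}\Big)$$ for all $t\in[0,T]$, where the constant $C>0$ is independent of $t\in[0,T]$.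
   Context: The operator $\mathcal{H}$. Let $V$ be a complex potential on $\mathbb{R}^n$ and let $\mathcal{H}_0=-\Delta+V$ be a densely defined Schrödinger operator on $L^2(\mathbb{R}^n)$ with purely discrete spectrum (empty essential spectrum) $\{\lambda_\xi\in\mathbb{C}:\xi\in\mathcal{I}\}$, $\mathcal{I}$ an ordered countable set, whose corresponding eigenfunctions $\{u_\xi\}_{\xi\in\mathcal{I}}$ form a Riesz basis of $L^2(\mathbb{R}^n)$. Let $\{v_\xi\}_{\xi\in\mathcal{I}}$ be the biorthogonal system, $\int_{\mathbb{R}^n}u_\xi\overline{v_\eta}\,dx=\delta_{\xi\eta}$. Then $\mathcal{H}:=|\mathcal{H}_0|$ denotes the operator with $\mathcal{H}u_\xi=|\lambda_\xi|u_\xi$ for every $\xi$ (this is not the absolute value in the operator-theoretic sense). If some $\lambda_\xi=0$, one instead fixes $c>0$ and lets $\mathcal{H}$ be the operator with eigenvalue $|\lambda_\xi|+c$ on each $u_\xi$. Write $\mu_\xi>0$ for the eigenvalue of $\mathcal{H}$ on $u_\xi$; the adjoint satisfies $\mathcal{H}^*v_\xi=\mu_\xi v_\xi$. Distributions and Fourier transform. $C^\infty_{\mathcal{H}^*}(\mathbb{R}^n)=\bigcap_k\operatorname{Dom}((\mathcal{H}^* )^k)$ with the Fréchet topology given by the norms $\max_{j\le k}\|(\mathcal{H}^* )^j\varphi\|_{L^2}$; $\mathcal{D}'_{\mathcal{H}}(\mathbb{R}^n)$ is the space of continuous functionals on it, with $f\in L^2$ acting by $\varphi\mapsto\int f\overline{\varphi}\,dx$.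 The $\mathcal{H}$-Fourier transform is $\widehat f(\xi)=\int_{\mathbb{R}^n}f(x)\overline{v_\xi(x)}\,dx$, extended to $\mathcal{D}'_{\mathcal{H}}$ by evaluating $f$ on $v_\xi$; one has $f=\sum_\xi\widehat f(\xi)u_\xi$. Sobolev spaces. For $s\in\mathbb{R}$, $\mathrm{H}^s_{\mathcal{H}}=\{f\in\mathcal{D}'_{\mathcal{H}}(\mathbb{R}^n):\mathcal{H}^{s/2}f\in L^2(\mathbb{R}^n)\}$ with $\|f\|_{\mathrm{H}^s_{\mathcal{H}}}=\|\mathcal{H}^{s/2}f\|_{L^2}$, where $\mathcal{H}^{s/2}f=\sum_\xi\mu_\xi^{s/2}\widehat f(\xi)u_\xi$. $L_1^\infty([0,T])$ is the space of differentiable $a\in L^\infty([0,T])$ with $\partial_t a\in L^\infty([0,T])$. Solutions of the equation are understood after $\mathcal{H}$-Fourier transform in $x$: for every $\xi\in\mathcal{I}$, $\partial_t^2\widehat v+a(t)\mu_\xi\widehat v+q(t)\widehat v=\widehat f$ in $t$ with the transformed initial data. *)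

theory Defs
  imports "HOL-Analysis.Analysis"
begin

section \<open>The Hilbert space of square integrable functions\<close>

text \<open>
  Elements of \<open>L\<^sup>2\<close> are represented by functions; everything below is invariant under
  changing a representative on a null set.
\<close>

type_synonym 'a cfun = "'a \<Rightarrow> complex"

definition L2 :: "'a::euclidean_space cfun set" where
  "L2 = {f \<in> borel_measurable lebesgue. integrable lebesgue (\<lambda>x. (cmod (f x))\<^sup>2)}"

definition l2_inner :: "'a::euclidean_space cfun \<Rightarrow> 'a cfun \<Rightarrow> complex" where
  "l2_inner f g = (LINT x|lebesgue. f x * cnj (g x))"

definition l2_norm :: "'a::euclidean_space cfun \<Rightarrow> real" where
  "l2_norm f = sqrt (LINT x|lebesgue. (cmod (f x))\<^sup>2)"

definition riesz_basis :: "'i set \<Rightarrow> ('i \<Rightarrow> 'a::euclidean_space cfun) \<Rightarrow> bool" where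
  "riesz_basis I u \<longleftrightarrow>
     (\<forall>\<xi>\<in>I. u \<xi> \<in> L2) \<and>
     (\<forall>f\<in>L2. \<forall>e>0. \<exists>F b. finite F \<and> F \<subseteq> I \<and> l2_norm (\<lambda>x. f x - (\<Sum>\<xi>\<in>F. b \<xi> * u \<xi> x)) < e) \<and>
     (\<exists>A>0. \<exists>B>0. \<forall>F b. finite F \<and> F \<subseteq> I \<longrightarrow>
        A * (\<Sum>\<xi>\<in>F. (cmod (b \<xi>))\<^sup>2) \<le> (l2_norm (\<lambda>x. \<Sum>\<xi>\<in>F. b \<xi> * u \<xi> x))\<^sup>2 \<and>
        (l2_norm (\<lambda>x. \<Sum>\<xi>\<in>F. b \<xi> * u \<xi> x))\<^sup>2 \<le> B * (\<Sum>\<xi>\<in>F. (cmod (b \<xi>))\<^sup>2))"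

definition biorthogonal :: "'i set \<Rightarrow> ('i \<Rightarrow> 'a::euclidean_space cfun) \<Rightarrow> ('i \<Rightarrow> 'a cfun) \<Rightarrow> bool" where
  "biorthogonal I u v \<longleftrightarrow>
     (\<forall>\<xi>\<in>I. v \<xi> \<in> L2) \<and>
     (\<forall>\<xi>\<in>I. \<forall>\<eta>\<in>I. l2_inner (u \<xi>) (v \<eta>) = (if \<xi> = \<eta> then 1 else 0))"

section \<open>Unbounded operators\<close>

text \<open>
  An unbounded operator is given by its graph, a set of pairs \<open>(f, Af)\<close> that contains all
  representatives of its elements; its domain is \<^const>\<open>Domain\<close> of the graph.
\<close>

type_synonym 'a graph = "('a cfun \<times> 'a cfun) set"

definition linear_operator :: "'a::euclidean_space graph \<Rightarrow> bool" where
  "linear_operator G \<longleftrightarrow>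
     G \<subseteq> L2 \<times> L2 \<and>
     (\<lambda>x. 0, \<lambda>x. 0) \<in> G \<and>
     (\<forall>f g f' g' c. (f, g) \<in> G \<and> (f', g') \<in> G \<longrightarrow> (\<lambda>x. f x + c * f' x, \<lambda>x. g x + c * g' x) \<in> G) \<and>
     (\<forall>f g f' g'. (f, g) \<in> G \<and> f' \<in> L2 \<and> g' \<in> L2 \<and>
        (AE x in lebesgue. f' x = f x) \<and> (AE x in lebesgue. g' x = g x) \<longrightarrow> (f', g') \<in> G) \<and>
     (\<forall>f g g'. (f, g) \<in> G \<and> (f, g') \<in> G \<longrightarrow> (AE x in lebesgue. g x = g' x))"

definition densely_defined :: "'a::euclidean_space graph \<Rightarrow> bool" where
  "densely_defined G \<longleftrightarrow> (\<forall>f\<in>L2. \<forall>e>0. \<exists>h\<in>Domain G. l2_norm (\<lambda>x. f x - h x) < e)"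

text \<open>\<open>(u, g + z u) \<in> G\<close> says that \<open>(A - z) u = g\<close>.\<close>

definition resolvent_set :: "'a::euclidean_space graph \<Rightarrow> complex set" where
  "resolvent_set G = {z.
     (\<forall>u. (u, \<lambda>x. z * u x) \<in> G \<longrightarrow> (AE x in lebesgue. u x = 0)) \<and>
     (\<exists>K. \<forall>g\<in>L2. \<exists>u. (u, \<lambda>x. g x + z * u x) \<in> G \<and> l2_norm u \<le> K * l2_norm g)}"

definition spectrum :: "'a::euclidean_space graph \<Rightarrow> complex set" where
  "spectrum G = - resolvent_set G"

definition eigenspace :: "'a::euclidean_space graph \<Rightarrow> complex \<Rightarrow> 'a cfun set" where
  "eigenspace G z = {u. (u, \<lambda>x. z * u x) \<in> G}"

definition shifted_range :: "'a::euclidean_space graph \<Rightarrow> complex \<Rightarrow> 'a cfun set" where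
  "shifted_range G z = {g \<in> L2. \<exists>u. (u, \<lambda>x. g x + z * u x) \<in> G}"

text \<open>\<open>A - z\<close> is Fredholm: finite-dimensional kernel, closed range of finite codimension.\<close>

definition fredholm_at :: "'a::euclidean_space graph \<Rightarrow> complex \<Rightarrow> bool" where
  "fredholm_at G z \<longleftrightarrow>
     (\<exists>B. finite B \<and> B \<subseteq> eigenspace G z \<and>
        (\<forall>u\<in>eigenspace G z. \<exists>k. AE x in lebesgue. u x = (\<Sum>b\<in>B. k b * b x))) \<and>
     (\<forall>g\<in>L2. (\<forall>e>0. \<exists>h\<in>shifted_range G z. l2_norm (\<lambda>x. g x - h x) < e) \<longrightarrow> g \<in> shifted_range G z) \<and>
     (\<exists>B. finite B \<and> B \<subseteq> L2 \<and>
        (\<forall>g\<in>L2. \<exists>k. (\<lambda>x. g x - (\<Sum>b\<in>B. k b * b x)) \<in> shifted_range G z))"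

definition essential_spectrum :: "'a::euclidean_space graph \<Rightarrow> complex set" where
  "essential_spectrum G = {z. \<not> fredholm_at G z}"

definition adjoint_graph :: "'a::euclidean_space graph \<Rightarrow> 'a graph" where
  "adjoint_graph G = {(\<phi>, \<psi>). \<phi> \<in> L2 \<and> \<psi> \<in> L2 \<and> (\<forall>(f, g)\<in>G. l2_inner g \<phi> = l2_inner f \<psi>)}"

section \<open>Schroedinger operators\<close>

definition partial_deriv :: "'a::euclidean_space \<Rightarrow> 'a cfun \<Rightarrow> 'a cfun" where
  "partial_deriv b f = (\<lambda>x. frechet_derivative f (at x) b)"

primrec Ck :: "nat \<Rightarrow> 'a::euclidean_space cfun \<Rightarrow> bool" where
  "Ck 0 f \<longleftrightarrow> continuous_on UNIV f"
| "Ck (Suc k) f \<longleftrightarrow> (\<forall>x. f differentiable (at x)) \<and> (\<forall>b\<in>Basis. Ck k (partial_deriv b f))"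

definition Cc_infinity :: "'a::euclidean_space cfun set" where
  "Cc_infinity = {\<theta>. (\<forall>k. Ck k \<theta>) \<and> compact (closure {x. \<theta> x \<noteq> 0})}"

definition laplacian :: "'a::euclidean_space cfun \<Rightarrow> 'a cfun" where
  "laplacian f = (\<lambda>x. \<Sum>b\<in>Basis. partial_deriv b (partial_deriv b f) x)"

text \<open>
  A densely defined operator acting as \<open>- \<Delta> + V\<close>. The expression \<open>- \<Delta> u + V u\<close> is meant in the
  sense of distributions, so \<open>V u\<close> has to be locally integrable for \<open>u\<close> in the domain.
\<close>

definition schroedinger_operator :: "'a::euclidean_space cfun \<Rightarrow> 'a graph \<Rightarrow> bool" where
  "schroedinger_operator V H\<^sub>0 \<longleftrightarrow>
     V \<in> borel_measurable lebesgue \<and> linear_operator H\<^sub>0 \<and> densely_defined H\<^sub>0 \<and>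
     (\<forall>(u, g)\<in>H\<^sub>0.
        (\<forall>K. compact K \<longrightarrow> (\<lambda>x. V x * u x) absolutely_integrable_on K) \<and>
        (\<forall>\<theta>\<in>Cc_infinity. (LINT x|lebesgue. g x * \<theta> x) =
           (LINT x|lebesgue. u x * (- laplacian \<theta> x)) + (LINT x|lebesgue. V x * u x * \<theta> x)))"

section \<open>Test functions and distributions associated with an operator\<close>

text \<open>In this section \<open>A\<close> plays the role of \<open>H\<^sup>*\<close>.\<close>

definition test_space :: "'a::euclidean_space graph \<Rightarrow> 'a cfun set" where
  "test_space A = (\<Inter>k::nat. Domain (A ^^ k))"

definition power_apply :: "'a::euclidean_space graph \<Rightarrow> nat \<Rightarrow> 'a cfun \<Rightarrow> 'a cfun" where
  "power_apply A j \<phi> = (SOME \<psi>. (\<phi>, \<psi>) \<in> A ^^ j)"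

definition test_norm :: "'a::euclidean_space graph \<Rightarrow> nat \<Rightarrow> 'a cfun \<Rightarrow> real" where
  "test_norm A k \<phi> = Max ((\<lambda>j. l2_norm (power_apply A j \<phi>)) ` {..k})"

definition test_topology :: "'a::euclidean_space graph \<Rightarrow> 'a cfun topology" where
  "test_topology A = topology_generated_by
     {{\<psi> \<in> test_space A. test_norm A k (\<lambda>x. \<psi> x - \<phi> x) < r} | \<phi> k r. \<phi> \<in> test_space A \<and> r > 0}"

type_synonym 'a dist = "'a cfun \<Rightarrow> complex"

text \<open>
  The functionals are antilinear, because \<open>f \<in> L\<^sup>2\<close> acts by integrating \<open>f\<close> against the complex
  conjugate of the test function. They are made \<^const>\<open>extensional\<close>, so that equality
  of distributions is equality on all test functions.
\<close>

definition distributions :: "'a::euclidean_space graph \<Rightarrow> 'a dist set" where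
  "distributions A = {w \<in> extensional (test_space A).
     (\<forall>\<phi>\<in>test_space A. \<forall>\<psi>\<in>test_space A. \<forall>c. w (\<lambda>x. \<phi> x + c * \<psi> x) = w \<phi> + cnj c * w \<psi>) \<and>
     continuous_map (test_topology A) euclidean w}"

definition dist_of :: "'a::euclidean_space graph \<Rightarrow> 'a cfun \<Rightarrow> 'a dist" where
  "dist_of A f = (\<lambda>\<phi>\<in>test_space A. l2_inner f \<phi>)"

section \<open>The operator \<open>H\<close> and its Sobolev spaces\<close>

context
  fixes I :: "'i set"
    and u v :: "'i \<Rightarrow> 'a::euclidean_space cfun"
    and \<mu> :: "'i \<Rightarrow> real"
begin

text \<open>
  \<open>H f\<close> is the sum of the series \<open>\<Sum> \<mu>\<^sub>\<xi> (f, v\<^sub>\<xi>) u\<^sub>\<xi>\<close>, on the maximal domain: all \<open>f\<close> for which the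
  series converges (unconditionally) in \<open>L\<^sup>2\<close>.
\<close>

definition H_op :: "'a graph" where
  "H_op = {(f, g). f \<in> L2 \<and> g \<in> L2 \<and>
     ((\<lambda>F. l2_norm (\<lambda>x. g x - (\<Sum>\<xi>\<in>F. complex_of_real (\<mu> \<xi>) * l2_inner f (v \<xi>) * u \<xi> x)))
        \<longlongrightarrow> 0) (finite_subsets_at_top I)}"

definition H_adj :: "'a graph" where
  "H_adj = adjoint_graph H_op"

definition fourier :: "'a dist \<Rightarrow> 'i \<Rightarrow> complex" where
  "fourier w \<xi> = w (v \<xi>)"

text \<open>
  The distribution \<open>H\<^sup>r w = \<Sum> \<mu>\<^sub>\<xi>\<^sup>r w(v\<^sub>\<xi>) u\<^sub>\<xi>\<close>, the series being summed in the weak sense.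
  For a distribution \<open>w\<close> it converges absolutely on every test function (provided that the
  \<open>u\<^sub>\<xi>\<close> form a Riesz basis and the \<open>\<mu>\<^sub>\<xi>\<close> are bounded away from zero).
\<close>

definition H_power :: "real \<Rightarrow> 'a dist \<Rightarrow> 'a dist" where
  "H_power r w = (\<lambda>\<phi>\<in>test_space H_adj.
     (\<Sum>\<^sub>\<infinity>\<xi>\<in>I. complex_of_real (\<mu> \<xi> powr r) * fourier w \<xi> * l2_inner (u \<xi>) \<phi>))"

definition sobolev :: "real \<Rightarrow> 'a dist set" where
  "sobolev s = {w \<in> distributions H_adj. \<exists>g\<in>L2. H_power (s / 2) w = dist_of H_adj g}"

definition sobolev_norm :: "real \<Rightarrow> 'a dist \<Rightarrow> real" where
  "sobolev_norm s w = l2_norm (SOME g. g \<in> L2 \<and> H_power (s / 2) w = dist_of H_adj g)"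

definition dist_diff :: "'a dist \<Rightarrow> 'a dist \<Rightarrow> 'a dist" where
  "dist_diff w w' = (\<lambda>\<phi>\<in>test_space H_adj. w \<phi> - w' \<phi>)"

definition dist_scale :: "real \<Rightarrow> 'a dist \<Rightarrow> 'a dist" where
  "dist_scale c w = (\<lambda>\<phi>\<in>test_space H_adj. complex_of_real c * w \<phi>)"

definition C_sobolev :: "real \<Rightarrow> real \<Rightarrow> (real \<Rightarrow> 'a dist) \<Rightarrow> bool" where
  "C_sobolev T s w \<longleftrightarrow>
     (\<forall>t\<in>{0..T}. w t \<in> sobolev s \<and>
        ((\<lambda>\<tau>. sobolev_norm s (dist_diff (w \<tau>) (w t))) \<longlongrightarrow> 0) (at t within {0..T}))"

text \<open>\<open>w \<in> C\<^sup>1([0,T]; H\<^sup>s)\<close> with derivative \<open>w'\<close>.\<close>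

definition C1_sobolev :: "real \<Rightarrow> real \<Rightarrow> (real \<Rightarrow> 'a dist) \<Rightarrow> (real \<Rightarrow> 'a dist) \<Rightarrow> bool" where
  "C1_sobolev T s w w' \<longleftrightarrow>
     C_sobolev T s w \<and> C_sobolev T s w' \<and>
     (\<forall>t\<in>{0..T}.
        ((\<lambda>\<tau>. sobolev_norm s (dist_diff (dist_scale (1 / (\<tau> - t)) (dist_diff (w \<tau>) (w t))) (w' t)))
           \<longlongrightarrow> 0) (at t within {0..T}))"

text \<open>Bochner square integrable functions on \<open>[0,T]\<close> with values in \<open>H\<^sup>s\<close>.\<close>

definition L2_sobolev :: "real \<Rightarrow> real \<Rightarrow> (real \<Rightarrow> 'a dist) \<Rightarrow> bool" where
  "L2_sobolev T s f \<longleftrightarrow>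
     (AE t in lebesgue_on {0..T}. f t \<in> sobolev s) \<and>
     (\<exists>S. (\<forall>k::nat. simple_function (lebesgue_on {0..T}) (S k) \<and> S k ` {0..T} \<subseteq> sobolev s) \<and>
        (AE t in lebesgue_on {0..T}. (\<lambda>k. sobolev_norm s (dist_diff (S k t) (f t))) \<longlonglongrightarrow> 0)) \<and>
     integrable (lebesgue_on {0..T}) (\<lambda>t. (sobolev_norm s (f t))\<^sup>2)"

definition L2_sobolev_norm :: "real \<Rightarrow> real \<Rightarrow> (real \<Rightarrow> 'a dist) \<Rightarrow> real" where
  "L2_sobolev_norm T s f = sqrt (LINT t|lebesgue_on {0..T}. (sobolev_norm s (f t))\<^sup>2)"

end

section \<open>Coefficients and the Cauchy problem\<close>

definition Linf :: "real \<Rightarrow> (real \<Rightarrow> real) set" where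
  "Linf T = {q \<in> borel_measurable (lebesgue_on {0..T}). \<exists>B. AE t in lebesgue_on {0..T}. \<bar>q t\<bar> \<le> B}"

definition Linf1 :: "real \<Rightarrow> (real \<Rightarrow> real) set" where
  "Linf1 T = {a \<in> Linf T. \<exists>a'\<in>Linf T.
     \<forall>t\<in>{0..T}. (a has_real_derivative a' t) (at t within {0..T})}"

definition absolutely_continuous_on :: "real set \<Rightarrow> (real \<Rightarrow> complex) \<Rightarrow> bool" where
  "absolutely_continuous_on S z \<longleftrightarrow>
     (\<forall>e>0. \<exists>d>0. \<forall>D J. D division_of J \<and> J \<subseteq> S \<and> (\<Sum>k\<in>D. measure lborel k) < d \<longrightarrow>
        (\<Sum>k\<in>D. cmod (z (Sup k) - z (Inf k))) < e)"

text \<open>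
  The scalar problem \<open>y'' + a m y + q y = h\<close>, \<open>y(0) = y0\<close>, \<open>y'(0) = y1\<close> in the sense of
  Caratheodory: \<open>q\<close> and \<open>h\<close> are only defined almost everywhere, so \<open>y'\<close> is absolutely continuous
  and the equation holds for almost every \<open>t\<close>.
\<close>

definition ode_solution ::
  "real \<Rightarrow> (real \<Rightarrow> real) \<Rightarrow> (real \<Rightarrow> real) \<Rightarrow> real \<Rightarrow> (real \<Rightarrow> complex) \<Rightarrow> complex \<Rightarrow> complex \<Rightarrow>
   (real \<Rightarrow> complex) \<Rightarrow> bool" where
  "ode_solution T a q m h y0 y1 y \<longleftrightarrow>
     (\<exists>y'. (\<forall>t\<in>{0..T}. (y has_vector_derivative y' t) (at t within {0..T})) \<and>
       absolutely_continuous_on {0..T} y' \<and>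
       (AE t in lebesgue_on {0..T}. \<exists>y''. (y' has_vector_derivative y'') (at t within {0..T}) \<and>
          y'' + complex_of_real (a t * m) * y t + complex_of_real (q t) * y t = h t) \<and>
       y 0 = y0 \<and> y' 0 = y1)"

text \<open>
  \<open>w \<in> C([0,T]; H\<^sup>1\<^sup>+\<^sup>s) \<inter> C\<^sup>1([0,T]; H\<^sup>s)\<close>, with time derivative \<open>w'\<close>, solves the Cauchy problem with
  source \<open>f\<close> and data \<open>v0\<close>, \<open>v1\<close>.
\<close>

definition cauchy_solution ::
  "'i set \<Rightarrow> ('i \<Rightarrow> 'a::euclidean_space cfun) \<Rightarrow> ('i \<Rightarrow> 'a cfun) \<Rightarrow> ('i \<Rightarrow> real) \<Rightarrow>
   real \<Rightarrow> real \<Rightarrow> (real \<Rightarrow> real) \<Rightarrow> (real \<Rightarrow> real) \<Rightarrow> (real \<Rightarrow> 'a dist) \<Rightarrow> 'a dist \<Rightarrow> 'a dist \<Rightarrow>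
   (real \<Rightarrow> 'a dist) \<Rightarrow> (real \<Rightarrow> 'a dist) \<Rightarrow> bool" where
  "cauchy_solution I u v \<mu> T s a q f v0 v1 w w' \<longleftrightarrow>
     C_sobolev I u v \<mu> T (1 + s) w \<and> C1_sobolev I u v \<mu> T s w w' \<and>
     (\<forall>\<xi>\<in>I. ode_solution T a q (\<mu> \<xi>) (\<lambda>t. fourier v (f t) \<xi>) (fourier v v0 \<xi>) (fourier v v1 \<xi>)
        (\<lambda>t. fourier v (w t) \<xi>))"

end

theory Submission
  imports Defs
begin

text \<open>
  The Fourier transform turns the problem into one scalar equation \<open>y'' + a \<mu> y + q y = h\<close> for each
  index \<open>\<xi>\<close>, and the Sobolev spaces into weighted sequence spaces. The theorem is then an energy
  estimate for the scalar equation in which the constant does not depend on \<open>\<xi>\<close>.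

  \<^bold>\<open>Coordinates.\<close> Since \<open>u\<close> is a Riesz basis with dual system \<open>v\<close>, the coefficients \<open>l2_inner f (v \<xi>)\<close>
  identify \<open>L\<^sup>2\<close> with the space of square summable sequences, with equivalent norms (\<open>norm_lower_bound\<close>,
  \<open>norm_upper_bound\<close>, \<open>synthesis_u\<close>). Expansions of test functions along \<open>v\<close> converge in the test
  topology, so a distribution is determined by its coefficients (\<open>distribution_expansion\<close>), and the
  Sobolev space of order \<open>r\<close> consists of the distributions with finite \<open>\<Sum> \<mu>\<^sup>r \<bar>w(v)\<bar>\<^sup>2\<close>; up to the Riesz
  constants this sum is the square of the norm (\<open>sobolev_norm_bounds\<close>, \<open>series_dist_sobolev\<close>). This
  requires \<open>\<mu>\<close> to be bounded away from zero. If zero is not an eigenvalue, it lies in the resolvent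
  set, and the bounded inverse bounds the eigenvalues from below (\<open>eigenvalue_bounded_below\<close>).

  \<^bold>\<open>The scalar equation.\<close> A solution exists by the contraction principle (\<open>ode_pair_exists\<close>). Its energy
  \<open>a \<mu> \<bar>y\<bar>\<^sup>2 + \<bar>y'\<bar>\<^sup>2\<close> satisfies a differential inequality with constants that depend only on the bounds
  of \<open>a\<close>, \<open>a'\<close> and \<open>q\<close> and on the infimum of \<open>\<mu>\<close>, because the terms that are large with \<open>\<mu>\<close> cancel
  (\<open>energy_estimate\<close>); this also gives uniqueness. The functions \<open>q\<close> and \<open>h\<close> are merely
  measurable, so \<open>y'\<close> is merely absolutely continuous. The energy estimate therefore rests on the
  fundamental theorem of calculus for absolutely continuous functions
  (\<open>absolutely_continuous_has_integral\<close>), and existence on Lebesgue's differentiation theorem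
  (\<open>indefinite_integral_differentiable_ae\<close>).

  \<^bold>\<open>Summation.\<close> Multiplied by \<open>\<mu>\<^sup>s\<close> and summed over \<open>\<xi>\<close>, the scalar estimate becomes the estimate of
  the theorem. Its terms are at the same time a summable majorant that is uniform in time, so
  continuity and differentiability in time pass from the single coefficients to the series by
  dominated convergence (\<open>C_sobolev_series\<close>, \<open>difference_quotient_series\<close>).
\<close>

section \<open>Absolute continuity and the fundamental theorem of calculus\<close>

hide_const (open) Polynomial.content

text \<open>
  Away from \<open>N\<close> the derivative controls the increments of \<open>p\<close>, as in the gauge proof for functions
  that are differentiable everywhere. The intervals tagged by points of \<open>N\<close> are confined by the gauge
  to an open set of small measure, on which the increments are small by absolute continuity. The
  Henstock--Kurzweil integral, which integrates every derivative, is what makes this direct.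
\<close>

lemma absolutely_continuous_has_integral:
  fixes p g :: "real \<Rightarrow> complex"
  assumes ac: "absolutely_continuous_on {a..b} p"
    and neg: "negligible N"
    and der: "\<And>x. x \<in> {a..b} - N \<Longrightarrow> (p has_vector_derivative g x) (at x within {a..b})"
    and ab: "a \<le> b"
  shows "(g has_integral (p b - p a)) {a..b}"
proof -
  define g' where "g' x = (if x \<in> N then 0 else g x)" for x
  define inc where "inc k = (if k = {} then 0 else p (Sup k) - p (Inf k))" for k :: "real set"
  have "(g' has_integral (p b - p a)) (cbox a b)"
    unfolding has_integral
  proof (intro allI impI)
    fix e :: real assume e: "e > 0"
    obtain \<delta> where \<delta>: "\<delta> > 0"
      and ac\<delta>: "\<And>D J. D division_of J \<Longrightarrow> J \<subseteq> {a..b} \<Longrightarrow> (\<Sum>k\<in>D. measure lborel k) < \<delta> \<Longrightarrow>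
        (\<Sum>k\<in>D. cmod (p (Sup k) - p (Inf k))) < e / 2"
      using ac[unfolded absolutely_continuous_on_def] e by (meson half_gt_zero)
    obtain U where U: "open U" "N \<subseteq> U" "U - N \<in> lmeasurable" "emeasure lebesgue (U - N) < ennreal \<delta>"
      using sets_lebesgue_outer_open[of N \<delta>] \<delta> neg negligible_imp_sets by blast
    have "U - N \<union> N = U" using U(2) by auto
    then have Um: "U \<in> lmeasurable"
      using fmeasurable.Un[OF U(3) negligible_imp_measurable[OF neg]] by simp
    have "measure lebesgue U = measure lebesgue (U - N)"
      using neg Um by (simp add: measure_Diff_null_set negligible_iff_null_sets fmeasurableD)
    also have "\<dots> < \<delta>"
      using U(3,4) \<delta> by (simp add: emeasure_eq_measure2 ennreal_less_iff)
    finally have U\<delta>: "measure lebesgue U < \<delta>" .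
    \<comment> \<open>slope error allowed off \<open>N\<close>; the \<open>+ 1\<close> covers the case \<open>a = b\<close>\<close>
    define c where "c = e / (2 * (b - a + 1))"
    have c: "c > 0" and cle: "c * (b - a) < e / 2"
      using e ab by (auto simp: c_def field_simps)
    have "\<exists>d>0. x \<in> {a..b} - N \<longrightarrow> (\<forall>y\<in>{a..b}. \<bar>y - x\<bar> < d \<longrightarrow>
        norm (p y - p x - (y - x) *\<^sub>R g x) \<le> c * \<bar>y - x\<bar>)" for x
    proof (cases "x \<in> {a..b} - N")
      case True
      show ?thesis
        using der[OF True] c unfolding has_vector_derivative_def has_derivative_within_alt
        by (metis real_norm_def)
    qed (auto intro: exI[of _ 1])
    then obtain d where d: "\<And>x. d x > 0"
      and dd: "\<And>x y. x \<in> {a..b} - N \<Longrightarrow> y \<in> {a..b} \<Longrightarrow> \<bar>y - x\<bar> < d x \<Longrightarrow>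
        norm (p y - p x - (y - x) *\<^sub>R g x) \<le> c * \<bar>y - x\<bar>"
      by metis
    define \<gamma> where "\<gamma> x = (if x \<in> N then U else ball x (d x))" for x
    have gauge: "gauge \<gamma>"
      using U d by (auto simp: gauge_def \<gamma>_def)
    have "norm ((\<Sum>(x,k)\<in>\<D>. content k *\<^sub>R g' x) - (p b - p a)) < e"
      if \<D>: "\<D> tagged_division_of cbox a b" and fine: "\<gamma> fine \<D>" for \<D>
    proof -
      note \<D>' = tagged_division_ofD[OF \<D>]
      have tele: "(\<Sum>(x,k)\<in>\<D>. p (Sup k) - p (Inf k)) = p b - p a"
        using additive_tagged_division_1[of a b \<D> p] ab \<D> by (simp add: cbox_interval)
      let ?A = "{z \<in> \<D>. fst z \<in> N}" and ?B = "{z \<in> \<D>. fst z \<notin> N}"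
      let ?f = "\<lambda>(x::real,k). content k *\<^sub>R g' x - (p (Sup k) - p (Inf k))"
      have split: "\<D> = ?A \<union> ?B" "?A \<inter> ?B = {}" "finite ?A" "finite ?B"
        using \<D>'(1) by auto
      have interval: "\<exists>l r. k = {l..r} \<and> l \<le> x \<and> x \<le> r \<and> a \<le> l \<and> r \<le> b \<and> k \<subseteq> \<gamma> x"
        if xk: "(x,k) \<in> \<D>" for x k
      proof -
        obtain l r where lr: "k = cbox l r" using \<D>'(4)[OF xk] by auto
        have "x \<in> k" "k \<subseteq> cbox a b" using \<D>'(2,3)[OF xk] by auto
        then show ?thesis using lr fineD[OF fine xk] by (intro exI[of _ l] exI[of _ r]) (auto simp: cbox_interval)
      qed
      have "norm (sum ?f ?B) \<le> (\<Sum>z\<in>?B. c * content (snd z))"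
      proof (rule sum_norm_le)
        fix z assume z: "z \<in> ?B"
        obtain x k where zxk: "z = (x,k)" by (cases z)
        then have xk: "(x,k) \<in> \<D>" "x \<notin> N" using z by auto
        obtain l r where lr: "k = {l..r}" "l \<le> x" "x \<le> r" "a \<le> l" "r \<le> b" "k \<subseteq> \<gamma> x"
          using interval[OF xk(1)] by blast
        have "l \<in> k" "r \<in> k" using lr by auto
        then have "l \<in> ball x (d x)" "r \<in> ball x (d x)" using lr(6) xk(2) by (auto simp: \<gamma>_def)
        then have near: "\<bar>l - x\<bar> < d x" "\<bar>r - x\<bar> < d x" by (auto simp: dist_real_def)
        have L: "norm (p l - p x - (l - x) *\<^sub>R g x) \<le> c * (x - l)"
          using dd[of x l] near lr xk(2) by auto
        have R: "norm (p r - p x - (r - x) *\<^sub>R g x) \<le> c * (r - x)"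
          using dd[of x r] near lr xk(2) by auto
        have "?f z = (p l - p x - (l - x) *\<^sub>R g x) - (p r - p x - (r - x) *\<^sub>R g x)"
          using lr xk(2) by (simp add: zxk g'_def algebra_simps)
        also have "norm \<dots> \<le> c * (x - l) + c * (r - x)"
          using L R norm_triangle_ineq4 by (meson add_mono order_trans)
        also have "\<dots> = c * content (snd z)"
          using lr by (simp add: zxk algebra_simps)
        finally show "norm (?f z) \<le> c * content (snd z)" .
      qed
      also have "\<dots> \<le> (\<Sum>z\<in>\<D>. c * content (snd z))"
        using \<D>'(1) c by (intro sum_mono2) auto
      also have "\<dots> = c * (b - a)"
        using additive_content_tagged_division[OF \<D>] ab by (simp add: sum_distrib_left[symmetric] case_prod_beta)
      finally have B: "norm (sum ?f ?B) \<le> c * (b - a)" .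
      have tagA: "?A tagged_partial_division_of cbox a b"
        by (rule tagged_partial_division_subset[of \<D>]) (use \<D> in \<open>auto simp: tagged_division_of_def\<close>)
      have tagA': "?A tagged_division_of \<Union>(snd ` ?A)"
        by (rule tagged_partial_division_of_Union_self[OF tagA])
      have divA: "snd ` ?A division_of \<Union>(snd ` ?A)"
        by (rule division_of_tagged_division[OF tagA'])
      have UA: "\<Union>(snd ` ?A) \<subseteq> {a..b}" "\<Union>(snd ` ?A) \<subseteq> U"
        using interval by (fastforce simp: \<gamma>_def)+
      \<comment> \<open>the intervals tagged in \<open>N\<close> have total length below \<open>\<delta>\<close>, since they lie in \<open>U\<close>\<close>
      have "(\<Sum>k\<in>snd ` ?A. content k) = (\<Sum>k\<in>snd ` ?A. measure lebesgue k)"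
        using interval by (intro sum.cong) force+
      also have "\<dots> = measure lebesgue (\<Union>(snd ` ?A))"
      proof (rule measure_negligible_finite_Union[symmetric])
        note dA = division_ofD[OF divA]
        show "finite (snd ` ?A)" by (rule dA(1))
        show "k \<in> lmeasurable" if "k \<in> snd ` ?A" for k using dA(4)[OF that] by auto
        show "pairwise (\<lambda>S T. negligible (S \<inter> T)) (snd ` ?A)"
        proof (rule pairwiseI)
          fix k l assume kl: "k \<in> snd ` ?A" "l \<in> snd ` ?A" "k \<noteq> l"
          have "convex (k \<inter> l)" using dA(4)[OF kl(1)] dA(4)[OF kl(2)] by (auto intro!: convex_Int)
          then show "negligible (k \<inter> l)"
            using dA(5)[OF kl] by (simp add: negligible_convex_interior)
        qed
      qed
      also have "\<dots> \<le> measure lebesgue U"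
      proof (rule measure_mono_fmeasurable[OF UA(2) _ Um])
        have "k \<in> sets lebesgue" if "k \<in> snd ` ?A" for k
          using division_ofD(4)[OF divA that] by auto
        then show "\<Union>(snd ` ?A) \<in> sets lebesgue"
          using division_ofD(1)[OF divA] by (intro sets.finite_Union) auto
      qed
      finally have small: "(\<Sum>k\<in>snd ` ?A. content k) < \<delta>" using U\<delta> by simp
      have "norm (sum ?f ?A) \<le> (\<Sum>z\<in>?A. norm (inc (snd z)))"
      proof (rule sum_norm_le)
        fix z assume z: "z \<in> ?A"
        then obtain l r where "snd z = {l..r}" "l \<le> r" using interval[of "fst z" "snd z"] by force
        then show "norm (?f z) \<le> norm (inc (snd z))"
          using z by (auto simp: g'_def inc_def case_prod_beta norm_minus_commute)
      qed
      also have "\<dots> = (\<Sum>(x,k)\<in>?A. norm (inc k))"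
        by (simp add: case_prod_beta)
      also have "\<dots> = (\<Sum>k\<in>snd ` ?A. norm (inc k))"
      proof (rule sum.over_tagged_division_lemma[OF tagA'])
        fix l r :: real assume "box l r = {}"
        then have "r \<le> l" by simp
        then show "norm (inc (cbox l r)) = 0"
          by (cases "l = r") (auto simp: inc_def)
      qed
      also have "\<dots> = (\<Sum>k\<in>snd ` ?A. cmod (p (Sup k) - p (Inf k)))"
        using interval by (intro sum.cong) (force simp: inc_def)+
      also have "\<dots> < e / 2"
        by (rule ac\<delta>[OF divA UA(1) small])
      finally have A: "norm (sum ?f ?A) < e / 2" .
      have "(\<Sum>(x,k)\<in>\<D>. content k *\<^sub>R g' x) - (p b - p a) = sum ?f \<D>"
        unfolding tele[symmetric] by (simp add: sum_subtractf case_prod_beta)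
      also have "\<dots> = sum ?f ?A + sum ?f ?B"
        using split by (metis (no_types, lifting) sum.union_disjoint)
      finally show ?thesis
        using A B cle norm_triangle_ineq[of "sum ?f ?A" "sum ?f ?B"] by simp
    qed
    then show "\<exists>\<gamma>. gauge \<gamma> \<and> (\<forall>\<D>. \<D> tagged_division_of cbox a b \<and> \<gamma> fine \<D> \<longrightarrow>
        norm ((\<Sum>(x, k)\<in>\<D>. content k *\<^sub>R g' x) - (p b - p a)) < e)"
      using gauge by blast
  qed
  then show ?thesis
    by (intro has_integral_spike[OF neg, of "{a..b}" g g']) (auto simp: g'_def)
qed

text \<open>
  Lebesgue's differentiation theorem on the line. Let \<open>E n\<close> be the set of points \<open>x\<close> that are endpoints
  of arbitrarily short intervals whose difference quotient misses \<open>g x\<close> by more than \<open>1 / (n + 1)\<close>. Short enough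
  intervals are fine for the gauge of Henstock's lemma, which bounds the total error over disjoint ones.
  Hence the disjoint intervals chosen by Vitali's covering lemma have small total length, and \<open>E n\<close> is
  contained in their fivefold enlargements.
\<close>

lemma indefinite_integral_differentiable_ae:
  fixes g :: "real \<Rightarrow> complex"
  assumes int: "g integrable_on {a..b}"
  shows "negligible {x \<in> {a..b}.
    \<not> ((\<lambda>t. integral {a..t} g) has_vector_derivative g x) (at x within {a..b})}"
proof -
  define G where "G t = integral {a..t} g" for t
  define bad where "bad n x y \<longleftrightarrow> y \<in> {a..b} \<and> y \<noteq> x \<and>
      norm (G y - G x - (y - x) *\<^sub>R g x) > \<bar>y - x\<bar> / real (Suc n)" for n x y
  define E where "E n = {x \<in> {a..b}. \<forall>d>0. \<exists>y. \<bar>y - x\<bar> < d \<and> bad n x y}" for n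
  have sub: "{x \<in> {a..b}. \<not> (G has_vector_derivative g x) (at x within {a..b})} \<subseteq> (\<Union>n. E n)"
  proof (rule subsetI, rule ccontr)
    fix x assume x: "x \<in> {x \<in> {a..b}. \<not> (G has_vector_derivative g x) (at x within {a..b})}"
      and "x \<notin> (\<Union>n. E n)"
    then have E: "\<exists>d>0. \<forall>y. \<bar>y - x\<bar> < d \<longrightarrow> \<not> bad n x y" for n by (auto simp: E_def)
    have "(G has_vector_derivative g x) (at x within {a..b})"
      unfolding has_vector_derivative_def has_derivative_within_alt
    proof (intro conjI allI impI bounded_linear_scaleR_left)
      fix e :: real assume "e > 0"
      then obtain n where n: "inverse (real (Suc n)) < e" using reals_Archimedean by blast
      obtain d where "d > 0" and d: "\<And>y. \<bar>y - x\<bar> < d \<Longrightarrow> \<not> bad n x y" using E by blast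
      have "norm (G y - G x - (y - x) *\<^sub>R g x) \<le> e * norm (y - x)" if "y \<in> {a..b}" "norm (y - x) < d" for y
      proof (cases "y = x")
        case False
        then have "norm (G y - G x - (y - x) *\<^sub>R g x) \<le> \<bar>y - x\<bar> / real (Suc n)"
          using d[of y] that by (auto simp: bad_def)
        also have "\<dots> = inverse (real (Suc n)) * \<bar>y - x\<bar>" by (simp add: divide_inverse mult.commute)
        also have "\<dots> \<le> e * \<bar>y - x\<bar>" using n by (intro mult_right_mono) auto
        finally show ?thesis by simp
      qed auto
      then show "\<exists>d>0. \<forall>y\<in>{a..b}. norm (y - x) < d \<longrightarrow> norm (G y - G x - (y - x) *\<^sub>R g x) \<le> e * norm (y - x)"
        using \<open>d > 0\<close> by blast
    qed
    then show False using x by simp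
  qed
  have negE: "negligible (E n)" for n
    unfolding negligible_outer_le
  proof (intro allI impI)
    fix e :: real assume e: "e > 0"
    \<comment> \<open>\<open>5\<close> is the enlargement factor in the covering lemma, \<open>Suc n\<close> the relative size of the error\<close>
    define e0 where "e0 = e / (5 * real (Suc n))"
    have e0: "e0 > 0" using e by (simp add: e0_def)
    obtain \<gamma> where \<gamma>: "gauge \<gamma>" and hen: "\<And>p. p tagged_partial_division_of cbox a b \<Longrightarrow> \<gamma> fine p \<Longrightarrow>
        (\<Sum>(x,k)\<in>p. norm (content k *\<^sub>R g x - integral k g)) < e0"
      using Henstock_lemma[of g a b e0] int e0 unfolding box_real(2) by blast
    define K where "K = {(x,y). x \<in> E n \<and> bad n x y \<and> {min x y..max x y} \<subseteq> \<gamma> x}"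
    \<comment> \<open>the interval between \<open>x\<close> and \<open>y\<close>, written as the ball with center \<open>m\<close> and radius \<open>r\<close>\<close>
    define m where "m z = (fst z + snd z) / 2" for z :: "real \<times> real"
    define r where "r z = \<bar>snd z - fst z\<bar> / 2" for z :: "real \<times> real"
    have cb: "cball (m z) (r z) = {min (fst z) (snd z)..max (fst z) (snd z)}" for z
      by (auto simp: m_def r_def cball_eq_atLeastAtMost min_def max_def abs_if field_simps)
    have Kx: "fst z \<in> {a..b}" "snd z \<in> {a..b}" "fst z \<noteq> snd z" if "z \<in> K" for z
      using that by (auto simp: K_def E_def bad_def)
    have cover: "E n \<subseteq> (\<Union>z\<in>K. cball (m z) (r z))"
    proof
      fix x assume x: "x \<in> E n"
      obtain d where d: "d > 0" "ball x d \<subseteq> \<gamma> x" using \<gamma> by (meson gauge_def openE)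
      obtain y where y: "\<bar>y - x\<bar> < d" "bad n x y" using x d by (auto simp: E_def)
      have "{min x y..max x y} \<subseteq> ball x d" using y by (auto simp: dist_real_def min_def max_def split: if_splits)
      then have "(x,y) \<in> K" using x y d by (auto simp: K_def)
      then show "x \<in> (\<Union>z\<in>K. cball (m z) (r z))" by (intro UN_I[of "(x,y)"]) (auto simp: cb)
    qed
    have rK: "0 < r z \<and> r z \<le> b - a" if "z \<in> K" for z
      using Kx[OF that] by (auto simp: r_def abs_if)
    obtain C where C: "countable C" "C \<subseteq> K"
        "pairwise (\<lambda>i j. disjnt (cball (m i) (r i)) (cball (m j) (r j))) C"
        "E n \<subseteq> (\<Union>i\<in>C. cball (m i) (5 * r i))"
      using Vitali_covering_lemma_cballs[OF cover rK] by blast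
    have bound: "(\<Sum>z\<in>F. measure lebesgue (cball (m z) (5 * r z))) \<le> e" if F: "F \<subseteq> C" "finite F" for F
    proof -
      define h where "h z = (fst z, cball (m z) (r z))" for z
      have FK: "z \<in> K" if "z \<in> F" for z using F C that by auto
      have injh: "inj_on h F"
        by (rule inj_onI)
          (auto simp: h_def cb prod_eq_iff min_def max_def split: if_splits)
      have sub: "cball (m z) (r z) \<subseteq> cbox a b" if "z \<in> F" for z
        using Kx[OF FK[OF that]] by (auto simp: cb)
      have tag: "h ` F tagged_partial_division_of cbox a b"
        unfolding tagged_partial_division_of_def
      proof (intro conjI allI impI)
        show "finite (h ` F)" using F by simp
      next
        fix x k assume "(x,k) \<in> h ` F"
        then obtain z where z: "z \<in> F" "x = fst z" "k = cball (m z) (r z)" by (auto simp: h_def)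
        show "x \<in> k" using z by (auto simp: cb)
        show "k \<subseteq> cbox a b" using z sub by simp
        show "\<exists>a b. k = cbox a b" unfolding z(3) cb cbox_interval[symmetric] by blast
      next
        fix x k x' k' assume *: "(x,k) \<in> h ` F \<and> (x',k') \<in> h ` F \<and> (x,k) \<noteq> (x',k')"
        then obtain z where z: "z \<in> F" "x = fst z" "k = cball (m z) (r z)" by (auto simp: h_def)
        from * obtain z' where z': "z' \<in> F" "x' = fst z'" "k' = cball (m z') (r z')" by (auto simp: h_def)
        then have "z \<noteq> z'" using * z by auto
        then have "disjnt k k'" using C(3) z z' F(1) by (auto simp: pairwise_def)
        then show "interior k \<inter> interior k' = {}"
          by (metis disjnt_def interior_Int interior_empty)
      qed
      have fine: "\<gamma> fine h ` F"
        using FK by (fastforce simp: fine_def h_def cb K_def)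
      have eq: "measure lebesgue (cball (m z) (5 * r z)) = 5 * content (cball (m z) (r z))" if "z \<in> F" for z
        using rK[OF FK[OF that]] by (simp add: cball_eq_atLeastAtMost)
      have "(\<Sum>z\<in>F. content (cball (m z) (r z)) / real (Suc n)) \<le>
          (\<Sum>z\<in>F. norm (content (cball (m z) (r z)) *\<^sub>R g (fst z) - integral (cball (m z) (r z)) g))"
      proof (rule sum_mono)
        fix z assume z: "z \<in> F"
        obtain x y where xy: "z = (x,y)" by (cases z)
        have K: "x \<in> {a..b}" "y \<in> {a..b}" "x \<noteq> y" using Kx[OF FK[OF z]] by (auto simp: xy)
        have bad: "norm (G y - G x - (y - x) *\<^sub>R g x) > \<bar>y - x\<bar> / real (Suc n)"
          using FK[OF z] by (auto simp: K_def bad_def xy)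
        have comb: "G t - G s = integral {s..t} g" if "a \<le> s" "s \<le> t" "t \<le> b" for s t
        proof -
          have "g integrable_on {a..t}"
            using int by (rule integrable_on_subinterval) (use that in auto)
          then show ?thesis
            using Henstock_Kurzweil_Integration.integral_combine[of a s t g] that
            by (simp add: G_def algebra_simps)
        qed
        show "content (cball (m z) (r z)) / real (Suc n) \<le>
          norm (content (cball (m z) (r z)) *\<^sub>R g (fst z) - integral (cball (m z) (r z)) g)"
        proof (cases "x \<le> y")
          case True
          then show ?thesis using bad comb[of x y] K
            by (simp add: cb xy norm_minus_commute)
        next
          case False
          have "norm (G y - G x - (y - x) *\<^sub>R g x) = norm (content (cball (m z) (r z)) *\<^sub>R g (fst z) - integral (cball (m z) (r z)) g)"
            using False comb[of y x] K by (simp add: cb xy algebra_simps)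
          then show ?thesis using bad False by (simp add: cb xy)
        qed
      qed
      also have "\<dots> = (\<Sum>(x,k)\<in>h ` F. norm (content k *\<^sub>R g x - integral k g))"
        unfolding sum.reindex[OF injh] by (simp add: h_def)
      also have "\<dots> < e0" by (rule hen[OF tag fine])
      finally have "(\<Sum>z\<in>F. content (cball (m z) (r z))) < real (Suc n) * e0"
        by (simp add: sum_divide_distrib[symmetric] field_simps)
      then have "5 * (\<Sum>z\<in>F. content (cball (m z) (r z))) \<le> e"
        by (simp add: e0_def del: of_nat_Suc)
      then show ?thesis using eq by (simp add: sum_distrib_left)
    qed
    have bound': "measure lebesgue (\<Union>z\<in>F. cball (m z) (5 * r z)) \<le> e"
      if F: "F \<subseteq> C" "finite F" for F
      by (rule order_trans[OF measure_UNION_le[OF F(2)] bound[OF F]]) auto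
    show "\<exists>T. E n \<subseteq> T \<and> T \<in> lmeasurable \<and> measure lebesgue T \<le> e"
    proof (intro exI conjI)
      show "(\<Union>i\<in>C. cball (m i) (5 * r i)) \<in> lmeasurable"
        by (rule fmeasurable_UN_bound[OF C(1) _ bound']) auto
      show "measure lebesgue (\<Union>i\<in>C. cball (m i) (5 * r i)) \<le> e"
        by (rule measure_UN_bound[OF C(1) _ bound']) auto
    qed (rule C(4))
  qed
  have "negligible (\<Union>n. E n)" using negE by (rule negligible_Union_nat)
  then show ?thesis using negligible_subset[OF _ sub] by (simp add: G_def[abs_def])
qed

lemma AE_lebesgue_on_iff_negligible:
  fixes a b :: real
  shows "(AE t in lebesgue_on {a..b}. P t) \<longleftrightarrow> negligible {t \<in> {a..b}. \<not> P t}"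
proof -
  have "(AE t in lebesgue_on {a..b}. P t) \<longleftrightarrow> (AE t in lebesgue. t \<in> {a..b} \<longrightarrow> P t)"
    by (rule AE_restrict_space_iff) auto
  also have "\<dots> \<longleftrightarrow> negligible {t \<in> {a..b}. \<not> P t}"
  proof
    assume "AE t in lebesgue. t \<in> {a..b} \<longrightarrow> P t"
    then obtain N where "N \<in> null_sets lebesgue" "{t \<in> space lebesgue. \<not> (t \<in> {a..b} \<longrightarrow> P t)} \<subseteq> N"
      unfolding eventually_ae_filter by blast
    then have "negligible N" "{t \<in> {a..b}. \<not> P t} \<subseteq> N"
      by (auto simp: negligible_iff_null_sets)
    then show "negligible {t \<in> {a..b}. \<not> P t}"
      by (rule negligible_subset)
  next
    assume "negligible {t \<in> {a..b}. \<not> P t}"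
    then have "{t \<in> {a..b}. \<not> P t} \<in> null_sets lebesgue"
      by (simp add: negligible_iff_null_sets)
    then show "AE t in lebesgue. t \<in> {a..b} \<longrightarrow> P t"
      by (rule AE_I') auto
  qed
  finally show ?thesis .
qed

lemma absolutely_continuous_on_subset:
  "absolutely_continuous_on S p \<Longrightarrow> S' \<subseteq> S \<Longrightarrow> absolutely_continuous_on S' p"
  unfolding absolutely_continuous_on_def by (meson order_trans)

lemma division_of_real_interval:
  fixes k :: "real set"
  assumes "D division_of J" "k \<in> D" "J \<subseteq> S"
  obtains l r where "k = {l..r}" "l \<le> r" "l \<in> S" "r \<in> S" "{l..r} \<subseteq> S"
proof -
  obtain l r where k: "k = cbox l r" using division_ofD(4)[OF assms(1,2)] by blast
  have "k \<noteq> {}" "k \<subseteq> S" using division_ofD(2,3)[OF assms(1,2)] assms(3) by auto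
  then show ?thesis using k by (intro that[of l r]) auto
qed

text \<open>
  The closure properties below, and that of Lipschitz functions, come down to bounding the increments
  of \<open>z\<close> by those of two functions that are already known to be absolutely continuous.
\<close>

lemma absolutely_continuous_on_dominated:
  assumes p: "absolutely_continuous_on S p" and q: "absolutely_continuous_on S q"
    and bound: "\<And>x y. x \<in> S \<Longrightarrow> y \<in> S \<Longrightarrow> cmod (z y - z x) \<le> K * (cmod (p y - p x) + cmod (q y - q x))"
  shows "absolutely_continuous_on S z"
  unfolding absolutely_continuous_on_def
proof (intro allI impI)
  fix e :: real assume e: "e > 0"
  define L where "L = \<bar>K\<bar> + 1"
  have L: "L > 0" "K \<le> L" by (auto simp: L_def)
  define e' where "e' = e / (2 * L)"
  have e': "e' > 0" using e L by (simp add: e'_def)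
  obtain d1 where d1: "d1 > 0" "\<And>D J. D division_of J \<and> J \<subseteq> S \<and> (\<Sum>k\<in>D. measure lborel k) < d1 \<Longrightarrow>
      (\<Sum>k\<in>D. cmod (p (Sup k) - p (Inf k))) < e'"
    using p e' unfolding absolutely_continuous_on_def by meson
  obtain d2 where d2: "d2 > 0" "\<And>D J. D division_of J \<and> J \<subseteq> S \<and> (\<Sum>k\<in>D. measure lborel k) < d2 \<Longrightarrow>
      (\<Sum>k\<in>D. cmod (q (Sup k) - q (Inf k))) < e'"
    using q e' unfolding absolutely_continuous_on_def by meson
  have "(\<Sum>k\<in>D. cmod (z (Sup k) - z (Inf k))) < e"
    if D: "D division_of J" and J: "J \<subseteq> S" and s: "(\<Sum>k\<in>D. measure lborel k) < min d1 d2" for D J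
  proof -
    have "(\<Sum>k\<in>D. cmod (z (Sup k) - z (Inf k))) \<le>
        (\<Sum>k\<in>D. L * (cmod (p (Sup k) - p (Inf k)) + cmod (q (Sup k) - q (Inf k))))"
    proof (rule sum_mono)
      fix k assume k: "k \<in> D"
      obtain l r where lr: "k = {l..r}" "l \<le> r" "l \<in> S" "r \<in> S"
        using division_of_real_interval[OF D k J] by metis
      have "cmod (z (Sup k) - z (Inf k)) \<le> K * (cmod (p (Sup k) - p (Inf k)) + cmod (q (Sup k) - q (Inf k)))"
        using bound[of l r] lr by simp
      also have "\<dots> \<le> L * (cmod (p (Sup k) - p (Inf k)) + cmod (q (Sup k) - q (Inf k)))"
        using L by (intro mult_right_mono) auto
      finally show "cmod (z (Sup k) - z (Inf k)) \<le>
        L * (cmod (p (Sup k) - p (Inf k)) + cmod (q (Sup k) - q (Inf k)))" .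
    qed
    also have "\<dots> = L * ((\<Sum>k\<in>D. cmod (p (Sup k) - p (Inf k))) + (\<Sum>k\<in>D. cmod (q (Sup k) - q (Inf k))))"
      by (simp add: sum.distrib flip: sum_distrib_left)
    also have "\<dots> < L * (e' + e')"
      using d1(2)[of D J] d2(2)[of D J] D J s L by (intro mult_strict_left_mono) auto
    also have "\<dots> = e" using L by (simp add: e'_def)
    finally show ?thesis .
  qed
  then show "\<exists>d>0. \<forall>D J. D division_of J \<and> J \<subseteq> S \<and> (\<Sum>k\<in>D. measure lborel k) < d \<longrightarrow>
      (\<Sum>k\<in>D. cmod (z (Sup k) - z (Inf k))) < e"
    using d1(1) d2(1) by (intro exI[of _ "min d1 d2"]) auto
qed

lemma absolutely_continuous_on_of_real: "absolutely_continuous_on S of_real"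
  unfolding absolutely_continuous_on_def
proof (intro allI impI)
  fix e :: real assume e: "e > 0"
  have "(\<Sum>k\<in>D. cmod (of_real (Sup k) - of_real (Inf k))) = (\<Sum>k\<in>D. measure lborel k)"
    if D: "D division_of J" for D and J :: "real set"
  proof (rule sum.cong)
    fix k assume k: "k \<in> D"
    obtain l r where "k = {l..r}" "l \<le> r"
      using division_of_real_interval[OF D k order_refl] by metis
    then show "cmod (of_real (Sup k) - of_real (Inf k)) = measure lborel k"
      by (simp flip: of_real_diff)
  qed simp
  then show "\<exists>d>0. \<forall>D J. D division_of J \<and> J \<subseteq> S \<and> (\<Sum>k\<in>D. measure lborel k) < d \<longrightarrow>
      (\<Sum>k\<in>D. cmod (of_real (Sup k) - of_real (Inf k))) < e"
    using e by (intro exI[of _ e] conjI allI impI) auto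
qed

lemma absolutely_continuous_on_lipschitz:
  assumes "\<And>x y. x \<in> S \<Longrightarrow> y \<in> S \<Longrightarrow> cmod (z y - z x) \<le> K * \<bar>y - x\<bar>"
  shows "absolutely_continuous_on S z"
proof (rule absolutely_continuous_on_dominated[OF absolutely_continuous_on_of_real absolutely_continuous_on_of_real])
  fix x y assume "x \<in> S" "y \<in> S"
  then show "cmod (z y - z x) \<le> K / 2 * (cmod (of_real y - of_real x) + cmod (of_real y - of_real x))"
    using assms[of x y] by (simp flip: of_real_diff)
qed

lemma absolutely_continuous_on_mult:
  assumes p: "absolutely_continuous_on S p" and q: "absolutely_continuous_on S q"
    and "bounded (p ` S)" and "bounded (q ` S)"
  shows "absolutely_continuous_on S (\<lambda>t. p t * q t)"
proof -
  obtain A where A: "\<And>t. t \<in> S \<Longrightarrow> cmod (p t) \<le> A"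
    using assms(3) by (auto simp: bounded_iff)
  obtain B where B: "\<And>t. t \<in> S \<Longrightarrow> cmod (q t) \<le> B"
    using assms(4) by (auto simp: bounded_iff)
  show ?thesis
  proof (rule absolutely_continuous_on_dominated[OF p q])
    fix x y assume xy: "x \<in> S" "y \<in> S"
    have "p y * q y - p x * q x = (p y - p x) * q y + p x * (q y - q x)"
      by (simp add: algebra_simps)
    also have "cmod \<dots> \<le> cmod (p y - p x) * cmod (q y) + cmod (p x) * cmod (q y - q x)"
      by (metis norm_mult norm_triangle_ineq)
    also have "\<dots> \<le> cmod (p y - p x) * max A B + max A B * cmod (q y - q x)"
      using A[OF xy(1)] B[OF xy(2)] order_trans[OF norm_ge_zero A[OF xy(1)]]
      by (intro add_mono mult_mono) auto
    finally show "cmod (p y * q y - p x * q x) \<le> max A B * (cmod (p y - p x) + cmod (q y - q x))"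
      by (simp add: algebra_simps)
  qed
qed

lemma absolutely_continuous_on_add:
  assumes "absolutely_continuous_on S p" and "absolutely_continuous_on S q"
  shows "absolutely_continuous_on S (\<lambda>t. p t + q t)"
  by (rule absolutely_continuous_on_dominated[OF assms, of _ 1])
    (simp add: norm_diff_triangle_ineq)

lemma absolutely_continuous_on_cnj:
  assumes "absolutely_continuous_on S p"
  shows "absolutely_continuous_on S (\<lambda>t. cnj (p t))"
proof (rule absolutely_continuous_on_dominated[OF assms assms, of _ 1])
  fix x y
  have "cmod (cnj (p y) - cnj (p x)) = cmod (p y - p x)"
    by (metis complex_cnj_diff complex_mod_cnj)
  then show "cmod (cnj (p y) - cnj (p x)) \<le> 1 * (cmod (p y - p x) + cmod (p y - p x))" by simp
qed

lemma absolutely_continuous_on_imp_continuous: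
  assumes ac: "absolutely_continuous_on {a..b} p"
  shows "continuous_on {a..b} p"
  unfolding continuous_on_iff
proof (intro ballI allI impI)
  fix x e :: real assume x: "x \<in> {a..b}" and e: "e > 0"
  obtain d where d: "d > 0" "\<And>D J. D division_of J \<and> J \<subseteq> {a..b} \<and> (\<Sum>k\<in>D. measure lborel k) < d \<Longrightarrow>
      (\<Sum>k\<in>D. cmod (p (Sup k) - p (Inf k))) < e"
    using ac e unfolding absolutely_continuous_on_def by meson
  have "dist (p y) (p x) < e" if y: "y \<in> {a..b}" "dist y x < d" for y
  proof -
    let ?k = "cbox (min x y) (max x y)"
    have "{?k} division_of ?k" by (rule division_of_self) auto
    moreover have "?k \<subseteq> {a..b}" using x y by auto
    moreover have "measure lborel ?k < d" using y by (auto simp: dist_real_def min_def max_def)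
    ultimately have "cmod (p (max x y) - p (min x y)) < e"
      using d(2)[of "{?k}" ?k] by (simp add: min_def max_def split: if_splits)
    then show ?thesis by (auto simp: dist_norm min_def max_def norm_minus_commute split: if_splits)
  qed
  then show "\<exists>d>0. \<forall>y\<in>{a..b}. dist y x < d \<longrightarrow> dist (p y) (p x) < e"
    using d(1) by blast
qed

text \<open>
  For square integrable \<open>g\<close> there is a quantitative reason: from \<open>\<bar>g\<bar> \<le> \<eta> \<bar>g\<bar>\<^sup>2 + 1 / \<eta>\<close> the
  integral of \<open>\<bar>g\<bar>\<close> over a set of measure \<open>\<delta>\<close> is at most \<open>\<eta> I + \<delta> / \<eta>\<close>.
\<close>

lemma absolutely_continuous_on_indefinite_integral:
  fixes g :: "real \<Rightarrow> complex"
  assumes g: "g integrable_on {a..b}" and g2: "(\<lambda>t. (cmod (g t))\<^sup>2) integrable_on {a..b}"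
  shows "absolutely_continuous_on {a..b} (\<lambda>t. c + integral {a..t} g)"
  unfolding absolutely_continuous_on_def
proof (intro allI impI)
  fix e :: real assume e: "e > 0"
  define I where "I = integral {a..b} (\<lambda>t. (cmod (g t))\<^sup>2)"
  have I: "I \<ge> 0" unfolding I_def by (rule integral_nonneg[OF g2]) auto
  define \<eta> where "\<eta> = e / (2 * (I + 1))"
  have \<eta>: "\<eta> > 0" "\<eta> * I < e / 2" using e I by (auto simp: \<eta>_def field_simps)
  have young: "cmod z \<le> \<eta> * (cmod z)\<^sup>2 + 1 / \<eta>" for z
  proof (cases "cmod z \<le> 1 / \<eta>")
    case False
    then have "1 \<le> \<eta> * cmod z" using \<eta> by (simp add: field_simps)
    then have "cmod z * 1 \<le> cmod z * (\<eta> * cmod z)" by (intro mult_left_mono) auto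
    then have "cmod z \<le> \<eta> * (cmod z)\<^sup>2" by (simp add: power2_eq_square algebra_simps)
    moreover have "0 < 1 / \<eta>" using \<eta> by simp
    ultimately show ?thesis by linarith
  qed (use \<eta> in \<open>simp add: add_increasing\<close>)
  have "(\<Sum>k\<in>D. cmod ((c + integral {a..Sup k} g) - (c + integral {a..Inf k} g))) < e"
    if D: "D division_of J" and J: "J \<subseteq> {a..b}" and s: "(\<Sum>k\<in>D. measure lborel k) < \<eta> * e / 2" for D J
  proof -
    have "(\<Sum>k\<in>D. cmod ((c + integral {a..Sup k} g) - (c + integral {a..Inf k} g))) \<le>
        (\<Sum>k\<in>D. \<eta> * integral k (\<lambda>t. (cmod (g t))\<^sup>2) + measure lborel k / \<eta>)"
    proof (rule sum_mono)
      fix k assume k: "k \<in> D"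
      obtain l r where lr: "k = {l..r}" "l \<le> r" "l \<in> {a..b}" "r \<in> {a..b}" "{l..r} \<subseteq> {a..b}"
        using division_of_real_interval[OF D k J] by metis
      have i2: "(\<lambda>t. \<eta> * (cmod (g t))\<^sup>2) integrable_on {l..r}"
        using integrable_cmul[OF integrable_on_subinterval[OF g2 lr(5)], of \<eta>] by simp
      have "g integrable_on {a..r}"
        using g by (rule integrable_on_subinterval) (use lr in auto)
      then have "(c + integral {a..Sup k} g) - (c + integral {a..Inf k} g) = integral {l..r} g"
        using Henstock_Kurzweil_Integration.integral_combine[of a l r g] lr by (simp add: algebra_simps)
      also have "norm \<dots> \<le> integral {l..r} (\<lambda>t. \<eta> * (cmod (g t))\<^sup>2 + 1 / \<eta>)"
        using i2 integrable_on_subinterval[OF g lr(5)] young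
        by (intro Henstock_Kurzweil_Integration.integral_norm_bound_integral integrable_add) auto
      also have "\<dots> = \<eta> * integral {l..r} (\<lambda>t. (cmod (g t))\<^sup>2) + (r - l) / \<eta>"
        using lr i2 by (subst Henstock_Kurzweil_Integration.integral_add) auto
      finally show "cmod ((c + integral {a..Sup k} g) - (c + integral {a..Inf k} g)) \<le>
          \<eta> * integral k (\<lambda>t. (cmod (g t))\<^sup>2) + measure lborel k / \<eta>"
        using lr by simp
    qed
    also have "\<dots> = \<eta> * integral J (\<lambda>t. (cmod (g t))\<^sup>2) + (\<Sum>k\<in>D. measure lborel k) / \<eta>"
      using integral_combine_division_topdown[OF integrable_on_subdivision[OF D g2 J] D]
      by (simp add: sum.distrib sum_distrib_left sum_divide_distrib)
    also have "\<dots> < e / 2 + e / 2"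
    proof (rule add_strict_mono)
      have "integral J (\<lambda>t. (cmod (g t))\<^sup>2) \<le> I"
        unfolding I_def by (rule integral_subset_le[OF J integrable_on_subdivision[OF D g2 J] g2]) auto
      then have "\<eta> * integral J (\<lambda>t. (cmod (g t))\<^sup>2) \<le> \<eta> * I"
        using \<eta> by (intro mult_left_mono) auto
      then show "\<eta> * integral J (\<lambda>t. (cmod (g t))\<^sup>2) < e / 2" using \<eta>(2) by simp
      show "(\<Sum>k\<in>D. measure lborel k) / \<eta> < e / 2"
        using s \<eta> by (simp add: field_simps)
    qed
    finally show ?thesis by simp
  qed
  then show "\<exists>d>0. \<forall>D J. D division_of J \<and> J \<subseteq> {a..b} \<and> (\<Sum>k\<in>D. measure lborel k) < d \<longrightarrow>
      (\<Sum>k\<in>D. cmod ((c + integral {a..Sup k} g) - (c + integral {a..Inf k} g))) < e"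
    using \<eta>(1) e by (intro exI[of _ "\<eta> * e / 2"] conjI allI impI) (simp, blast)
qed

section \<open>The scalar initial value problem\<close>

lemma absolutely_continuous_on_bounded_derivative:
  fixes z :: "real \<Rightarrow> complex"
  assumes der: "\<And>t. t \<in> {a..b} \<Longrightarrow> (z has_vector_derivative z' t) (at t within {a..b})"
    and bound: "\<And>t. t \<in> {a..b} \<Longrightarrow> cmod (z' t) \<le> K"
  shows "absolutely_continuous_on {a..b} z"
proof (rule absolutely_continuous_on_lipschitz)
  fix x y assume xy: "x \<in> {a..b}" "y \<in> {a..b}"
  have on: "onorm (\<lambda>h. h *\<^sub>R z' t) \<le> K" if "t \<in> {a..b}" for t
  proof (rule onorm_le)
    fix h show "cmod (h *\<^sub>R z' t) \<le> K * norm h"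
      using mult_left_mono[OF bound[OF that], of "\<bar>h\<bar>"] by (simp add: mult.commute)
  qed
  show "cmod (z y - z x) \<le> K * \<bar>y - x\<bar>"
    using differentiable_bound[of "{a..b}" z "\<lambda>t h. h *\<^sub>R z' t" K y x] der on xy
    by (simp add: has_vector_derivative_def)
qed

definition ode_at where
  "ode_at T a q m h y p t \<longleftrightarrow> (\<exists>p'. (p has_vector_derivative p') (at t within {0..T}) \<and>
        p' + complex_of_real (a t * m) * y t + complex_of_real (q t) * y t = h t)"

text \<open>
  A solution in the sense of \<^const>\<open>ode_solution\<close> together with its derivative \<open>p\<close>, which carries the
  coefficients of the time derivative of the solution of the Cauchy problem.
\<close>

definition ode_pair where
  "ode_pair T a q m h y0 y1 y p \<longleftrightarrow>
     (\<forall>t\<in>{0..T}. (y has_vector_derivative p t) (at t within {0..T})) \<and>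
     absolutely_continuous_on {0..T} p \<and>
     (AE t in lebesgue_on {0..T}. ode_at T a q m h y p t) \<and>
     y 0 = y0 \<and> p 0 = y1"

lemma ode_solution_iff_ode_pair:
  "ode_solution T a q m h y0 y1 y \<longleftrightarrow> (\<exists>p. ode_pair T a q m h y0 y1 y p)"
  by (simp add: ode_solution_def ode_pair_def ode_at_def)

lemma ode_pair_diff:
  assumes "ode_pair T a q m h y0 y1 y p" and "ode_pair T a q m h2 z0 z1 z r"
  shows "ode_pair T a q m (\<lambda>t. h t - h2 t) (y0 - z0) (y1 - z1) (\<lambda>t. y t - z t) (\<lambda>t. p t - r t)"
  unfolding ode_pair_def
proof (intro conjI ballI)
  fix t assume "t \<in> {0..T}"
  then show "((\<lambda>t. y t - z t) has_vector_derivative p t - r t) (at t within {0..T})"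
    using assms by (auto simp: ode_pair_def intro!: has_vector_derivative_diff)
next
  have *: "absolutely_continuous_on {0..T} p" "absolutely_continuous_on {0..T} r"
    using assms by (auto simp: ode_pair_def)
  show "absolutely_continuous_on {0..T} (\<lambda>t. p t - r t)"
  proof (rule absolutely_continuous_on_dominated[OF *, of _ 1])
    fix s t
    show "cmod (p t - r t - (p s - r s)) \<le> 1 * (cmod (p t - p s) + cmod (r t - r s))"
      using norm_triangle_ineq4[of "p t - p s" "r t - r s"] by (simp add: algebra_simps)
  qed
next
  have "AE t in lebesgue_on {0..T}. ode_at T a q m h y p t" "AE t in lebesgue_on {0..T}. ode_at T a q m h2 z r t"
    using assms by (auto simp: ode_pair_def)
  then show "AE t in lebesgue_on {0..T}. ode_at T a q m (\<lambda>t. h t - h2 t) (\<lambda>t. y t - z t) (\<lambda>t. p t - r t) t"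
  proof eventually_elim
    case (elim t)
    then obtain p' r' where *: "(p has_vector_derivative p') (at t within {0..T})"
      "p' + complex_of_real (a t * m) * y t + complex_of_real (q t) * y t = h t"
      "(r has_vector_derivative r') (at t within {0..T})"
      "r' + complex_of_real (a t * m) * z t + complex_of_real (q t) * z t = h2 t"
      unfolding ode_at_def by blast
    then show ?case
      unfolding ode_at_def
      by (intro exI[of _ "p' - r'"] conjI has_vector_derivative_diff) (auto simp: algebra_simps)
  qed
qed (use assms in \<open>auto simp: ode_pair_def\<close>)

lemma ode_pair_cong:
  assumes ode: "ode_pair T a q m h y0 y1 y p" and T: "T \<ge> 0"
    and y: "\<And>t. t \<in> {0..T} \<Longrightarrow> z t = y t"
    and h: "AE t in lebesgue_on {0..T}. h t = h' t"
  shows "ode_pair T a q m h' y0 y1 z p"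
proof -
  have inI: "AE t in lebesgue_on {0..T}. t \<in> {0..T}" by (rule AE_I2) simp
  have eq: "AE t in lebesgue_on {0..T}. ode_at T a q m h y p t"
    using ode by (auto simp: ode_pair_def)
  have "AE t in lebesgue_on {0..T}. ode_at T a q m h' z p t"
    using eq h inI
  proof eventually_elim
    case (elim t)
    then show ?case using y by (simp add: ode_at_def)
  qed
  moreover have "(z has_vector_derivative p t) (at t within {0..T})" if t: "t \<in> {0..T}" for t
    by (rule has_vector_derivative_transform[OF t]) (use ode t y in \<open>auto simp: ode_pair_def\<close>)
  moreover have "z 0 = y 0" using y T by simp
  ultimately show ?thesis using ode by (simp add: ode_pair_def)
qed

lemma has_real_derivative_norm_square:
  fixes y :: "real \<Rightarrow> complex"
  assumes "(y has_vector_derivative y') (at t within S)"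
  shows "((\<lambda>t. (cmod (y t))\<^sup>2) has_real_derivative 2 * Re (y' * cnj (y t))) (at t within S)"
proof -
  have "((\<lambda>t. y t \<bullet> y t) has_derivative (\<lambda>h. y t \<bullet> (h *\<^sub>R y') + (h *\<^sub>R y') \<bullet> y t)) (at t within S)"
    using assms unfolding has_vector_derivative_def by (intro has_derivative_inner)
  moreover have "(\<lambda>h. y t \<bullet> (h *\<^sub>R y') + (h *\<^sub>R y') \<bullet> y t) = (*) (2 * Re (y' * cnj (y t)))"
    by (auto simp: inner_complex_def algebra_simps)
  ultimately show ?thesis
    by (simp add: has_field_derivative_def power2_norm_eq_inner)
qed

text \<open>
  In the derivative of the energy \<open>a m \<bar>y\<bar>\<^sup>2 + \<bar>p\<bar>\<^sup>2\<close> the two terms with \<open>2 a m Re (p \<cdot> cnj y)\<close> cancel,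
  and these are the only ones that could not be bounded uniformly in \<open>m\<close>. What is left is at most
  \<open>C\<close> times the energy plus \<open>\<bar>h\<bar>\<^sup>2\<close>; the lower bounds on \<open>a\<close> and \<open>m\<close> serve to estimate \<open>Q \<bar>y\<bar>\<^sup>2\<close> by
  the energy. So \<open>exp (- C t)\<close> times the energy grows at most like the integral of \<open>\<bar>h\<bar>\<^sup>2\<close>, which is
  Gronwall's inequality. The constant does not depend on \<open>m\<close>, and this is what makes the estimate
  summable over all indices.
\<close>

lemma energy_estimate:
  fixes a a' q :: "real \<Rightarrow> real" and h y p :: "real \<Rightarrow> complex"
  assumes a_der: "\<And>t. t \<in> {0..T} \<Longrightarrow> (a has_real_derivative a' t) (at t within {0..T})"
    and a'_le: "\<And>t. t \<in> {0..T} \<Longrightarrow> \<bar>a' t\<bar> \<le> L"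
    and a_ge: "\<And>t. t \<in> {0..T} \<Longrightarrow> a t \<ge> a0" and a0: "a0 > 0"
    and q_le: "AE t in lebesgue_on {0..T}. \<bar>q t\<bar> \<le> Q"
    and m: "m \<ge> m0" and m0: "m0 > 0"
    and Q: "Q \<ge> 0"
    and h2: "(\<lambda>t. (cmod (h t))\<^sup>2) integrable_on {0..T}"
    and ode: "ode_pair T a q m h y0 y1 y p"
    and t: "t \<in> {0..T}"
  shows "a t * m * (cmod (y t))\<^sup>2 + (cmod (p t))\<^sup>2 \<le>
    exp ((L / a0 + 1 + Q + Q / (a0 * m0)) * T) *
      (a 0 * m * (cmod y0)\<^sup>2 + (cmod y1)\<^sup>2 + integral {0..T} (\<lambda>t. (cmod (h t))\<^sup>2))"
proof -
  \<comment> \<open>\<open>L / a0\<close> pays for \<open>a'\<close>, \<open>1\<close> for the source, \<open>Q\<close> and \<open>Q / (a0 * m0)\<close> for the two parts of the term with \<open>q\<close>\<close>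
  define C where "C = L / a0 + 1 + Q + Q / (a0 * m0)"
  define E where "E t = a t * m * (cmod (y t))\<^sup>2 + (cmod (p t))\<^sup>2" for t
  define F where "F t = exp (- C * t) * E t" for t
  have T: "0 \<le> T" using t by auto
  have m_pos: "m > 0" using m m0 by simp
  have L: "L \<ge> 0" using a'_le[OF t] by linarith
  have C: "C \<ge> 0" using L a0 m0 Q by (simp add: C_def)
  have y_der: "\<And>t. t \<in> {0..T} \<Longrightarrow> (y has_vector_derivative p t) (at t within {0..T})"
    and p_ac: "absolutely_continuous_on {0..T} p"
    and eq: "AE t in lebesgue_on {0..T}. ode_at T a q m h y p t"
    and init: "y 0 = y0" "p 0 = y1"
    using ode by (auto simp: ode_pair_def)
  have ae: "AE t in lebesgue_on {0..T}. \<bar>q t\<bar> \<le> Q \<and> ode_at T a q m h y p t"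
    using q_le eq by eventually_elim auto
  define N where "N = {t \<in> {0..T}. \<not> (\<bar>q t\<bar> \<le> Q \<and> ode_at T a q m h y p t)}"
  have N: "negligible N" using ae unfolding AE_lebesgue_on_iff_negligible N_def .
  have "\<forall>t\<in>{0..T} - N. \<exists>p'. (p has_vector_derivative p') (at t within {0..T}) \<and>
      p' + complex_of_real (a t * m) * y t + complex_of_real (q t) * y t = h t"
    by (auto simp: N_def ode_at_def)
  then obtain p' where p': "\<And>t. t \<in> {0..T} - N \<Longrightarrow> (p has_vector_derivative p' t) (at t within {0..T})"
    "\<And>t. t \<in> {0..T} - N \<Longrightarrow> p' t + complex_of_real (a t * m) * y t + complex_of_real (q t) * y t = h t"
    by metis
  have q_le': "\<bar>q t\<bar> \<le> Q" if "t \<in> {0..T} - N" for t using that by (auto simp: N_def)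
  \<comment> \<open>the value \<open>0\<close> on \<open>N\<close> keeps the bound by \<open>\<bar>h\<bar>\<^sup>2\<close> valid at every point\<close>
  define d where "d t = (if t \<in> N then 0 else exp (- C * t) *
      (- C * E t + a' t * m * (cmod (y t))\<^sup>2 + a t * m * (2 * Re (p t * cnj (y t))) + 2 * Re (p' t * cnj (p t))))" for t
  have F_der: "(F has_real_derivative d t) (at t within {0..T})" if t: "t \<in> {0..T} - N" for t
  proof -
    have t': "t \<in> {0..T}" using t by auto
    note [derivative_intros] = has_real_derivative_norm_square[OF y_der[OF t']]
      has_real_derivative_norm_square[OF p'(1)[OF t]] a_der[OF t']
    show ?thesis
      unfolding F_def E_def d_def
      by (rule derivative_eq_intros refl | (use t in \<open>simp add: algebra_simps\<close>; fail))+
  qed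
  have d_le: "d t \<le> (cmod (h t))\<^sup>2" if t: "t \<in> {0..T}" for t
  proof (cases "t \<in> N")
    case False
    then have t': "t \<in> {0..T} - N" using t by auto
    define Y where "Y = (cmod (y t))\<^sup>2"
    define P where "P = (cmod (p t))\<^sup>2"
    have YP: "Y \<ge> 0" "P \<ge> 0" by (auto simp: Y_def P_def)
    have young: "2 * \<bar>Re (z * cnj w)\<bar> \<le> (cmod z)\<^sup>2 + (cmod w)\<^sup>2" for z w
    proof -
      have "2 * \<bar>Re (z * cnj w)\<bar> \<le> 2 * (cmod z * cmod w)"
        using abs_Re_le_cmod[of "z * cnj w"] by (simp add: norm_mult)
      also have "\<dots> \<le> (cmod z)\<^sup>2 + (cmod w)\<^sup>2"
        using sum_squares_bound[of "cmod z" "cmod w"] by (simp add: mult.assoc)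
      finally show ?thesis .
    qed
    have p'_eq: "p' t = h t - complex_of_real (a t * m) * y t - complex_of_real (q t) * y t"
      using p'(2)[OF t'] by (simp add: algebra_simps)
    have p'Re: "2 * Re (p' t * cnj (p t)) = 2 * Re (h t * cnj (p t))
        - a t * m * (2 * Re (p t * cnj (y t))) - q t * (2 * Re (y t * cnj (p t)))"
      unfolding p'_eq by (simp add: algebra_simps)
    have b1: "2 * Re (h t * cnj (p t)) \<le> (cmod (h t))\<^sup>2 + P"
      using young[of "h t" "p t"] unfolding P_def by linarith
    have "\<bar>q t * (2 * Re (y t * cnj (p t)))\<bar> \<le> Q * (Y + P)"
      using young[of "y t" "p t"] q_le'[OF t'] unfolding abs_mult Y_def P_def
      by (intro mult_mono) (auto simp del: times_complex.sel)
    then have "- (q t * (2 * Re (y t * cnj (p t)))) \<le> Q * (Y + P)" by linarith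
    then have b2: "- q t * (2 * Re (y t * cnj (p t))) \<le> Q * Y + Q * P"
      by (simp add: distrib_left)
    have "a0 * m0 \<le> a t * m"
      using a_ge[OF t] m a0 m0 by (intro mult_mono) auto
    then have "Q / (a0 * m0) * (a0 * m0 * Y) \<le> Q / (a0 * m0) * (a t * m * Y)"
      using YP Q a0 m0 by (intro mult_left_mono mult_right_mono) auto
    then have b3: "Q * Y \<le> Q / (a0 * m0) * (a t * m * Y)"
      using a0 m0 by simp
    have "a' t * (m * Y) \<le> L * (m * Y)"
      using a'_le[OF t] m_pos YP by (intro mult_right_mono) auto
    also have "\<dots> = L / a0 * (a0 * (m * Y))" using a0 by simp
    also have "\<dots> \<le> L / a0 * (a t * (m * Y))"
      using a_ge[OF t] m_pos YP L a0 by (intro mult_left_mono mult_right_mono) auto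
    finally have b4: "a' t * m * Y \<le> L / a0 * (a t * m * Y)" by (simp add: mult.assoc)
    have pos: "(1 + Q) * (a t * m * Y) \<ge> 0" "(L / a0 + Q / (a0 * m0)) * P \<ge> 0"
      using Q L a0 m0 m_pos YP a_ge[OF t] by auto
    have "- C * E t + a' t * m * Y + a t * m * (2 * Re (p t * cnj (y t))) + 2 * Re (p' t * cnj (p t))
        \<le> (cmod (h t))\<^sup>2" (is "?X \<le> _")
      using b1 b2 b3 b4 pos unfolding p'Re C_def E_def Y_def[symmetric] P_def[symmetric]
      by (simp add: algebra_simps)
    then have "exp (- C * t) * ?X \<le> exp (- C * t) * (cmod (h t))\<^sup>2"
      by (intro mult_left_mono) auto
    also have "\<dots> \<le> 1 * (cmod (h t))\<^sup>2"
      using C t by (intro mult_right_mono) auto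
    finally show ?thesis using False by (simp add: d_def Y_def)
  qed (simp add: d_def)
  have p_cont: "continuous_on {0..T} p"
    by (rule absolutely_continuous_on_imp_continuous[OF p_ac])
  have y_cont: "continuous_on {0..T} y"
    using y_der has_vector_derivative_continuous by (blast intro: continuous_on_eq_continuous_within[THEN iffD2])
  have a_cont: "continuous_on {0..T} a"
    using a_der DERIV_continuous by (blast intro: continuous_on_eq_continuous_within[THEN iffD2])
  have bdd: "bounded (f ` {0..T})" if "continuous_on {0..T} f" for f :: "real \<Rightarrow> complex"
    using compact_continuous_image[OF that] compact_imp_bounded by blast
  obtain K where K: "\<And>t. t \<in> {0..T} \<Longrightarrow> cmod (p t) \<le> K"
    using bdd[OF p_cont] unfolding bounded_iff by blast
  have y_ac: "absolutely_continuous_on {0..T} y"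
    by (rule absolutely_continuous_on_bounded_derivative[OF y_der K])
  have a_ac: "absolutely_continuous_on {0..T} (\<lambda>t. complex_of_real (a t))"
  proof (rule absolutely_continuous_on_bounded_derivative)
    fix t assume t: "t \<in> {0..T}"
    show "((\<lambda>t. complex_of_real (a t)) has_vector_derivative complex_of_real (a' t)) (at t within {0..T})"
      using a_der[OF t] by (intro has_vector_derivative_of_real) (simp add: has_real_derivative_iff_has_vector_derivative)
    show "cmod (complex_of_real (a' t)) \<le> L" using a'_le[OF t] by simp
  qed
  have e_ac: "absolutely_continuous_on {0..T} (\<lambda>t. complex_of_real (exp (- C * t)))"
  proof (rule absolutely_continuous_on_bounded_derivative)
    fix t assume t: "t \<in> {0..T}"
    show "((\<lambda>t. complex_of_real (exp (- C * t))) has_vector_derivative complex_of_real (- C * exp (- C * t))) (at t within {0..T})"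
      by (intro has_vector_derivative_of_real)
        (auto intro!: derivative_eq_intros simp: has_real_derivative_iff_has_vector_derivative[symmetric])
    show "cmod (complex_of_real (- C * exp (- C * t))) \<le> C"
      using C t by (simp add: norm_mult mult_left_le)
  qed
  have m_ac: "absolutely_continuous_on {0..T} (\<lambda>t. complex_of_real m)"
    by (rule absolutely_continuous_on_lipschitz[of _ _ 0]) simp
  have F_eq: "(\<lambda>t. complex_of_real (F t)) = (\<lambda>t. complex_of_real (exp (- C * t)) *
      (complex_of_real (a t) * complex_of_real m * (y t * cnj (y t)) + p t * cnj (p t)))"
    by (simp add: F_def E_def complex_norm_square[symmetric])
  have F_ac: "absolutely_continuous_on {0..T} (\<lambda>t. complex_of_real (F t))"
    unfolding F_eq
    by (intro absolutely_continuous_on_mult absolutely_continuous_on_add absolutely_continuous_on_cnj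
      e_ac a_ac m_ac y_ac p_ac bdd continuous_intros y_cont p_cont a_cont)
  have sub: "{0..t} \<subseteq> {0..T}" using t by auto
  have "((\<lambda>t. complex_of_real (d t)) has_integral complex_of_real (F t) - complex_of_real (F 0)) {0..t}"
  proof (rule absolutely_continuous_has_integral[OF absolutely_continuous_on_subset[OF F_ac sub] N])
    fix x assume x: "x \<in> {0..t} - N"
    then have "(F has_real_derivative d x) (at x within {0..T})"
      using F_der[of x] sub by auto
    then have "(F has_real_derivative d x) (at x within {0..t})"
      using sub by (rule DERIV_subset)
    then show "((\<lambda>t. complex_of_real (F t)) has_vector_derivative complex_of_real (d x)) (at x within {0..t})"
      by (rule has_vector_derivative_of_real)
  qed (use t in auto)
  from has_integral_linear[OF this bounded_linear_Re]
  have d_int: "(d has_integral F t - F 0) {0..t}" by (simp add: o_def)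
  have h2t: "(\<lambda>t. (cmod (h t))\<^sup>2) integrable_on {0..t}"
    by (rule integrable_on_subinterval[OF h2 sub])
  have "F t - F 0 \<le> integral {0..t} (\<lambda>t. (cmod (h t))\<^sup>2)"
    by (rule has_integral_le[OF d_int integrable_integral[OF h2t]]) (use d_le sub in auto)
  also have "\<dots> \<le> integral {0..T} (\<lambda>t. (cmod (h t))\<^sup>2)"
    by (rule integral_subset_le[OF sub h2t h2]) auto
  finally have Ft: "F t \<le> E 0 + integral {0..T} (\<lambda>t. (cmod (h t))\<^sup>2)" by (simp add: F_def)
  have nonneg: "E 0 + integral {0..T} (\<lambda>t. (cmod (h t))\<^sup>2) \<ge> 0"
    using integral_nonneg[OF h2] a_ge[of 0] a0 m_pos T by (simp add: E_def)
  have "E t = exp (C * t) * F t" by (simp add: F_def exp_minus field_simps)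
  also have "\<dots> \<le> exp (C * t) * (E 0 + integral {0..T} (\<lambda>t. (cmod (h t))\<^sup>2))"
    using Ft by (intro mult_left_mono) auto
  also have "\<dots> \<le> exp (C * T) * (E 0 + integral {0..T} (\<lambda>t. (cmod (h t))\<^sup>2))"
    using nonneg C t by (intro mult_right_mono) (auto intro!: mult_left_mono)
  finally show ?thesis by (simp add: E_def C_def init)
qed

text \<open>
  Measured against the weight \<open>exp (l t)\<close>, an integration gains the factor \<open>1 / l\<close>.
\<close>

lemma norm_integral_exp_bound:
  fixes f :: "real \<Rightarrow> complex"
  assumes "f integrable_on {0..t}" and "\<And>s. s \<in> {0..t} \<Longrightarrow> cmod (f s) \<le> D * exp (l * s)"
    and "l > 0" "t \<ge> 0" "D \<ge> 0"
  shows "cmod (integral {0..t} f) \<le> D * exp (l * t) / l"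
proof -
  have "((\<lambda>s. D * exp (l * s)) has_integral (D * exp (l * t) / l - D * exp (l * 0) / l)) {0..t}"
    using assms(3) by (intro fundamental_theorem_of_calculus[OF assms(4)])
      (auto intro!: derivative_eq_intros simp: has_real_derivative_iff_has_vector_derivative[symmetric])
  then have "cmod (integral {0..t} f) \<le> D * exp (l * t) / l - D / l"
    using Henstock_Kurzweil_Integration.integral_norm_bound_integral[OF assms(1) has_integral_integrable assms(2)]
    by (metis (no_types, lifting) integral_unique exp_zero mult.right_neutral mult_zero_right)
  also have "\<dots> \<le> D * exp (l * t) / l" using assms by simp
  finally show ?thesis .
qed

lemma bounded_measurable_mult_integrable:
  fixes b :: "real \<Rightarrow> real" and w :: "real \<Rightarrow> complex"
  assumes b: "b \<in> borel_measurable (lebesgue_on {0..T})" "\<And>t. t \<in> {0..T} \<Longrightarrow> \<bar>b t\<bar> \<le> M"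
    and w: "continuous_on {0..T} w" and t: "t \<le> T"
  shows "(\<lambda>s. b s *\<^sub>R w s) integrable_on {0..t}"
proof (rule integrable_on_subinterval)
  show "(\<lambda>s. b s *\<^sub>R w s) integrable_on {0..T}"
  proof (rule measurable_bounded_by_integrable_imp_integrable)
    show "(\<lambda>s. b s *\<^sub>R w s) \<in> borel_measurable (lebesgue_on {0..T})"
      using b continuous_imp_measurable_on_sets_lebesgue[OF w] by (intro borel_measurable_scaleR) auto
    show "(\<lambda>s. M * cmod (w s)) integrable_on {0..T}"
      by (intro integrable_continuous_interval continuous_intros w)
    show "cmod (b s *\<^sub>R w s) \<le> M * cmod (w s)" if "s \<in> {0..T}" for s
      using b(2)[OF that] by (simp add: mult_right_mono)
  qed auto
qed (use t in auto)

text \<open>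
  For \<open>z t = exp (- l t) p t\<close> the equation is a fixed point problem whose two nested integrations
  contribute the factor \<open>1 / l\<close> each; with \<open>l\<^sup>2 > M\<close> it is a contraction on the whole interval. Functions
  on \<open>[0,T]\<close> are extended to the line by clamping the argument, which makes them bounded continuous
  functions.
\<close>

lemma volterra_solution:
  fixes b :: "real \<Rightarrow> real" and k :: "real \<Rightarrow> complex"
  assumes T: "T > 0" and k: "continuous_on {0..T} k"
    and b: "b \<in> borel_measurable (lebesgue_on {0..T})" "\<And>t. t \<in> {0..T} \<Longrightarrow> \<bar>b t\<bar> \<le> M"
  obtains p where "continuous_on {0..T} p"
    and "\<And>t. t \<in> {0..T} \<Longrightarrow> p t = k t - integral {0..t} (\<lambda>s. b s *\<^sub>R integral {0..s} p)"
proof -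
  have M: "M \<ge> 0" using b(2)[of 0] T by simp
  define l where "l = sqrt M + 1"
  have "sqrt M \<ge> 0" "(sqrt M)\<^sup>2 = M" using M by auto
  then have l: "l > 0" "l\<^sup>2 > M" by (simp_all add: l_def power2_sum add_nonneg_pos add_pos_nonneg)
  define pz where "pz z r = exp (l * r) *\<^sub>R apply_bcontfun z r" for z :: "real \<Rightarrow>\<^sub>C complex" and r
  define inner where "inner z s = integral {0..s} (pz z)" for z s
  define \<Psi> where "\<Psi> z t = exp (- l * t) *\<^sub>R (k t - integral {0..t} (\<lambda>s. b s *\<^sub>R inner z s))" for z t
  have pz_cont: "continuous_on S (pz z)" for z S
    unfolding pz_def by (intro continuous_intros continuous_on_apply_bcontfun)
  have pz_int: "pz z integrable_on {0..t}" for z t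
    by (rule integrable_continuous_interval[OF pz_cont])
  have inner_cont: "continuous_on {0..T} (inner z)" for z
    unfolding inner_def by (rule indefinite_integral_continuous_1[OF pz_int])
  have bi_int: "(\<lambda>s. b s *\<^sub>R inner z s) integrable_on {0..t}" if "t \<le> T" for z t
    by (rule bounded_measurable_mult_integrable[OF b inner_cont that])
  have \<Psi>_cont: "continuous_on (cbox 0 T) (\<Psi> z)" for z
    unfolding \<Psi>_def cbox_interval
    by (intro continuous_intros k indefinite_integral_continuous_1 bi_int) auto
  have "\<exists>g. \<forall>x. apply_bcontfun g x = \<Psi> z (clamp 0 T x)" for z
    using continuous_on_cbox_bcontfunE[OF \<Psi>_cont[of z]] by metis
  then obtain G where G: "\<And>z x. apply_bcontfun (G z) x = \<Psi> z (clamp 0 T x)" by metis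
  have lip: "dist (G z1) (G z2) \<le> M / l\<^sup>2 * dist z1 z2" for z1 z2
  proof (rule dist_bound)
    fix x
    define t where "t = clamp 0 T x"
    have t: "0 \<le> t" "t \<le> T" using clamp_in_interval[of 0 T x] T by (auto simp: t_def)
    let ?D = "dist z1 z2"
    have diff: "cmod (inner z1 s - inner z2 s) \<le> ?D / l * exp (l * s)" if s: "s \<in> {0..t}" for s
    proof -
      have "inner z1 s - inner z2 s = integral {0..s} (\<lambda>r. pz z1 r - pz z2 r)"
        unfolding inner_def by (rule Henstock_Kurzweil_Integration.integral_diff[symmetric, OF pz_int pz_int])
      also have "cmod \<dots> \<le> ?D * exp (l * s) / l"
      proof (rule norm_integral_exp_bound)
        show "(\<lambda>r. pz z1 r - pz z2 r) integrable_on {0..s}" by (intro integrable_diff pz_int)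
        fix r
        have "cmod (apply_bcontfun z1 r - apply_bcontfun z2 r) \<le> ?D"
          using dist_bounded[of z1 r z2] by (simp add: dist_norm)
        then show "cmod (pz z1 r - pz z2 r) \<le> ?D * exp (l * r)"
          unfolding pz_def scaleR_diff_right[symmetric] norm_scaleR
          by (simp add: mult.commute mult_left_mono)
      qed (use l s in auto)
      finally show ?thesis by simp
    qed
    have "\<Psi> z1 t - \<Psi> z2 t = exp (- l * t) *\<^sub>R
        (integral {0..t} (\<lambda>s. b s *\<^sub>R inner z2 s) - integral {0..t} (\<lambda>s. b s *\<^sub>R inner z1 s))"
      by (simp add: \<Psi>_def algebra_simps)
    also have "\<dots> = exp (- l * t) *\<^sub>R integral {0..t} (\<lambda>s. b s *\<^sub>R inner z2 s - b s *\<^sub>R inner z1 s)"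
      using t by (subst Henstock_Kurzweil_Integration.integral_diff) (auto intro: bi_int)
    also have "cmod \<dots> \<le> exp (- l * t) * (M * (?D / l) * exp (l * t) / l)"
      unfolding norm_scaleR abs_exp_cancel
    proof (intro mult_left_mono norm_integral_exp_bound integrable_diff bi_int)
      fix s assume s: "s \<in> {0..t}"
      have "cmod (b s *\<^sub>R inner z2 s - b s *\<^sub>R inner z1 s) = \<bar>b s\<bar> * cmod (inner z1 s - inner z2 s)"
        by (simp add: norm_minus_commute flip: scaleR_diff_right)
      also have "\<dots> \<le> M * (?D / l * exp (l * s))"
        using b(2)[of s] s t diff[OF s] M by (intro mult_mono) auto
      finally show "cmod (b s *\<^sub>R inner z2 s - b s *\<^sub>R inner z1 s) \<le> M * (?D / l) * exp (l * s)"
        by (simp add: mult.assoc)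
    qed (use t l M in auto)
    also have "\<dots> = M / l\<^sup>2 * ?D"
      using l by (simp add: exp_minus field_simps power2_eq_square)
    finally show "dist (apply_bcontfun (G z1) x) (apply_bcontfun (G z2) x) \<le> M / l\<^sup>2 * ?D"
      by (simp add: G t_def dist_norm)
  qed
  have "\<exists>!z. G z = z"
    by (rule banach_fix_type[of "M / l\<^sup>2"]) (use M l lip in auto)
  then obtain z where z: "G z = z" by blast
  show ?thesis
  proof (rule that[of "pz z"])
    show "continuous_on {0..T} (pz z)" by (rule pz_cont)
    fix t assume t: "t \<in> {0..T}"
    have "apply_bcontfun z t = \<Psi> z t"
      using G[of z t] t by (simp add: z)
    then show "pz z t = k t - integral {0..t} (\<lambda>s. b s *\<^sub>R integral {0..s} (pz z))"
      by (simp add: pz_def[of z t] \<Psi>_def inner_def exp_minus)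
  qed
qed

text \<open>
  The unknown is \<open>p = y'\<close>, so that \<open>y\<close> is the integral of \<open>p\<close> and the equation becomes a Volterra
  equation for \<open>p\<close>. The bound on \<open>q\<close> holds only almost everywhere; \<open>q\<close> is first changed on a null set.
  That \<open>p\<close> is absolutely continuous and solves the equation almost everywhere are the two facts
  about indefinite integrals proved above.
\<close>

lemma ode_pair_exists:
  fixes a q :: "real \<Rightarrow> real" and h :: "real \<Rightarrow> complex"
  assumes T: "T > 0"
    and a: "continuous_on {0..T} a"
    and q: "q \<in> borel_measurable (lebesgue_on {0..T})" "AE t in lebesgue_on {0..T}. \<bar>q t\<bar> \<le> Q"
    and h: "h \<in> borel_measurable (lebesgue_on {0..T})" "(\<lambda>t. (cmod (h t))\<^sup>2) integrable_on {0..T}"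
  shows "\<exists>y p. ode_pair T a q m h y0 y1 y p"
proof -
  define q' where "q' t = (if \<bar>q t\<bar> \<le> Q then q t else 0)" for t
  define b where "b t = a t * m + q' t" for t
  obtain A where A: "\<And>t. t \<in> {0..T} \<Longrightarrow> \<bar>a t\<bar> \<le> A"
    using compact_imp_bounded[OF compact_continuous_image[OF a compact_Icc]] unfolding bounded_iff by force
  define M where "M = A * \<bar>m\<bar> + \<bar>Q\<bar>"
  have b_bound: "\<bar>b t\<bar> \<le> M" if t: "t \<in> {0..T}" for t
  proof -
    have "\<bar>b t\<bar> \<le> \<bar>a t * m\<bar> + \<bar>q' t\<bar>" unfolding b_def by (rule abs_triangle_ineq)
    also have "\<dots> \<le> A * \<bar>m\<bar> + \<bar>Q\<bar>"
      using A[OF t] by (intro add_mono) (auto simp: abs_mult q'_def intro: mult_right_mono)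
    finally show ?thesis by (simp add: M_def)
  qed
  have a_meas: "a \<in> borel_measurable (lebesgue_on {0..T})"
    by (rule continuous_imp_measurable_on_sets_lebesgue[OF a]) simp
  have b_meas: "b \<in> borel_measurable (lebesgue_on {0..T})"
    unfolding b_def q'_def using a_meas q(1) by measurable
  have h_int: "h integrable_on {0..T}"
  proof (rule measurable_bounded_by_integrable_imp_integrable[OF h(1)])
    show "(\<lambda>t. 1 + (cmod (h t))\<^sup>2) integrable_on {0..T}"
      by (intro integrable_add h(2)) auto
    show "cmod (h t) \<le> 1 + (cmod (h t))\<^sup>2" for t
      using sum_squares_bound[of "cmod (h t)" 1] norm_ge_zero[of "h t"] by (simp; linarith)
  qed auto
  have by0_int: "(\<lambda>s. b s *\<^sub>R y0) integrable_on {0..t}" if "t \<le> T" for t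
    by (rule bounded_measurable_mult_integrable[OF b_meas b_bound _ that]) auto
  define k where "k t = y1 + integral {0..t} (\<lambda>s. h s - b s *\<^sub>R y0)" for t
  have k_cont: "continuous_on {0..T} k"
    unfolding k_def by (intro continuous_intros indefinite_integral_continuous_1 integrable_diff h_int by0_int) auto
  obtain p where p: "continuous_on {0..T} p"
    "\<And>t. t \<in> {0..T} \<Longrightarrow> p t = k t - integral {0..t} (\<lambda>s. b s *\<^sub>R integral {0..s} p)"
    using volterra_solution[OF T k_cont b_meas b_bound] by blast
  define y where "y t = y0 + integral {0..t} p" for t
  define g where "g t = h t - b t *\<^sub>R y t" for t
  have y_der: "(y has_vector_derivative p t) (at t within {0..T})" if "t \<in> {0..T}" for t
    unfolding y_def using integral_has_vector_derivative[OF p(1) that] by (auto intro!: derivative_eq_intros)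
  have y_cont: "continuous_on {0..T} y"
    unfolding y_def by (intro continuous_intros indefinite_integral_continuous_1 integrable_continuous_interval p(1))
  have P_cont: "continuous_on {0..T} (\<lambda>s. integral {0..s} p)"
    by (intro indefinite_integral_continuous_1 integrable_continuous_interval p(1))
  have p_eq: "p t = y1 + integral {0..t} g" if t: "t \<in> {0..T}" for t
  proof -
    have i1: "(\<lambda>s. h s - b s *\<^sub>R y0) integrable_on {0..t}"
      using t by (intro integrable_diff by0_int integrable_on_subinterval[OF h_int]) auto
    have i2: "(\<lambda>s. b s *\<^sub>R integral {0..s} p) integrable_on {0..t}"
      using t by (intro bounded_measurable_mult_integrable[OF b_meas b_bound P_cont]) auto
    have "p t = y1 + (integral {0..t} (\<lambda>s. h s - b s *\<^sub>R y0) - integral {0..t} (\<lambda>s. b s *\<^sub>R integral {0..s} p))"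
      using p(2)[OF t] by (simp add: k_def)
    also have "\<dots> = y1 + integral {0..t} g"
      unfolding Henstock_Kurzweil_Integration.integral_diff[OF i1 i2, symmetric] g_def y_def
      by (simp add: algebra_simps)
    finally show ?thesis .
  qed
  have y_meas: "y \<in> borel_measurable (lebesgue_on {0..T})"
    by (rule continuous_imp_measurable_on_sets_lebesgue[OF y_cont]) simp
  have g_meas: "g \<in> borel_measurable (lebesgue_on {0..T})"
    unfolding g_def using h(1) b_meas y_meas by measurable
  have by_int: "(\<lambda>s. b s *\<^sub>R y s) integrable_on {0..T}"
    by (rule bounded_measurable_mult_integrable[OF b_meas b_bound y_cont order_refl])
  have g_int: "g integrable_on {0..T}"
    unfolding g_def by (intro integrable_diff h_int by_int)
  have g2_int: "(\<lambda>t. (cmod (g t))\<^sup>2) integrable_on {0..T}"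
  proof (rule measurable_bounded_by_integrable_imp_integrable)
    show "(\<lambda>t. (cmod (g t))\<^sup>2) \<in> borel_measurable (lebesgue_on {0..T})" using g_meas by measurable
    show "(\<lambda>t. 2 * (cmod (h t))\<^sup>2 + 2 * (M * cmod (y t))\<^sup>2) integrable_on {0..T}"
    proof (rule integrable_add)
      show "(\<lambda>t. 2 * (cmod (h t))\<^sup>2) integrable_on {0..T}"
        using integrable_cmul[OF h(2), of 2] by simp
      show "(\<lambda>t. 2 * (M * cmod (y t))\<^sup>2) integrable_on {0..T}"
        by (intro integrable_continuous_interval continuous_intros y_cont)
    qed
    fix t assume t: "t \<in> {0..T}"
    have "cmod (g t) \<le> cmod (h t) + M * cmod (y t)"
      unfolding g_def using b_bound[OF t] norm_triangle_ineq4[of "h t" "b t *\<^sub>R y t"]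
      by (simp add: order_trans[OF _ add_left_mono] mult_right_mono)
    then have "(cmod (g t))\<^sup>2 \<le> (cmod (h t) + M * cmod (y t))\<^sup>2"
      by (intro power_mono) auto
    also have "\<dots> \<le> 2 * (cmod (h t))\<^sup>2 + 2 * (M * cmod (y t))\<^sup>2"
      using sum_squares_bound[of "cmod (h t)" "M * cmod (y t)"] unfolding power2_sum by linarith
    finally show "norm ((cmod (g t))\<^sup>2) \<le> 2 * (cmod (h t))\<^sup>2 + 2 * (M * cmod (y t))\<^sup>2" by simp
  qed auto
  have ac: "absolutely_continuous_on {0..T} (\<lambda>t. y1 + integral {0..t} g)"
    by (rule absolutely_continuous_on_indefinite_integral[OF g_int g2_int])
  have p_ac: "absolutely_continuous_on {0..T} p"
    by (rule absolutely_continuous_on_dominated[OF ac ac, of _ 1]) (simp add: p_eq)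
  have "AE t in lebesgue_on {0..T}. ((\<lambda>t. integral {0..t} g) has_vector_derivative g t) (at t within {0..T})"
    unfolding AE_lebesgue_on_iff_negligible by (rule indefinite_integral_differentiable_ae[OF g_int])
  moreover have "AE t in lebesgue_on {0..T}. t \<in> {0..T}"
    by (rule AE_I2) simp
  ultimately have "AE t in lebesgue_on {0..T}. ode_at T a q m h y p t"
    using q(2)
  proof eventually_elim
    case (elim t)
    have "((\<lambda>t. y1 + integral {0..t} g) has_vector_derivative g t) (at t within {0..T})"
      using elim(1) by (auto intro!: derivative_eq_intros)
    then have "(p has_vector_derivative g t) (at t within {0..T})"
      by (rule has_vector_derivative_transform[rotated 2]) (use elim(2) p_eq in auto)
    moreover have "g t + complex_of_real (a t * m) * y t + complex_of_real (q t) * y t = h t"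
      using elim(3) by (simp add: g_def b_def q'_def scaleR_conv_of_real algebra_simps)
    ultimately show ?case unfolding ode_at_def by blast
  qed
  then have "ode_pair T a q m h y0 y1 y p"
    unfolding ode_pair_def using y_der p_ac p_eq[of 0] T by (auto simp: y_def)
  then show ?thesis by blast
qed

lemma L2D: "f \<in> L2 \<Longrightarrow> f \<in> borel_measurable lebesgue" "f \<in> L2 \<Longrightarrow> integrable lebesgue (\<lambda>x. (cmod (f x))\<^sup>2)"
  by (auto simp: L2_def)

section \<open>The Hilbert space of square integrable functions\<close>

lemma borel_measurable_cnj:
  assumes "f \<in> borel_measurable M"
  shows "(\<lambda>x. cnj (f x)) \<in> borel_measurable M"
  by (rule measurable_compose[OF assms borel_measurable_continuous_onI[OF continuous_on_cnj[OF continuous_on_id]]])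

lemma L2_mult_cnj_integrable:
  assumes f: "f \<in> L2" and g: "g \<in> L2"
  shows "integrable lebesgue (\<lambda>x. f x * cnj (g x))"
proof (rule Bochner_Integration.integrable_bound)
  show "integrable lebesgue (\<lambda>x. (cmod (f x))\<^sup>2 + (cmod (g x))\<^sup>2)"
    using f g by (intro Bochner_Integration.integrable_add) (auto simp: L2_def)
  show "(\<lambda>x. f x * cnj (g x)) \<in> borel_measurable lebesgue"
    using L2D(1)[OF f] L2D(1)[OF g] by (intro borel_measurable_times borel_measurable_cnj) auto
  show "AE x in lebesgue. cmod (f x * cnj (g x)) \<le> norm ((cmod (f x))\<^sup>2 + (cmod (g x))\<^sup>2)"
  proof (rule AE_I2)
    fix x
    have "2 * (cmod (f x) * cmod (g x)) \<le> (cmod (f x))\<^sup>2 + (cmod (g x))\<^sup>2"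
      using sum_squares_bound[of "cmod (f x)" "cmod (g x)"] by (simp add: mult.assoc)
    moreover have "0 \<le> cmod (f x) * cmod (g x)" by simp
    ultimately show "cmod (f x * cnj (g x)) \<le> norm ((cmod (f x))\<^sup>2 + (cmod (g x))\<^sup>2)"
      unfolding norm_mult complex_mod_cnj real_norm_def by linarith
  qed
qed

lemma L2_zero [simp]: "(\<lambda>x. 0) \<in> L2"
  by (simp add: L2_def)

lemma L2_scale:
  assumes "f \<in> L2" shows "(\<lambda>x. c * f x) \<in> L2"
  using assms by (auto simp: L2_def norm_mult power_mult_distrib)

lemma L2_add:
  assumes f: "f \<in> L2" and g: "g \<in> L2"
  shows "(\<lambda>x. f x + g x) \<in> L2"
proof -
  have [measurable]: "f \<in> borel_measurable lebesgue" "g \<in> borel_measurable lebesgue"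
    using f g by (auto simp: L2_def)
  have "integrable lebesgue (\<lambda>x. (cmod (f x + g x))\<^sup>2)"
  proof (rule Bochner_Integration.integrable_bound)
    show "integrable lebesgue (\<lambda>x. 2 * (cmod (f x))\<^sup>2 + 2 * (cmod (g x))\<^sup>2)"
      using f g by (intro Bochner_Integration.integrable_add) (auto simp: L2_def)
    show "AE x in lebesgue. norm ((cmod (f x + g x))\<^sup>2) \<le> norm (2 * (cmod (f x))\<^sup>2 + 2 * (cmod (g x))\<^sup>2)"
    proof (rule AE_I2)
      fix x
      have "(cmod (f x + g x))\<^sup>2 \<le> (cmod (f x) + cmod (g x))\<^sup>2"
        by (intro power_mono norm_triangle_ineq) auto
      also have "\<dots> \<le> 2 * (cmod (f x))\<^sup>2 + 2 * (cmod (g x))\<^sup>2"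
        using sum_squares_bound[of "cmod (f x)" "cmod (g x)"] unfolding power2_sum by linarith
      finally show "norm ((cmod (f x + g x))\<^sup>2) \<le> norm (2 * (cmod (f x))\<^sup>2 + 2 * (cmod (g x))\<^sup>2)" by simp
    qed
  qed auto
  then show ?thesis by (simp add: L2_def)
qed

lemma L2_diff:
  assumes "f \<in> L2" "g \<in> L2"
  shows "(\<lambda>x. f x - g x) \<in> L2"
  using L2_add[OF assms(1) L2_scale[OF assms(2), of "- 1"]] by simp

lemma L2_sum:
  assumes "\<And>i. i \<in> F \<Longrightarrow> e i \<in> L2"
  shows "(\<lambda>x. \<Sum>i\<in>F. c i * e i x) \<in> L2"
  using assms by (induction F rule: infinite_finite_induct) (auto intro!: L2_add L2_scale)

lemma l2_inner_cnj:
  "l2_inner g f = cnj (l2_inner f g)"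
proof -
  have "l2_inner g f = (LINT x|lebesgue. cnj (f x * cnj (g x)))"
    unfolding l2_inner_def by (intro Bochner_Integration.integral_cong refl) (simp add: mult.commute)
  also have "\<dots> = cnj (l2_inner f g)"
    unfolding l2_inner_def by (rule Bochner_Integration.integral_cnj)
  finally show ?thesis .
qed

lemma l2_inner_add_left:
  assumes "f \<in> L2" "g \<in> L2" "h \<in> L2"
  shows "l2_inner (\<lambda>x. f x + g x) h = l2_inner f h + l2_inner g h"
  unfolding l2_inner_def using assms
  by (simp add: distrib_right Bochner_Integration.integral_add L2_mult_cnj_integrable)

lemma l2_inner_scale_left: "l2_inner (\<lambda>x. c * f x) h = c * l2_inner f h"
  unfolding l2_inner_def by (simp add: mult.assoc)

lemma l2_inner_diff_left:
  assumes "f \<in> L2" "g \<in> L2" "h \<in> L2"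
  shows "l2_inner (\<lambda>x. f x - g x) h = l2_inner f h - l2_inner g h"
  using l2_inner_add_left[OF assms(1) L2_scale[OF assms(2), of "- 1"] assms(3)]
    l2_inner_scale_left[of "- 1" g h] by simp

lemma l2_inner_sum_left:
  assumes "\<And>i. i \<in> F \<Longrightarrow> e i \<in> L2" "h \<in> L2"
  shows "l2_inner (\<lambda>x. \<Sum>i\<in>F. c i * e i x) h = (\<Sum>i\<in>F. c i * l2_inner (e i) h)"
  using assms(1)
proof (induction F rule: infinite_finite_induct)
  case (insert i F)
  have "l2_inner (\<lambda>x. c i * e i x + (\<Sum>i\<in>F. c i * e i x)) h =
      l2_inner (\<lambda>x. c i * e i x) h + l2_inner (\<lambda>x. \<Sum>i\<in>F. c i * e i x) h"
    using insert.prems assms(2) by (intro l2_inner_add_left L2_scale L2_sum) auto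
  then show ?case
    using insert by (simp add: l2_inner_scale_left)
qed (auto simp: l2_inner_def)

lemma l2_inner_diff_right:
  assumes "f \<in> L2" "g \<in> L2" "h \<in> L2"
  shows "l2_inner h (\<lambda>x. f x - g x) = l2_inner h f - l2_inner h g"
  unfolding l2_inner_cnj[of h "\<lambda>x. f x - g x"] l2_inner_diff_left[OF assms] l2_inner_cnj[of h f] l2_inner_cnj[of h g]
  by simp

lemma l2_inner_add_right:
  assumes "f \<in> L2" "g \<in> L2" "h \<in> L2"
  shows "l2_inner h (\<lambda>x. f x + g x) = l2_inner h f + l2_inner h g"
  unfolding l2_inner_cnj[of h "\<lambda>x. f x + g x"] l2_inner_add_left[OF assms] l2_inner_cnj[of h f] l2_inner_cnj[of h g]
  by simp

lemma l2_inner_scale_right: "l2_inner h (\<lambda>x. c * f x) = cnj c * l2_inner h f"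
  unfolding l2_inner_cnj[of h "\<lambda>x. c * f x"] l2_inner_scale_left l2_inner_cnj[of h f] by simp

lemma l2_inner_sum_right:
  assumes "\<And>i. i \<in> F \<Longrightarrow> e i \<in> L2" "h \<in> L2"
  shows "l2_inner h (\<lambda>x. \<Sum>i\<in>F. c i * e i x) = (\<Sum>i\<in>F. cnj (c i) * l2_inner h (e i))"
proof -
  have "l2_inner h (\<lambda>x. \<Sum>i\<in>F. c i * e i x) = cnj (\<Sum>i\<in>F. c i * l2_inner (e i) h)"
    using l2_inner_cnj[of h "\<lambda>x. \<Sum>i\<in>F. c i * e i x"] l2_inner_sum_left[of F e h c] assms by simp
  also have "\<dots> = (\<Sum>i\<in>F. cnj (c i) * l2_inner h (e i))"
    unfolding l2_inner_cnj[of h] by simp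
  finally show ?thesis .
qed

lemma l2_norm_nonneg [simp]: "l2_norm f \<ge> 0"
  by (simp add: l2_norm_def)

lemma l2_norm_square: "(l2_norm f)\<^sup>2 = (LINT x|lebesgue. (cmod (f x))\<^sup>2)"
  by (simp add: l2_norm_def)

lemma l2_inner_self: "l2_inner f f = of_real ((l2_norm f)\<^sup>2)"
  unfolding l2_inner_def l2_norm_square complex_norm_square[symmetric] by (rule integral_complex_of_real)

lemma l2_norm_zero [simp]: "l2_norm (\<lambda>x. 0) = 0"
  by (simp add: l2_norm_def)

lemma l2_norm_scale: "l2_norm (\<lambda>x. c * f x) = cmod c * l2_norm f"
  by (simp add: l2_norm_def norm_mult power_mult_distrib real_sqrt_mult)

lemma l2_norm_minus_commute: "l2_norm (\<lambda>x. f x - g x) = l2_norm (\<lambda>x. g x - f x)"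
  by (simp add: l2_norm_def norm_minus_commute)

lemma nn_integral_cmod_square:
  assumes "f \<in> L2"
  shows "(\<integral>\<^sup>+x. ennreal ((cmod (f x))\<^sup>2) \<partial>lebesgue) = ennreal ((l2_norm f)\<^sup>2)"
  unfolding l2_norm_square by (rule nn_integral_eq_integral[OF L2D(2)[OF assms]]) simp

lemma l2_cauchy_schwarz:
  assumes f: "f \<in> L2" and g: "g \<in> L2"
  shows "cmod (l2_inner f g) \<le> l2_norm f * l2_norm g"
proof -
  define J where "J = (LINT x|lebesgue. cmod (f x) * cmod (g x))"
  have fg: "integrable lebesgue (\<lambda>x. cmod (f x) * cmod (g x))"
    using integrable_norm[OF L2_mult_cnj_integrable[OF f g]] by (simp add: norm_mult)
  have J: "J \<ge> 0" unfolding J_def by (intro integral_nonneg_AE) simp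
  have "(\<integral>\<^sup>+x. ennreal (cmod (f x)) * ennreal (cmod (g x)) \<partial>lebesgue) = ennreal J"
    unfolding J_def ennreal_mult'[symmetric, OF norm_ge_zero] by (rule nn_integral_eq_integral[OF fg]) simp
  then have "ennreal (J\<^sup>2) = (\<integral>\<^sup>+x. ennreal (cmod (f x)) * ennreal (cmod (g x)) \<partial>lebesgue)\<^sup>2"
    using J by (simp add: ennreal_power)
  also have "\<dots> \<le> (\<integral>\<^sup>+x. (ennreal (cmod (f x)))\<^sup>2 \<partial>lebesgue) * (\<integral>\<^sup>+x. (ennreal (cmod (g x)))\<^sup>2 \<partial>lebesgue)"
    using L2D(1)[OF f] L2D(1)[OF g] by (intro Cauchy_Schwarz_nn_integral) auto
  also have "\<dots> = ennreal ((l2_norm f * l2_norm g)\<^sup>2)"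
    unfolding ennreal_power[OF norm_ge_zero] nn_integral_cmod_square[OF f] nn_integral_cmod_square[OF g]
    by (simp add: power_mult_distrib ennreal_mult)
  finally have "J\<^sup>2 \<le> (l2_norm f * l2_norm g)\<^sup>2"
    by (subst (asm) ennreal_le_iff) auto
  then have "J \<le> l2_norm f * l2_norm g" by (rule power2_le_imp_le) simp
  moreover have "cmod (l2_inner f g) \<le> J"
    using integral_norm_bound[of lebesgue "\<lambda>x. f x * cnj (g x)"] by (simp add: l2_inner_def J_def norm_mult)
  ultimately show ?thesis by linarith
qed

lemma l2_norm_triangle:
  assumes f: "f \<in> L2" and g: "g \<in> L2"
  shows "l2_norm (\<lambda>x. f x + g x) \<le> l2_norm f + l2_norm g"
proof (rule power2_le_imp_le)
  have fg: "(\<lambda>x. f x + g x) \<in> L2" by (rule L2_add[OF f g])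
  have "of_real ((l2_norm (\<lambda>x. f x + g x))\<^sup>2) =
      l2_inner f f + l2_inner g g + (l2_inner f g + cnj (l2_inner f g))"
    unfolding l2_inner_self[symmetric] l2_inner_add_left[OF f g fg]
      l2_inner_add_right[OF f g f] l2_inner_add_right[OF f g g] l2_inner_cnj[of g f] by simp
  then have "of_real ((l2_norm (\<lambda>x. f x + g x))\<^sup>2) =
      complex_of_real ((l2_norm f)\<^sup>2 + (l2_norm g)\<^sup>2 + 2 * Re (l2_inner f g))"
    by (simp add: l2_inner_self complex_add_cnj)
  then have "(l2_norm (\<lambda>x. f x + g x))\<^sup>2 = (l2_norm f)\<^sup>2 + (l2_norm g)\<^sup>2 + 2 * Re (l2_inner f g)"
    unfolding of_real_eq_iff .
  also have "\<dots> \<le> (l2_norm f + l2_norm g)\<^sup>2"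
    using l2_cauchy_schwarz[OF f g] complex_Re_le_cmod[of "l2_inner f g"] by (simp add: power2_sum)
  finally show "(l2_norm (\<lambda>x. f x + g x))\<^sup>2 \<le> (l2_norm f + l2_norm g)\<^sup>2" .
qed simp

lemma l2_norm_triangle_diff:
  assumes "f \<in> L2" "g \<in> L2" "h \<in> L2"
  shows "l2_norm (\<lambda>x. f x - h x) \<le> l2_norm (\<lambda>x. f x - g x) + l2_norm (\<lambda>x. g x - h x)"
  using l2_norm_triangle[OF L2_diff[OF assms(1,2)] L2_diff[OF assms(2,3)]] by simp

lemma l2_norm_cong_AE:
  assumes "f \<in> L2" "g \<in> L2" "AE x in lebesgue. f x = g x"
  shows "l2_norm f = l2_norm g"
proof -
  have [measurable]: "f \<in> borel_measurable lebesgue" "g \<in> borel_measurable lebesgue"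
    using assms by (auto simp: L2_def)
  have "(LINT x|lebesgue. (cmod (f x))\<^sup>2) = (LINT x|lebesgue. (cmod (g x))\<^sup>2)"
    using assms(3) by (intro integral_cong_AE) (auto elim: eventually_mono)
  then show ?thesis by (simp add: l2_norm_def)
qed

text \<open>
  The Riesz--Fischer theorem for rapidly convergent sequences. The weighted sum of \<open>2 ^ n \<bar>D n\<bar>\<^sup>2\<close> over
  the increments \<open>D n\<close> has finite integral, hence is finite almost everywhere, and
  \<open>\<bar>D n\<bar> \<le> (1/2) ^ n + 2 ^ n \<bar>D n\<bar>\<^sup>2\<close> turns this into absolute convergence of the sum of the increments.
  Fatou's lemma transfers the distance estimates to the limit.
\<close>

lemma L2_complete:
  fixes S :: "nat \<Rightarrow> 'a::euclidean_space cfun"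
  assumes S: "\<And>n. S n \<in> L2" and step: "\<And>n. l2_norm (\<lambda>x. S (Suc n) x - S n x) \<le> (1/2) ^ n"
  shows "\<exists>g\<in>L2. \<forall>n. l2_norm (\<lambda>x. g x - S n x) \<le> 2 * (1/2) ^ n"
proof -
  define D where "D n x = S (Suc n) x - S n x" for n x
  have D: "D n \<in> L2" for n unfolding D_def by (rule L2_diff[OF S S])
  have [measurable]: "S n \<in> borel_measurable lebesgue" "D n \<in> borel_measurable lebesgue" for n
    using S D by (auto simp: L2_def)
  have "(\<integral>\<^sup>+x. (\<Sum>n. ennreal (2 ^ n * (cmod (D n x))\<^sup>2)) \<partial>lebesgue) =
      (\<Sum>n. \<integral>\<^sup>+x. ennreal (2 ^ n * (cmod (D n x))\<^sup>2) \<partial>lebesgue)"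
    by (rule nn_integral_suminf) measurable
  also have "\<dots> = (\<Sum>n. ennreal (2 ^ n * (l2_norm (D n))\<^sup>2))"
    by (simp add: ennreal_mult nn_integral_cmult nn_integral_cmod_square[OF D])
  also have "\<dots> \<le> (\<Sum>n. ennreal ((1/2) ^ n))"
  proof (intro suminf_le summableI ennreal_leI)
    fix n
    have "(l2_norm (D n))\<^sup>2 \<le> ((1/2) ^ n)\<^sup>2"
      using step[of n] by (intro power_mono) (auto simp: D_def[abs_def])
    then have "2 ^ n * (l2_norm (D n))\<^sup>2 \<le> 2 ^ n * ((1/2) ^ n)\<^sup>2" by simp
    also have "\<dots> = (1/2) ^ n" by (simp add: power2_eq_square power_mult_distrib[symmetric] flip: power_mult_distrib)
    finally show "2 ^ n * (l2_norm (D n))\<^sup>2 \<le> (1/2) ^ n" .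
  qed
  also have "\<dots> = ennreal (\<Sum>n. (1/2) ^ n)"
    by (rule suminf_ennreal2) (auto intro: summable_geometric)
  finally have fin: "(\<integral>\<^sup>+x. (\<Sum>n. ennreal (2 ^ n * (cmod (D n x))\<^sup>2)) \<partial>lebesgue) \<noteq> \<infinity>"
    by (auto simp: top_unique)
  have "AE x in lebesgue. (\<Sum>n. ennreal (2 ^ n * (cmod (D n x))\<^sup>2)) \<noteq> \<infinity>"
    by (rule nn_integral_noteq_infinite[OF _ fin]) measurable
  then have conv: "AE x in lebesgue. convergent (\<lambda>n. S n x)"
  proof eventually_elim
    case (elim x)
    have s1: "summable (\<lambda>n. 2 ^ n * (cmod (D n x))\<^sup>2)"
      using elim by (intro summable_suminf_not_top) auto
    have "summable (\<lambda>n. cmod (D n x))"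
    proof (rule summable_comparison_test')
      show "summable (\<lambda>n. (1/2) ^ n + 2 ^ n * (cmod (D n x))\<^sup>2)"
        by (intro summable_add s1 summable_geometric) auto
      fix n
      show "norm (cmod (D n x)) \<le> (1/2) ^ n + 2 ^ n * (cmod (D n x))\<^sup>2"
      proof (cases "cmod (D n x) \<le> (1/2) ^ n")
        case False
        then have "1 \<le> 2 ^ n * cmod (D n x)" by (simp add: field_simps)
        then have "cmod (D n x) * 1 \<le> cmod (D n x) * (2 ^ n * cmod (D n x))" by (intro mult_left_mono) auto
        then show ?thesis by (simp add: power2_eq_square algebra_simps add_increasing)
      qed (simp add: add_increasing2)
    qed
    then have "summable (\<lambda>n. S (Suc n) x - S n x)"
      unfolding D_def by (rule summable_norm_cancel)
    then have "convergent (\<lambda>n. \<Sum>k<n. S (Suc k) x - S k x)"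
      by (simp add: summable_iff_convergent)
    moreover have "(\<Sum>k<n. S (Suc k) x - S k x) = S n x - S 0 x" for n
      using sum_lessThan_telescope[of "\<lambda>n. S n x" n] by simp
    ultimately have "convergent (\<lambda>n. S n x - S 0 x)" by simp
    from convergent_add[OF this convergent_const[of "S 0 x"]]
    show ?case by simp
  qed
  define g where "g x = lim (\<lambda>n. S n x)" for x
  have [measurable]: "g \<in> borel_measurable lebesgue"
    unfolding g_def by (intro borel_measurable_lim_metric) measurable
  have far: "l2_norm (\<lambda>x. S (n + k) x - S n x) \<le> 2 * (1/2) ^ n" for n k
  proof -
    have "l2_norm (\<lambda>x. S (n + k) x - S n x) \<le> 2 * (1/2) ^ n - 2 * (1/2) ^ (n + k)"
    proof (induction k)
      case (Suc k)
      have "l2_norm (\<lambda>x. S (n + Suc k) x - S n x) \<le>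
          l2_norm (\<lambda>x. S (n + Suc k) x - S (n + k) x) + l2_norm (\<lambda>x. S (n + k) x - S n x)"
        by (rule l2_norm_triangle_diff[OF S S S])
      then show ?case using Suc step[of "n + k"] by simp
    qed simp
    also have "\<dots> \<le> 2 * (1/2) ^ n" by simp
    finally show ?thesis .
  qed
  have bound: "(\<integral>\<^sup>+x. ennreal ((cmod (g x - S n x))\<^sup>2) \<partial>lebesgue) \<le> ennreal ((2 * (1/2) ^ n)\<^sup>2)" for n
  proof -
    have "AE x in lebesgue. ennreal ((cmod (g x - S n x))\<^sup>2) = liminf (\<lambda>m. ennreal ((cmod (S m x - S n x))\<^sup>2))"
      using conv
    proof eventually_elim
      case (elim x)
      then have "(\<lambda>m. S m x) \<longlonglongrightarrow> g x" by (simp add: g_def convergent_LIMSEQ_iff)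
      then have "(\<lambda>m. ennreal ((cmod (S m x - S n x))\<^sup>2)) \<longlonglongrightarrow> ennreal ((cmod (g x - S n x))\<^sup>2)"
        by (intro tendsto_intros)
      then show ?case by (rule lim_imp_Liminf[symmetric, rotated]) simp
    qed
    then have "(\<integral>\<^sup>+x. ennreal ((cmod (g x - S n x))\<^sup>2) \<partial>lebesgue) =
        (\<integral>\<^sup>+x. liminf (\<lambda>m. ennreal ((cmod (S m x - S n x))\<^sup>2)) \<partial>lebesgue)"
      by (rule nn_integral_cong_AE)
    also have "\<dots> \<le> liminf (\<lambda>m. \<integral>\<^sup>+x. ennreal ((cmod (S m x - S n x))\<^sup>2) \<partial>lebesgue)"
      by (rule nn_integral_liminf) measurable
    also have "\<dots> \<le> liminf (\<lambda>m. ennreal ((2 * (1/2) ^ n)\<^sup>2))"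
    proof (rule Liminf_mono)
      show "\<forall>\<^sub>F m in sequentially. (\<integral>\<^sup>+x. ennreal ((cmod (S m x - S n x))\<^sup>2) \<partial>lebesgue) \<le> ennreal ((2 * (1/2) ^ n)\<^sup>2)"
        using eventually_ge_at_top[of n]
      proof eventually_elim
        case (elim m)
        then obtain k where "m = n + k" using le_Suc_ex by blast
        then show ?case
          using power_mono[OF far[of n k], of 2]
          by (subst nn_integral_cmod_square[OF L2_diff[OF S S]]) (simp add: ennreal_leI)
      qed
    qed
    finally show ?thesis by (simp add: Liminf_const)
  qed
  have diff: "(\<lambda>x. g x - S n x) \<in> L2" for n
  proof -
    have "integrable lebesgue (\<lambda>x. (cmod (g x - S n x))\<^sup>2)"
    proof (rule integrableI_bounded)
      show "(\<integral>\<^sup>+ x. ennreal (norm ((cmod (g x - S n x))\<^sup>2)) \<partial>lebesgue) < \<infinity>"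
        using bound[of n] by (simp add: le_less_trans[OF _ ennreal_less_top])
    qed measurable
    then show ?thesis by (simp add: L2_def)
  qed
  have "g \<in> L2" using L2_add[OF diff S, of 0 0] by simp
  moreover have "l2_norm (\<lambda>x. g x - S n x) \<le> 2 * (1/2) ^ n" for n
  proof (rule power2_le_imp_le)
    have "ennreal ((l2_norm (\<lambda>x. g x - S n x))\<^sup>2) \<le> ennreal ((2 * (1/2) ^ n)\<^sup>2)"
      using bound[of n] nn_integral_cmod_square[OF diff[of n]] by simp
    then show "(l2_norm (\<lambda>x. g x - S n x))\<^sup>2 \<le> (2 * (1/2) ^ n)\<^sup>2"
      by (subst (asm) ennreal_le_iff) auto
  qed simp
  ultimately show ?thesis by blast
qed

section \<open>Riesz bases and their dual systems\<close>

lemma summable_on_small_tail: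
  fixes f :: "'i \<Rightarrow> real"
  assumes "f summable_on I" "\<epsilon> > 0"
  obtains F where "finite F" "F \<subseteq> I" "\<And>G. finite G \<Longrightarrow> G \<subseteq> I - F \<Longrightarrow> sum f G < \<epsilon>"
proof -
  obtain s where "(f has_sum s) I" using assms(1) by (auto simp: summable_on_def)
  then have "\<forall>\<^sub>F F in finite_subsets_at_top I. dist (sum f F) s < \<epsilon> / 2"
    using assms(2) by (intro tendstoD) (auto simp: has_sum_def)
  then have "\<exists>F. finite F \<and> F \<subseteq> I \<and> (\<forall>G. finite G \<and> F \<subseteq> G \<and> G \<subseteq> I \<longrightarrow> dist (sum f G) s < \<epsilon> / 2)"
    by (simp add: eventually_finite_subsets_at_top)
  then obtain F where F: "finite F" "F \<subseteq> I"
    and near: "\<And>G. finite G \<Longrightarrow> F \<subseteq> G \<Longrightarrow> G \<subseteq> I \<Longrightarrow> dist (sum f G) s < \<epsilon> / 2"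
    by metis
  show ?thesis
  proof (rule that[OF F])
    fix G assume G: "finite G" "G \<subseteq> I - F"
    have "sum f (F \<union> G) = sum f F + sum f G"
      using F G by (intro sum.union_disjoint) auto
    moreover have "\<bar>sum f F - s\<bar> < \<epsilon> / 2" "\<bar>sum f (F \<union> G) - s\<bar> < \<epsilon> / 2"
      using near[of F] near[of "F \<union> G"] F G by (auto simp: dist_real_def)
    ultimately show "sum f G < \<epsilon>" by linarith
  qed
qed

text \<open>
  The tails of the sum of \<open>\<bar>c\<bar>\<^sup>2\<close> bound the differences of partial sums. Along increasing finite sets
  with tails of order \<open>4 ^ - n\<close> the partial sums converge rapidly, and those of larger finite sets stay
  close to them.
\<close>

lemma bessel_sequence_synthesis:
  fixes e :: "'i \<Rightarrow> 'a::euclidean_space cfun"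
  assumes e: "\<And>\<xi>. \<xi> \<in> I \<Longrightarrow> e \<xi> \<in> L2"
    and bound: "\<And>F b. finite F \<Longrightarrow> F \<subseteq> I \<Longrightarrow>
      (l2_norm (\<lambda>x. \<Sum>\<xi>\<in>F. b \<xi> * e \<xi> x))\<^sup>2 \<le> K * (\<Sum>\<xi>\<in>F. (cmod (b \<xi>))\<^sup>2)"
    and c: "(\<lambda>\<xi>. (cmod (c \<xi>))\<^sup>2) summable_on I"
  shows "\<exists>g\<in>L2. ((\<lambda>F. l2_norm (\<lambda>x. g x - (\<Sum>\<xi>\<in>F. c \<xi> * e \<xi> x))) \<longlongrightarrow> 0) (finite_subsets_at_top I)"
proof -
  \<comment> \<open>so that \<open>K * \<epsilon> n\<close> is at most the square of \<open>(1/2) ^ n\<close>\<close>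
  define \<epsilon> where "\<epsilon> n = (1/4::real) ^ n / (\<bar>K\<bar> + 1)" for n
  have \<epsilon>: "\<epsilon> n > 0" "\<bar>K\<bar> * \<epsilon> n \<le> (1/4) ^ n" for n
  proof -
    show "\<epsilon> n > 0" by (simp add: \<epsilon>_def add_nonneg_pos)
    have "\<bar>K\<bar> * \<epsilon> n \<le> (\<bar>K\<bar> + 1) * \<epsilon> n" using \<open>\<epsilon> n > 0\<close> by (intro mult_right_mono) auto
    also have "\<dots> = (1/4) ^ n" by (simp add: \<epsilon>_def add_nonneg_pos)
    finally show "\<bar>K\<bar> * \<epsilon> n \<le> (1/4) ^ n" .
  qed
  have "\<exists>F. finite F \<and> F \<subseteq> I \<and> (\<forall>G. finite G \<longrightarrow> G \<subseteq> I - F \<longrightarrow> (\<Sum>\<xi>\<in>G. (cmod (c \<xi>))\<^sup>2) < \<epsilon> n)" for n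
    using summable_on_small_tail[OF c \<epsilon>(1)[of n]] by metis
  then obtain F0 where F0: "\<And>n. finite (F0 n)" "\<And>n. F0 n \<subseteq> I"
    "\<And>n G. finite G \<Longrightarrow> G \<subseteq> I - F0 n \<Longrightarrow> (\<Sum>\<xi>\<in>G. (cmod (c \<xi>))\<^sup>2) < \<epsilon> n"
    by metis
  define F where "F n = (\<Union>k\<le>n. F0 k)" for n
  have F: "finite (F n)" "F n \<subseteq> I" "F n \<subseteq> F (Suc n)" "F0 n \<subseteq> F n" for n
    using F0(1,2) by (auto simp: F_def intro: le_SucI)
  define S where "S G x = (\<Sum>\<xi>\<in>G. c \<xi> * e \<xi> x)" for G x
  have S: "S G \<in> L2" if "G \<subseteq> I" for G
    unfolding S_def using that e by (intro L2_sum) auto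
  have step: "l2_norm (\<lambda>x. S G x - S (F n) x) \<le> (1/2) ^ n" if G: "finite G" "F n \<subseteq> G" "G \<subseteq> I" for G n
  proof (rule power2_le_imp_le)
    have "S G x - S (F n) x = (\<Sum>\<xi>\<in>G - F n. c \<xi> * e \<xi> x)" for x
      unfolding S_def using G by (subst sum_diff[symmetric]) auto
    then have "(l2_norm (\<lambda>x. S G x - S (F n) x))\<^sup>2 \<le> K * (\<Sum>\<xi>\<in>G - F n. (cmod (c \<xi>))\<^sup>2)"
      using bound[of "G - F n" c] G by auto
    also have "\<dots> \<le> \<bar>K\<bar> * \<epsilon> n"
      using F0(3)[of "G - F n" n] F(4)[of n] G
      by (intro mult_mono) (auto intro: less_imp_le sum_nonneg)
    also have "\<dots> \<le> (1/4) ^ n" by (rule \<epsilon>)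
    also have "\<dots> = ((1/2) ^ n)\<^sup>2" by (simp add: power_mult[symmetric] mult.commute power_mult power2_eq_square power_mult_distrib[symmetric])
    finally show "(l2_norm (\<lambda>x. S G x - S (F n) x))\<^sup>2 \<le> ((1/2) ^ n)\<^sup>2" .
  qed simp
  obtain g where g: "g \<in> L2" "\<And>n. l2_norm (\<lambda>x. g x - S (F n) x) \<le> 2 * (1/2) ^ n"
    using L2_complete[of "\<lambda>n. S (F n)"] S[OF F(2)] step[OF F(1,3,2)] by blast
  have "((\<lambda>G. l2_norm (\<lambda>x. g x - S G x)) \<longlongrightarrow> 0) (finite_subsets_at_top I)"
  proof (rule tendstoI)
    fix r :: real assume "r > 0"
    then obtain n where n: "(1/2) ^ n < r / 3"
      using real_arch_pow_inv[of "r/3" "1/2"] by auto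
    have "l2_norm (\<lambda>x. g x - S G x) < r" if G: "finite G" "F n \<subseteq> G" "G \<subseteq> I" for G
      using l2_norm_triangle_diff[OF g(1) S[OF F(2)[of n]] S[OF G(3)]] g(2)[of n] step[OF G]
        l2_norm_minus_commute[of "S G" "S (F n)"] n by linarith
    then show "\<forall>\<^sub>F G in finite_subsets_at_top I. dist (l2_norm (\<lambda>x. g x - S G x)) 0 < r"
      unfolding eventually_finite_subsets_at_top using F(1,2)[of n] by (intro exI[of _ "F n"]) auto
  qed
  then show ?thesis using g(1) by (auto simp: S_def)
qed

lemma l2_norm_tendsto:
  assumes f: "f \<in> L2" and S: "\<forall>\<^sub>F n in Fi. S n \<in> L2"
    and lim: "((\<lambda>n. l2_norm (\<lambda>x. f x - S n x)) \<longlongrightarrow> 0) Fi"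
  shows "((\<lambda>n. l2_norm (S n)) \<longlongrightarrow> l2_norm f) Fi"
proof -
  have "((\<lambda>n. l2_norm (S n) - l2_norm f) \<longlongrightarrow> 0) Fi"
  proof (rule Lim_null_comparison[OF _ lim])
    show "\<forall>\<^sub>F n in Fi. norm (l2_norm (S n) - l2_norm f) \<le> l2_norm (\<lambda>x. f x - S n x)"
      using S
    proof eventually_elim
      case (elim n)
      have "l2_norm (S n) \<le> l2_norm (\<lambda>x. S n x - f x) + l2_norm f"
        using l2_norm_triangle[OF L2_diff[OF elim f] f] by simp
      moreover have "l2_norm f \<le> l2_norm (\<lambda>x. f x - S n x) + l2_norm (S n)"
        using l2_norm_triangle[OF L2_diff[OF f elim] elim] by simp
      ultimately show ?case using l2_norm_minus_commute[of f "S n"] by simp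
    qed
  qed
  then show ?thesis by (simp add: LIM_zero_iff)
qed

lemma l2_inner_tendsto:
  assumes f: "f \<in> L2" and S: "\<forall>\<^sub>F n in Fi. S n \<in> L2" and \<phi>: "\<phi> \<in> L2"
    and lim: "((\<lambda>n. l2_norm (\<lambda>x. f x - S n x)) \<longlongrightarrow> 0) Fi"
  shows "((\<lambda>n. l2_inner (S n) \<phi>) \<longlongrightarrow> l2_inner f \<phi>) Fi"
proof -
  have "((\<lambda>n. l2_inner (S n) \<phi> - l2_inner f \<phi>) \<longlongrightarrow> 0) Fi"
  proof (rule Lim_null_comparison[OF _ tendsto_mult_left_zero[OF lim, of "l2_norm \<phi>"]])
    show "\<forall>\<^sub>F n in Fi. cmod (l2_inner (S n) \<phi> - l2_inner f \<phi>) \<le> l2_norm (\<lambda>x. f x - S n x) * l2_norm \<phi>"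
      using S
    proof eventually_elim
      case (elim n)
      then show ?case
        using l2_cauchy_schwarz[OF L2_diff[OF f elim] \<phi>] l2_inner_diff_left[OF f elim \<phi>]
        by (simp add: norm_minus_commute)
    qed
  qed
  then show ?thesis by (simp add: LIM_zero_iff)
qed

lemma eventually_finite_subset: "\<forall>\<^sub>F F in finite_subsets_at_top I. finite F \<and> F \<subseteq> I"
  unfolding eventually_finite_subsets_at_top by (intro exI[of _ "{}"]) auto

lemma eventually_finite_subset_mem:
  "\<eta> \<in> I \<Longrightarrow> \<forall>\<^sub>F F in finite_subsets_at_top I. finite F \<and> F \<subseteq> I \<and> \<eta> \<in> F"
  unfolding eventually_finite_subsets_at_top by (intro exI[of _ "{\<eta>}"]) auto

lemma finite_combination_coefficient:
  assumes e: "\<And>\<xi>. \<xi> \<in> F \<Longrightarrow> e \<xi> \<in> L2" and \<phi>: "\<phi> \<in> L2" and F: "finite F"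
    and orth: "\<And>\<xi>. \<xi> \<in> F \<Longrightarrow> l2_inner (e \<xi>) \<phi> = (if \<xi> = \<eta> then 1 else 0)"
  shows "l2_inner (\<lambda>x. \<Sum>\<xi>\<in>F. b \<xi> * e \<xi> x) \<phi> = (if \<eta> \<in> F then b \<eta> else 0)"
proof -
  have "l2_inner (\<lambda>x. \<Sum>\<xi>\<in>F. b \<xi> * e \<xi> x) \<phi> = (\<Sum>\<xi>\<in>F. b \<xi> * l2_inner (e \<xi>) \<phi>)"
    using e \<phi> by (rule l2_inner_sum_left)
  also have "\<dots> = (\<Sum>\<xi>\<in>F. if \<xi> = \<eta> then b \<xi> else 0)"
    using orth by (intro sum.cong) auto
  finally show ?thesis using F by simp
qed

lemma series_coefficient:
  assumes e: "\<And>\<xi>. \<xi> \<in> I \<Longrightarrow> e \<xi> \<in> L2" and \<phi>: "\<phi> \<in> L2" and \<eta>: "\<eta> \<in> I"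
    and orth: "\<And>\<xi>. \<xi> \<in> I \<Longrightarrow> l2_inner (e \<xi>) \<phi> = (if \<xi> = \<eta> then 1 else 0)"
    and g: "g \<in> L2"
    and lim: "((\<lambda>F. l2_norm (\<lambda>x. g x - (\<Sum>\<xi>\<in>F. c \<xi> * e \<xi> x))) \<longlongrightarrow> 0) (finite_subsets_at_top I)"
  shows "l2_inner g \<phi> = c \<eta>"
proof (rule tendsto_unique[OF finite_subsets_at_top_neq_bot])
  have "\<forall>\<^sub>F F in finite_subsets_at_top I. (\<lambda>x. \<Sum>\<xi>\<in>F. c \<xi> * e \<xi> x) \<in> L2"
    using eventually_finite_subset by (rule eventually_mono) (rule L2_sum, use e in auto)
  then show "((\<lambda>F. l2_inner (\<lambda>x. \<Sum>\<xi>\<in>F. c \<xi> * e \<xi> x) \<phi>) \<longlongrightarrow> l2_inner g \<phi>) (finite_subsets_at_top I)"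
    by (rule l2_inner_tendsto[OF g _ \<phi> lim])
  show "((\<lambda>F. l2_inner (\<lambda>x. \<Sum>\<xi>\<in>F. c \<xi> * e \<xi> x) \<phi>) \<longlongrightarrow> c \<eta>) (finite_subsets_at_top I)"
  proof (rule tendsto_eventually, use eventually_finite_subset_mem[OF \<eta>] in eventually_elim)
    case (elim F)
    then show ?case
      using finite_combination_coefficient[of F e \<phi> \<eta> c] e \<phi> orth by auto
  qed
qed

text \<open>
  A Riesz basis with its dual system. The two Riesz constants are parameters because the constant in
  the final estimate is built from them.
\<close>

locale riesz_pair =
  fixes I :: "'i set" and u v :: "'i \<Rightarrow> 'a::euclidean_space cfun" and A B :: real
  assumes u_L2: "\<And>\<xi>. \<xi> \<in> I \<Longrightarrow> u \<xi> \<in> L2"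
    and v_L2: "\<And>\<xi>. \<xi> \<in> I \<Longrightarrow> v \<xi> \<in> L2"
    and biorth: "\<And>\<xi> \<eta>. \<xi> \<in> I \<Longrightarrow> \<eta> \<in> I \<Longrightarrow> l2_inner (u \<xi>) (v \<eta>) = (if \<xi> = \<eta> then 1 else 0)"
    and dense: "\<And>f e. f \<in> L2 \<Longrightarrow> e > 0 \<Longrightarrow>
      \<exists>F b. finite F \<and> F \<subseteq> I \<and> l2_norm (\<lambda>x. f x - (\<Sum>\<xi>\<in>F. b \<xi> * u \<xi> x)) < e"
    and A: "A > 0" and B: "B > 0"
    and lower: "\<And>F b. finite F \<Longrightarrow> F \<subseteq> I \<Longrightarrow>
      A * (\<Sum>\<xi>\<in>F. (cmod (b \<xi>))\<^sup>2) \<le> (l2_norm (\<lambda>x. \<Sum>\<xi>\<in>F. b \<xi> * u \<xi> x))\<^sup>2"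
    and upper: "\<And>F b. finite F \<Longrightarrow> F \<subseteq> I \<Longrightarrow>
      (l2_norm (\<lambda>x. \<Sum>\<xi>\<in>F. b \<xi> * u \<xi> x))\<^sup>2 \<le> B * (\<Sum>\<xi>\<in>F. (cmod (b \<xi>))\<^sup>2)"
begin

lemma u_comb_L2: "F \<subseteq> I \<Longrightarrow> (\<lambda>x. \<Sum>\<xi>\<in>F. b \<xi> * u \<xi> x) \<in> L2"
  by (rule L2_sum) (use u_L2 in auto)

lemma v_comb_L2: "F \<subseteq> I \<Longrightarrow> (\<lambda>x. \<Sum>\<xi>\<in>F. b \<xi> * v \<xi> x) \<in> L2"
  by (rule L2_sum) (use v_L2 in auto)

lemma coefficient_u_comb:
  assumes "finite F" "F \<subseteq> I" "\<eta> \<in> I"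
  shows "l2_inner (\<lambda>x. \<Sum>\<xi>\<in>F. b \<xi> * u \<xi> x) (v \<eta>) = (if \<eta> \<in> F then b \<eta> else 0)"
  using assms u_L2 v_L2 biorth by (intro finite_combination_coefficient) auto

lemma biorth_swap: "\<xi> \<in> I \<Longrightarrow> \<eta> \<in> I \<Longrightarrow> l2_inner (v \<xi>) (u \<eta>) = (if \<xi> = \<eta> then 1 else 0)"
  unfolding l2_inner_cnj[of "v \<xi>"] using biorth by auto

lemma eventually_u_comb_L2:
  "\<forall>\<^sub>F F in finite_subsets_at_top I. (\<lambda>x. \<Sum>\<xi>\<in>F. b \<xi> * u \<xi> x) \<in> L2"
  using eventually_finite_subset by (rule eventually_mono) (blast intro: u_comb_L2)

text \<open>
  Bessel's inequality for a family is dual to the boundedness of its synthesis map: \<open>f\<close> is paired with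
  the combination whose coefficients are those of \<open>f\<close>.
\<close>

lemma bessel_from_synthesis:
  assumes e: "\<And>\<xi>. \<xi> \<in> F \<Longrightarrow> e \<xi> \<in> L2" and f: "f \<in> L2" and K: "K \<ge> 0"
    and bound: "\<And>b. (l2_norm (\<lambda>x. \<Sum>\<xi>\<in>F. b \<xi> * e \<xi> x))\<^sup>2 \<le> K * (\<Sum>\<xi>\<in>F. (cmod (b \<xi>))\<^sup>2)"
  shows "(\<Sum>\<xi>\<in>F. (cmod (l2_inner f (e \<xi>)))\<^sup>2) \<le> K * (l2_norm f)\<^sup>2"
proof -
  define b where "b \<xi> = l2_inner f (e \<xi>)" for \<xi>
  define s where "s = (\<Sum>\<xi>\<in>F. (cmod (b \<xi>))\<^sup>2)"
  have s: "s \<ge> 0" by (auto simp: s_def intro: sum_nonneg)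
  have "l2_inner f (\<lambda>x. \<Sum>\<xi>\<in>F. b \<xi> * e \<xi> x) = (\<Sum>\<xi>\<in>F. cnj (b \<xi>) * b \<xi>)"
    using e f by (simp add: l2_inner_sum_right b_def)
  also have "\<dots> = of_real s"
    by (simp add: s_def complex_norm_square mult.commute del: of_real_power)
  finally have "s = cmod (l2_inner f (\<lambda>x. \<Sum>\<xi>\<in>F. b \<xi> * e \<xi> x))" using s by simp
  also have "\<dots> \<le> l2_norm f * l2_norm (\<lambda>x. \<Sum>\<xi>\<in>F. b \<xi> * e \<xi> x)"
    using e f by (intro l2_cauchy_schwarz L2_sum)
  finally have "s\<^sup>2 \<le> (l2_norm f * l2_norm (\<lambda>x. \<Sum>\<xi>\<in>F. b \<xi> * e \<xi> x))\<^sup>2"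
    using s by (intro power_mono)
  also have "\<dots> \<le> (l2_norm f)\<^sup>2 * (K * s)"
    unfolding power_mult_distrib s_def by (intro mult_left_mono bound) auto
  finally have *: "s * s \<le> K * (l2_norm f)\<^sup>2 * s" by (simp add: power2_eq_square mult_ac)
  show ?thesis
  proof (cases "s = 0")
    case True
    then show ?thesis using K by (simp add: s_def b_def)
  next
    case False
    then have "s \<le> K * (l2_norm f)\<^sup>2" using * s by simp
    then show ?thesis by (simp add: s_def b_def)
  qed
qed

lemma bessel_u:
  assumes "f \<in> L2" "finite F" "F \<subseteq> I"
  shows "(\<Sum>\<xi>\<in>F. (cmod (l2_inner f (u \<xi>)))\<^sup>2) \<le> B * (l2_norm f)\<^sup>2"
  using assms u_L2 B upper by (intro bessel_from_synthesis) auto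

text \<open>
  For a finite combination of the \<open>u \<xi>\<close> the coefficients are the ones in the lower Riesz bound. Both sides
  are continuous in \<open>f\<close>, and finite combinations are dense.
\<close>

lemma bessel_v:
  assumes f: "f \<in> L2" and F: "finite F" "F \<subseteq> I"
  shows "(\<Sum>\<xi>\<in>F. (cmod (l2_inner f (v \<xi>)))\<^sup>2) \<le> (l2_norm f)\<^sup>2 / A"
proof -
  have comb: "(\<Sum>\<xi>\<in>F. (cmod (l2_inner g (v \<xi>)))\<^sup>2) \<le> (l2_norm g)\<^sup>2 / A"
    if G: "finite G" "G \<subseteq> I" and g: "g = (\<lambda>x. \<Sum>\<xi>\<in>G. b \<xi> * u \<xi> x)" for G b g
  proof -
    have "(\<Sum>\<xi>\<in>F. (cmod (l2_inner g (v \<xi>)))\<^sup>2) = (\<Sum>\<xi>\<in>F. if \<xi> \<in> G then (cmod (b \<xi>))\<^sup>2 else 0)"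
      unfolding g using F by (intro sum.cong refl) (auto simp: coefficient_u_comb[OF G])
    also have "\<dots> \<le> (\<Sum>\<xi>\<in>F \<union> G. if \<xi> \<in> G then (cmod (b \<xi>))\<^sup>2 else 0)"
      using F G by (intro sum_mono2) auto
    also have "\<dots> = (\<Sum>\<xi>\<in>G. (cmod (b \<xi>))\<^sup>2)"
      using F G by (intro sum.mono_neutral_cong_right) auto
    also have "\<dots> \<le> (l2_norm g)\<^sup>2 / A"
      using lower[OF G, of b] A by (simp add: g field_simps)
    finally show ?thesis .
  qed
  have "\<exists>G b. finite G \<and> G \<subseteq> I \<and> l2_norm (\<lambda>x. f x - (\<Sum>\<xi>\<in>G. b \<xi> * u \<xi> x)) < 1 / real (Suc n)" for n
    by (rule dense[OF f]) simp
  then obtain G b where G: "\<And>n. finite (G n)" "\<And>n. G n \<subseteq> I"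
    and near: "\<And>n. l2_norm (\<lambda>x. f x - (\<Sum>\<xi>\<in>G n. b n \<xi> * u \<xi> x)) < 1 / real (Suc n)"
    by metis
  define g where "g n x = (\<Sum>\<xi>\<in>G n. b n \<xi> * u \<xi> x)" for n x
  have g: "\<forall>\<^sub>F n in sequentially. g n \<in> L2"
    unfolding g_def by (intro always_eventually allI u_comb_L2 G)
  have lim: "(\<lambda>n. l2_norm (\<lambda>x. f x - g n x)) \<longlonglongrightarrow> 0"
  proof (rule Lim_null_comparison)
    show "(\<lambda>n. 1 / real (Suc n)) \<longlonglongrightarrow> 0" by (rule LIMSEQ_Suc[OF lim_1_over_n])
    show "\<forall>\<^sub>F n in sequentially. norm (l2_norm (\<lambda>x. f x - g n x)) \<le> 1 / real (Suc n)"
      unfolding g_def using near by (intro always_eventually allI) (simp add: less_imp_le)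
  qed
  show ?thesis
  proof (rule LIMSEQ_le)
    show "(\<lambda>n. \<Sum>\<xi>\<in>F. (cmod (l2_inner (g n) (v \<xi>)))\<^sup>2) \<longlonglongrightarrow> (\<Sum>\<xi>\<in>F. (cmod (l2_inner f (v \<xi>)))\<^sup>2)"
      using F by (intro tendsto_intros l2_inner_tendsto[OF f g v_L2 lim]) auto
    show "(\<lambda>n. (l2_norm (g n))\<^sup>2 / A) \<longlonglongrightarrow> (l2_norm f)\<^sup>2 / A"
      using A by (intro tendsto_intros l2_norm_tendsto[OF f g lim]) auto
    have "(\<Sum>\<xi>\<in>F. (cmod (l2_inner (g n) (v \<xi>)))\<^sup>2) \<le> (l2_norm (g n))\<^sup>2 / A" for n
      by (rule comb[OF G(1)[of n] G(2)[of n], where b = "b n"]) (simp add: g_def[abs_def])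
    then show "\<exists>N. \<forall>n\<ge>N. (\<Sum>\<xi>\<in>F. (cmod (l2_inner (g n) (v \<xi>)))\<^sup>2) \<le> (l2_norm (g n))\<^sup>2 / A"
      by blast
  qed
qed

text \<open>
  The square of the norm is the pairing of the combination with itself, to which Bessel's inequality
  for \<open>v\<close> applies.
\<close>

lemma upper_v:
  assumes F: "finite F" "F \<subseteq> I"
  shows "(l2_norm (\<lambda>x. \<Sum>\<xi>\<in>F. b \<xi> * v \<xi> x))\<^sup>2 \<le> 1 / A * (\<Sum>\<xi>\<in>F. (cmod (b \<xi>))\<^sup>2)"
proof -
  define f where "f x = (\<Sum>\<xi>\<in>F. b \<xi> * v \<xi> x)" for x
  have f: "f \<in> L2" unfolding f_def by (rule v_comb_L2[OF F(2)])
  define s where "s = (\<Sum>\<xi>\<in>F. (cmod (b \<xi>))\<^sup>2)"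
  have s: "s \<ge> 0" by (auto simp: s_def intro: sum_nonneg)
  have "of_real ((l2_norm f)\<^sup>2) = (\<Sum>\<xi>\<in>F. cnj (b \<xi>) * l2_inner f (v \<xi>))"
    unfolding l2_inner_self[symmetric]
    using l2_inner_sum_right[of F v f b] F v_L2 f by (auto simp: f_def[abs_def])
  then have "(l2_norm f)\<^sup>2 = cmod (\<Sum>\<xi>\<in>F. cnj (b \<xi>) * l2_inner f (v \<xi>))"
    by (metis abs_of_nonneg norm_of_real zero_le_power2)
  also have "\<dots> \<le> (\<Sum>\<xi>\<in>F. cmod (b \<xi>) * cmod (l2_inner f (v \<xi>)))"
    by (rule order_trans[OF norm_sum]) (simp add: norm_mult)
  also have "\<dots> \<le> L2_set (\<lambda>\<xi>. cmod (b \<xi>)) F * L2_set (\<lambda>\<xi>. cmod (l2_inner f (v \<xi>))) F"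
    using L2_set_mult_ineq[of "\<lambda>\<xi>. cmod (b \<xi>)" "\<lambda>\<xi>. cmod (l2_inner f (v \<xi>))" F] by simp
  finally have "((l2_norm f)\<^sup>2)\<^sup>2 \<le> (L2_set (\<lambda>\<xi>. cmod (b \<xi>)) F * L2_set (\<lambda>\<xi>. cmod (l2_inner f (v \<xi>))) F)\<^sup>2"
    by (intro power_mono) auto
  also have "\<dots> = s * (\<Sum>\<xi>\<in>F. (cmod (l2_inner f (v \<xi>)))\<^sup>2)"
    by (simp add: power_mult_distrib L2_set_def s_def sum_nonneg)
  also have "\<dots> \<le> s * ((l2_norm f)\<^sup>2 / A)"
    using s by (intro mult_left_mono bessel_v f F)
  finally have *: "(l2_norm f)\<^sup>2 * (l2_norm f)\<^sup>2 \<le> 1 / A * s * (l2_norm f)\<^sup>2"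
    by (simp add: power2_eq_square mult_ac)
  have "(l2_norm f)\<^sup>2 \<le> 1 / A * s"
  proof (cases "l2_norm f = 0")
    case False
    then show ?thesis using * by (simp only: mult_le_cancel_right) auto
  qed (use s A in auto)
  then show ?thesis by (simp add: f_def[abs_def] s_def)
qed

text \<open>
  The partial sum operators are uniformly bounded, and on a finite combination of the \<open>u \<xi>\<close> they
  are exact as soon as \<open>F\<close> contains its indices.
\<close>

lemma expansion_u:
  assumes f: "f \<in> L2"
  shows "((\<lambda>F. l2_norm (\<lambda>x. f x - (\<Sum>\<xi>\<in>F. l2_inner f (v \<xi>) * u \<xi> x))) \<longlongrightarrow> 0) (finite_subsets_at_top I)"
proof (rule tendstoI)
  fix e :: real assume e: "e > 0"
  define L where "L = 1 + sqrt (B / A)"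
  have L: "L > 0" using A B by (simp add: L_def add_pos_nonneg)
  obtain G b where G: "finite G" "G \<subseteq> I" and near: "l2_norm (\<lambda>x. f x - (\<Sum>\<xi>\<in>G. b \<xi> * u \<xi> x)) < e / L"
    using dense[OF f, of "e / L"] e L by auto
  define g where "g x = (\<Sum>\<xi>\<in>G. b \<xi> * u \<xi> x)" for x
  have g: "g \<in> L2" unfolding g_def by (rule u_comb_L2[OF G(2)])
  define k where "k x = f x - g x" for x
  have k: "k \<in> L2" unfolding k_def by (rule L2_diff[OF f g])
  have "l2_norm (\<lambda>x. f x - (\<Sum>\<xi>\<in>F. l2_inner f (v \<xi>) * u \<xi> x)) < e"
    if F: "finite F" "G \<subseteq> F" "F \<subseteq> I" for F
  proof -
    have "(\<Sum>\<xi>\<in>F. l2_inner g (v \<xi>) * u \<xi> x) = g x" for x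
    proof -
      have "(\<Sum>\<xi>\<in>F. l2_inner g (v \<xi>) * u \<xi> x) = (\<Sum>\<xi>\<in>F. if \<xi> \<in> G then b \<xi> * u \<xi> x else 0)"
        unfolding g_def using F by (intro sum.cong refl) (auto simp: coefficient_u_comb[OF G])
      also have "\<dots> = g x"
        unfolding g_def using F by (intro sum.mono_neutral_cong_right) auto
      finally show ?thesis .
    qed
    moreover have "l2_inner k (v \<xi>) = l2_inner f (v \<xi>) - l2_inner g (v \<xi>)" if "\<xi> \<in> F" for \<xi>
      unfolding k_def using l2_inner_diff_left[OF f g] v_L2 that F by auto
    ultimately have eq: "f x - (\<Sum>\<xi>\<in>F. l2_inner f (v \<xi>) * u \<xi> x) = k x - (\<Sum>\<xi>\<in>F. l2_inner k (v \<xi>) * u \<xi> x)" for x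
      by (simp add: k_def left_diff_distrib sum_subtractf)
    have "(l2_norm (\<lambda>x. \<Sum>\<xi>\<in>F. l2_inner k (v \<xi>) * u \<xi> x))\<^sup>2 \<le> B * (\<Sum>\<xi>\<in>F. (cmod (l2_inner k (v \<xi>)))\<^sup>2)"
      by (rule upper[OF F(1,3)])
    also have "\<dots> \<le> B * ((l2_norm k)\<^sup>2 / A)"
      using B bessel_v[OF k F(1,3)] by (intro mult_left_mono) auto
    also have "\<dots> = (sqrt (B / A) * l2_norm k)\<^sup>2"
      using A B by (simp add: power_mult_distrib)
    finally have P: "l2_norm (\<lambda>x. \<Sum>\<xi>\<in>F. l2_inner k (v \<xi>) * u \<xi> x) \<le> sqrt (B / A) * l2_norm k"
      by (rule power2_le_imp_le) (use A B in auto)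
    have "l2_norm (\<lambda>x. k x - (\<Sum>\<xi>\<in>F. l2_inner k (v \<xi>) * u \<xi> x)) \<le>
        l2_norm k + l2_norm (\<lambda>x. - 1 * (\<Sum>\<xi>\<in>F. l2_inner k (v \<xi>) * u \<xi> x))"
      using l2_norm_triangle[OF k L2_scale[OF u_comb_L2[OF F(3)], of "- 1"]] by simp
    also have "\<dots> = l2_norm k + l2_norm (\<lambda>x. \<Sum>\<xi>\<in>F. l2_inner k (v \<xi>) * u \<xi> x)"
      by (subst l2_norm_scale) simp
    also have "\<dots> \<le> L * l2_norm k"
      using P by (simp add: L_def algebra_simps)
    also have "\<dots> < e"
      using near L by (simp add: k_def[abs_def] g_def field_simps)
    finally show ?thesis unfolding eq .
  qed
  then show "\<forall>\<^sub>F F in finite_subsets_at_top I. dist (l2_norm (\<lambda>x. f x - (\<Sum>\<xi>\<in>F. l2_inner f (v \<xi>) * u \<xi> x))) 0 < e"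
    unfolding eventually_finite_subsets_at_top using G by (intro exI[of _ G]) auto
qed

lemma parseval:
  assumes f: "f \<in> L2" and \<phi>: "\<phi> \<in> L2"
  shows "((\<lambda>\<xi>. l2_inner f (v \<xi>) * l2_inner (u \<xi>) \<phi>) has_sum l2_inner f \<phi>) I"
  unfolding has_sum_def
proof (rule Lim_transform_eventually[OF l2_inner_tendsto[OF f eventually_u_comb_L2 \<phi> expansion_u[OF f]]])
  show "\<forall>\<^sub>F F in finite_subsets_at_top I. l2_inner (\<lambda>x. \<Sum>\<xi>\<in>F. l2_inner f (v \<xi>) * u \<xi> x) \<phi> =
      (\<Sum>\<xi>\<in>F. l2_inner f (v \<xi>) * l2_inner (u \<xi>) \<phi>)"
    using eventually_finite_subset
    by (rule eventually_mono) (rule l2_inner_sum_left, use u_L2 \<phi> in auto)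
qed

lemma summable_coefficients_v:
  assumes "f \<in> L2"
  shows "(\<lambda>\<xi>. (cmod (l2_inner f (v \<xi>)))\<^sup>2) summable_on I"
  using bessel_v[OF assms] by (intro nonneg_bdd_above_summable_on bdd_aboveI2) auto

lemma summable_coefficients_u:
  assumes "f \<in> L2"
  shows "(\<lambda>\<xi>. (cmod (l2_inner f (u \<xi>)))\<^sup>2) summable_on I"
  using bessel_u[OF assms] by (intro nonneg_bdd_above_summable_on bdd_aboveI2) auto

lemma norm_lower_bound:
  assumes "f \<in> L2"
  shows "A * (\<Sum>\<^sub>\<infinity>\<xi>\<in>I. (cmod (l2_inner f (v \<xi>)))\<^sup>2) \<le> (l2_norm f)\<^sup>2"
proof -
  have "(\<Sum>\<^sub>\<infinity>\<xi>\<in>I. (cmod (l2_inner f (v \<xi>)))\<^sup>2) \<le> (l2_norm f)\<^sup>2 / A"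
    by (rule infsum_le_finite_sums[OF summable_coefficients_v[OF assms] bessel_v[OF assms]])
  then show ?thesis using A by (simp add: field_simps)
qed

lemma norm_upper_bound:
  assumes f: "f \<in> L2"
  shows "(l2_norm f)\<^sup>2 \<le> B * (\<Sum>\<^sub>\<infinity>\<xi>\<in>I. (cmod (l2_inner f (v \<xi>)))\<^sup>2)"
proof (rule tendsto_upperbound)
  show "((\<lambda>F. (l2_norm (\<lambda>x. \<Sum>\<xi>\<in>F. l2_inner f (v \<xi>) * u \<xi> x))\<^sup>2) \<longlongrightarrow> (l2_norm f)\<^sup>2) (finite_subsets_at_top I)"
    by (intro tendsto_power l2_norm_tendsto[OF f eventually_u_comb_L2 expansion_u[OF f]])
  show "\<forall>\<^sub>F F in finite_subsets_at_top I. (l2_norm (\<lambda>x. \<Sum>\<xi>\<in>F. l2_inner f (v \<xi>) * u \<xi> x))\<^sup>2 \<le>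
      B * (\<Sum>\<^sub>\<infinity>\<xi>\<in>I. (cmod (l2_inner f (v \<xi>)))\<^sup>2)"
    using eventually_finite_subset
  proof eventually_elim
    case (elim F)
    then have "(\<Sum>\<xi>\<in>F. (cmod (l2_inner f (v \<xi>)))\<^sup>2) \<le> (\<Sum>\<^sub>\<infinity>\<xi>\<in>I. (cmod (l2_inner f (v \<xi>)))\<^sup>2)"
      by (intro finite_sum_le_infsum summable_coefficients_v f) auto
    then show ?case
      using upper[of F "\<lambda>\<xi>. l2_inner f (v \<xi>)"] elim B by (meson mult_left_mono less_imp_le order_trans)
  qed
qed simp

lemma synthesis_u:
  assumes c: "(\<lambda>\<xi>. (cmod (c \<xi>))\<^sup>2) summable_on I"
  obtains g where "g \<in> L2" "\<And>\<xi>. \<xi> \<in> I \<Longrightarrow> l2_inner g (v \<xi>) = c \<xi>"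
proof -
  obtain g where g: "g \<in> L2"
    "((\<lambda>F. l2_norm (\<lambda>x. g x - (\<Sum>\<xi>\<in>F. c \<xi> * u \<xi> x))) \<longlongrightarrow> 0) (finite_subsets_at_top I)"
    using bessel_sequence_synthesis[OF u_L2 upper c] by blast
  have "l2_inner g (v \<eta>) = c \<eta>" if "\<eta> \<in> I" for \<eta>
    by (rule series_coefficient[OF u_L2 v_L2[OF that] that _ g]) (use biorth that in auto)
  then show ?thesis using g(1) that by blast
qed

lemma zero_if_orthogonal_u:
  assumes f: "f \<in> L2" and orth: "\<And>\<xi>. \<xi> \<in> I \<Longrightarrow> l2_inner (u \<xi>) f = 0"
  shows "l2_norm f = 0"
proof -
  have "((\<lambda>\<xi>. l2_inner f (v \<xi>) * l2_inner (u \<xi>) f) has_sum 0) I"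
    by (rule has_sum_0) (use orth in auto)
  then have "l2_inner f f = 0"
    using parseval[OF f f] has_sum_unique by blast
  then show ?thesis by (simp add: l2_inner_self)
qed

text \<open>
  The series converges by \<open>bessel_sequence_synthesis\<close>; its limit has the same coefficients as \<open>f\<close> and
  agrees with \<open>f\<close> because the \<open>u \<xi>\<close> are complete.
\<close>

lemma expansion_v:
  assumes f: "f \<in> L2"
  shows "((\<lambda>F. l2_norm (\<lambda>x. f x - (\<Sum>\<xi>\<in>F. l2_inner f (u \<xi>) * v \<xi> x))) \<longlongrightarrow> 0) (finite_subsets_at_top I)"
proof -
  let ?S = "\<lambda>F x. \<Sum>\<xi>\<in>F. l2_inner f (u \<xi>) * v \<xi> x"
  obtain g where g: "g \<in> L2"
    "((\<lambda>F. l2_norm (\<lambda>x. g x - ?S F x)) \<longlongrightarrow> 0) (finite_subsets_at_top I)"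
    using bessel_sequence_synthesis[OF v_L2 upper_v summable_coefficients_u[OF f]] by blast
  have "l2_inner (u \<eta>) (\<lambda>x. f x - g x) = 0" if \<eta>: "\<eta> \<in> I" for \<eta>
  proof -
    have "l2_inner g (u \<eta>) = l2_inner f (u \<eta>)"
      by (rule series_coefficient[OF v_L2 u_L2[OF \<eta>] \<eta> _ g]) (use biorth_swap \<eta> in auto)
    then have "l2_inner (\<lambda>x. f x - g x) (u \<eta>) = 0"
      using l2_inner_diff_left[OF f g(1) u_L2[OF \<eta>]] by simp
    then show ?thesis using l2_inner_cnj[of "u \<eta>" "\<lambda>x. f x - g x"] by simp
  qed
  then have fg: "l2_norm (\<lambda>x. f x - g x) = 0"
    by (intro zero_if_orthogonal_u L2_diff f g(1))
  show ?thesis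
  proof (rule Lim_null_comparison[OF _ g(2)], use eventually_finite_subset in eventually_elim)
    case (elim F)
    then show ?case
      using l2_norm_triangle_diff[OF f g(1) v_comb_L2, of F "\<lambda>\<xi>. l2_inner f (u \<xi>)"] fg by simp
  qed
qed

end

section \<open>Test functions and distributions in coordinates\<close>

lemma has_sum_single_index:
  fixes f :: "'i \<Rightarrow> 'b::{topological_comm_monoid_add, t2_space}"
  assumes "\<eta> \<in> I" "\<And>\<xi>. \<xi> \<in> I \<Longrightarrow> \<xi> \<noteq> \<eta> \<Longrightarrow> f \<xi> = 0"
  shows "(f has_sum f \<eta>) I"
  by (rule has_sum_finite_neutralI[of "{\<eta>}"]) (use assms in auto)

text \<open>
  The uniform lower bound \<open>m0\<close> is what makes the Sobolev spaces decrease with their order.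
\<close>

locale riesz_operator = riesz_pair I u v A B
  for I :: "'i set" and u v :: "'i \<Rightarrow> 'a::euclidean_space cfun" and A B :: real +
  fixes \<mu> :: "'i \<Rightarrow> real" and m0 :: real
  assumes m0: "m0 > 0" and \<mu>: "\<And>\<xi>. \<xi> \<in> I \<Longrightarrow> \<mu> \<xi> \<ge> m0"
begin

abbreviation "Hs \<equiv> H_adj I u v \<mu>"
abbreviation "test \<equiv> test_space Hs"
abbreviation "Sob \<equiv> sobolev I u v \<mu>"
abbreviation "Snorm \<equiv> sobolev_norm I u v \<mu>"
abbreviation "L2Snorm \<equiv> L2_sobolev_norm I u v \<mu>"
abbreviation "Diff \<equiv> dist_diff I u v \<mu>"
abbreviation "Scale \<equiv> dist_scale I u v \<mu>"

lemma \<mu>_pos: "\<xi> \<in> I \<Longrightarrow> \<mu> \<xi> > 0"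
  using \<mu> m0 by (meson less_le_trans)

lemma powr_half_square: "(\<mu> \<xi> powr (r / 2))\<^sup>2 = \<mu> \<xi> powr r"
  by (simp add: power2_eq_square powr_add[symmetric])

lemma H_op_coefficients:
  assumes "(f, g) \<in> H_op I u v \<mu>" and \<eta>: "\<eta> \<in> I"
  shows "l2_inner g (v \<eta>) = of_real (\<mu> \<eta>) * l2_inner f (v \<eta>)"
proof (rule series_coefficient[OF u_L2 v_L2[OF \<eta>] \<eta>])
  show "g \<in> L2" "((\<lambda>F. l2_norm (\<lambda>x. g x - (\<Sum>\<xi>\<in>F. of_real (\<mu> \<xi>) * l2_inner f (v \<xi>) * u \<xi> x))) \<longlongrightarrow> 0)
      (finite_subsets_at_top I)"
    using assms(1) by (auto simp: H_op_def)
qed (use biorth \<eta> in auto)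

lemma H_op_eigenfunction:
  assumes \<eta>: "\<eta> \<in> I"
  shows "(u \<eta>, \<lambda>x. of_real (\<mu> \<eta>) * u \<eta> x) \<in> H_op I u v \<mu>"
proof -
  have "\<forall>\<^sub>F F in finite_subsets_at_top I. l2_norm (\<lambda>x. of_real (\<mu> \<eta>) * u \<eta> x -
      (\<Sum>\<xi>\<in>F. of_real (\<mu> \<xi>) * l2_inner (u \<eta>) (v \<xi>) * u \<xi> x)) = 0"
    using eventually_finite_subset_mem[OF \<eta>]
  proof eventually_elim
    case (elim F)
    have "(\<Sum>\<xi>\<in>F. of_real (\<mu> \<xi>) * l2_inner (u \<eta>) (v \<xi>) * u \<xi> x) =
        (\<Sum>\<xi>\<in>F. if \<xi> = \<eta> then of_real (\<mu> \<xi>) * u \<xi> x else 0)" for x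
      using elim \<eta> biorth by (intro sum.cong refl) auto
    then show ?case using elim by simp
  qed
  from tendsto_eventually[OF this] show ?thesis
    using u_L2[OF \<eta>] L2_scale[OF u_L2[OF \<eta>]] by (simp add: H_op_def)
qed

text \<open>
  In coordinates the adjoint is multiplication of \<open>l2_inner (u \<xi>) \<phi>\<close> by \<open>\<mu> \<xi>\<close>: pairing with the
  eigenfunctions shows one direction, Parseval's identity the other.
\<close>

lemma H_adj_iff:
  "(\<phi>, \<psi>) \<in> Hs \<longleftrightarrow> \<phi> \<in> L2 \<and> \<psi> \<in> L2 \<and> (\<forall>\<xi>\<in>I. l2_inner (u \<xi>) \<psi> = of_real (\<mu> \<xi>) * l2_inner (u \<xi>) \<phi>)"
proof safe
  assume "(\<phi>, \<psi>) \<in> Hs"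
  then have *: "\<phi> \<in> L2" "\<psi> \<in> L2" "\<And>f g. (f, g) \<in> H_op I u v \<mu> \<Longrightarrow> l2_inner g \<phi> = l2_inner f \<psi>"
    by (auto simp: H_adj_def adjoint_graph_def)
  show "\<phi> \<in> L2" "\<psi> \<in> L2" by (rule *)+
  show "l2_inner (u \<xi>) \<psi> = of_real (\<mu> \<xi>) * l2_inner (u \<xi>) \<phi>" if "\<xi> \<in> I" for \<xi>
    using *(3)[OF H_op_eigenfunction[OF that]] by (simp add: l2_inner_scale_left)
next
  assume L2: "\<phi> \<in> L2" "\<psi> \<in> L2"
    and eq: "\<forall>\<xi>\<in>I. l2_inner (u \<xi>) \<psi> = of_real (\<mu> \<xi>) * l2_inner (u \<xi>) \<phi>"
  have "l2_inner g \<phi> = l2_inner f \<psi>" if fg: "(f, g) \<in> H_op I u v \<mu>" for f g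
  proof -
    have fgL2: "f \<in> L2" "g \<in> L2" using fg by (auto simp: H_op_def)
    have "((\<lambda>\<xi>. l2_inner g (v \<xi>) * l2_inner (u \<xi>) \<phi>) has_sum l2_inner g \<phi>) I"
      by (rule parseval[OF fgL2(2) L2(1)])
    also have "?this \<longleftrightarrow> ((\<lambda>\<xi>. l2_inner f (v \<xi>) * l2_inner (u \<xi>) \<psi>) has_sum l2_inner g \<phi>) I"
      using H_op_coefficients[OF fg] eq by (intro has_sum_cong) auto
    finally show ?thesis using parseval[OF fgL2(1) L2(2)] has_sum_unique by blast
  qed
  then show "(\<phi>, \<psi>) \<in> Hs" using L2 by (auto simp: H_adj_def adjoint_graph_def)
qed

lemma relpow_coefficients:
  assumes "(\<phi>, \<psi>) \<in> Hs ^^ k" "\<phi> \<in> L2"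
  shows "\<psi> \<in> L2 \<and> (\<forall>\<xi>\<in>I. l2_inner (u \<xi>) \<psi> = of_real (\<mu> \<xi> ^ k) * l2_inner (u \<xi>) \<phi>)"
  using assms
proof (induction k arbitrary: \<psi>)
  case (Suc k)
  then obtain \<omega> where "(\<phi>, \<omega>) \<in> Hs ^^ k" "(\<omega>, \<psi>) \<in> Hs" by auto
  then show ?case using Suc.IH[of \<omega>] Suc.prems(2) by (auto simp: H_adj_iff)
qed auto

lemma relpow_linear:
  assumes "(\<phi>, \<psi>) \<in> Hs ^^ k" "(\<phi>', \<psi>') \<in> Hs ^^ k"
  shows "(\<lambda>x. \<phi> x + c * \<phi>' x, \<lambda>x. \<psi> x + c * \<psi>' x) \<in> Hs ^^ k"
  using assms
proof (induction k arbitrary: \<psi> \<psi>')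
  case (Suc k)
  obtain \<omega> where \<omega>: "(\<phi>, \<omega>) \<in> Hs ^^ k" "(\<omega>, \<psi>) \<in> Hs" using Suc.prems(1) by auto
  obtain \<omega>' where \<omega>': "(\<phi>', \<omega>') \<in> Hs ^^ k" "(\<omega>', \<psi>') \<in> Hs" using Suc.prems(2) by auto
  have "(\<lambda>x. \<omega> x + c * \<omega>' x, \<lambda>x. \<psi> x + c * \<psi>' x) \<in> Hs"
    unfolding H_adj_iff
  proof (intro conjI ballI)
    fix \<xi> assume \<xi>: "\<xi> \<in> I"
    have *: "l2_inner (u \<xi>) (\<lambda>x. f x + c * g x) = l2_inner (u \<xi>) f + cnj c * l2_inner (u \<xi>) g"
      if "f \<in> L2" "g \<in> L2" for f g
      using that u_L2[OF \<xi>] by (simp add: l2_inner_add_right L2_scale l2_inner_scale_right)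
    show "l2_inner (u \<xi>) (\<lambda>x. \<psi> x + c * \<psi>' x) = of_real (\<mu> \<xi>) * l2_inner (u \<xi>) (\<lambda>x. \<omega> x + c * \<omega>' x)"
      using \<omega>(2) \<omega>'(2) \<xi> by (simp add: H_adj_iff * algebra_simps)
  qed (use \<omega>(2) \<omega>'(2) in \<open>auto simp: H_adj_iff intro: L2_add L2_scale\<close>)
  then show ?case using Suc.IH[OF \<omega>(1) \<omega>'(1)] by auto
qed auto

lemma relpow_dual_eigenfunction:
  assumes "\<eta> \<in> I"
  shows "(v \<eta>, \<lambda>x. of_real (\<mu> \<eta> ^ k) * v \<eta> x) \<in> Hs ^^ k"
proof (induction k)
  case (Suc k)
  have "(\<lambda>x. of_real (\<mu> \<eta> ^ k) * v \<eta> x, \<lambda>x. of_real (\<mu> \<eta> ^ Suc k) * v \<eta> x) \<in> Hs"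
    unfolding H_adj_iff l2_inner_scale_right using assms v_L2 biorth
    by (auto intro!: L2_scale)
  then show ?case using Suc by auto
qed simp

lemma test_iff: "\<phi> \<in> test \<longleftrightarrow> (\<forall>k. \<exists>\<psi>. (\<phi>, \<psi>) \<in> Hs ^^ k)"
  by (auto simp: test_space_def)

lemma test_L2: "\<phi> \<in> test \<Longrightarrow> \<phi> \<in> L2"
  unfolding test_iff by (drule spec[of _ 1]) (auto simp: H_adj_iff)

lemma power_apply_relpow: "\<phi> \<in> test \<Longrightarrow> (\<phi>, power_apply Hs k \<phi>) \<in> Hs ^^ k"
  unfolding power_apply_def test_iff by (rule someI_ex[of "\<lambda>\<psi>. (\<phi>, \<psi>) \<in> Hs ^^ k"]) blast

lemma power_apply_L2: "\<phi> \<in> test \<Longrightarrow> power_apply Hs k \<phi> \<in> L2"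
  using relpow_coefficients[OF power_apply_relpow test_L2] by blast

lemma power_apply_coefficient:
  "\<phi> \<in> test \<Longrightarrow> \<xi> \<in> I \<Longrightarrow> l2_inner (u \<xi>) (power_apply Hs k \<phi>) = of_real (\<mu> \<xi> ^ k) * l2_inner (u \<xi>) \<phi>"
  using relpow_coefficients[OF power_apply_relpow test_L2] by blast

lemma test_linear:
  assumes "\<phi> \<in> test" "\<psi> \<in> test"
  shows "(\<lambda>x. \<phi> x + c * \<psi> x) \<in> test"
  unfolding test_iff
proof
  fix k
  show "\<exists>\<psi>'. (\<lambda>x. \<phi> x + c * \<psi> x, \<psi>') \<in> Hs ^^ k"
    using relpow_linear[OF power_apply_relpow[OF assms(1)] power_apply_relpow[OF assms(2)]] by blast
qed

lemma test_diff: "\<phi> \<in> test \<Longrightarrow> \<psi> \<in> test \<Longrightarrow> (\<lambda>x. \<phi> x - \<psi> x) \<in> test"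
  using test_linear[of \<phi> \<psi> "- 1"] by simp

lemma v_test: "\<xi> \<in> I \<Longrightarrow> v \<xi> \<in> test"
  unfolding test_iff using relpow_dual_eigenfunction by blast

lemma zero_test: "(\<lambda>x. 0) \<in> test"
proof -
  have "(\<lambda>x. 0, \<lambda>x. 0) \<in> Hs ^^ k" for k
  proof (induction k)
    case (Suc k)
    have "(\<lambda>x. 0, \<lambda>x. 0) \<in> Hs" unfolding H_adj_iff by (simp add: l2_inner_def)
    then show ?case using Suc by auto
  qed simp
  then show ?thesis unfolding test_iff by blast
qed

lemma v_comb_test: "F \<subseteq> I \<Longrightarrow> (\<lambda>x. \<Sum>\<xi>\<in>F. b \<xi> * v \<xi> x) \<in> test"
proof (induction F rule: infinite_finite_induct)
  case (insert \<eta> F)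
  then show ?case
    using test_linear[of "\<lambda>x. \<Sum>\<xi>\<in>F. b \<xi> * v \<xi> x" "v \<eta>" "b \<eta>"] v_test by (simp add: add.commute)
qed (auto simp: zero_test)

text \<open>
  The values of \<^const>\<open>power_apply\<close> are representatives chosen without regard to linearity; their norms
  are compared through coefficients.
\<close>

lemma l2_norm_eqI:
  assumes f: "f \<in> L2" and g: "g \<in> L2" and eq: "\<And>\<xi>. \<xi> \<in> I \<Longrightarrow> l2_inner (u \<xi>) f = l2_inner (u \<xi>) g"
  shows "l2_norm f = l2_norm g"
proof -
  have "l2_norm (\<lambda>x. f x - g x) = 0"
  proof (rule zero_if_orthogonal_u[OF L2_diff[OF f g]])
    fix \<xi> assume \<xi>: "\<xi> \<in> I"
    then show "l2_inner (u \<xi>) (\<lambda>x. f x - g x) = 0"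
      using l2_inner_diff_right[OF f g u_L2[OF \<xi>]] eq by simp
  qed
  moreover have "l2_norm f \<le> l2_norm (\<lambda>x. f x - g x) + l2_norm g"
    using l2_norm_triangle[OF L2_diff[OF f g] g] by simp
  moreover have "l2_norm g \<le> l2_norm (\<lambda>x. g x - f x) + l2_norm f"
    using l2_norm_triangle[OF L2_diff[OF g f] f] by simp
  ultimately show ?thesis using l2_norm_minus_commute[of f g] by simp
qed

lemma test_norm_ge: "j \<le> k \<Longrightarrow> l2_norm (power_apply Hs j \<phi>) \<le> test_norm Hs k \<phi>"
  unfolding test_norm_def by (rule Max_ge) auto

lemma test_norm_le_iff: "test_norm Hs k \<phi> \<le> r \<longleftrightarrow> (\<forall>j\<le>k. l2_norm (power_apply Hs j \<phi>) \<le> r)"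
  unfolding test_norm_def by (subst Max_le_iff) auto

lemma test_norm_less_iff: "test_norm Hs k \<phi> < r \<longleftrightarrow> (\<forall>j\<le>k. l2_norm (power_apply Hs j \<phi>) < r)"
  unfolding test_norm_def by (subst Max_less_iff) auto

lemma test_norm_mono: "k \<le> k' \<Longrightarrow> test_norm Hs k \<phi> \<le> test_norm Hs k' \<phi>"
  unfolding test_norm_le_iff using test_norm_ge order_trans by blast

lemma test_norm_zero [simp]: "test_norm Hs k (\<lambda>x. 0) = 0"
proof -
  have "l2_norm (power_apply Hs j (\<lambda>x. 0)) = l2_norm (\<lambda>x :: 'a. 0 :: complex)" for j
  proof (rule l2_norm_eqI)
    fix \<xi> assume \<xi>: "\<xi> \<in> I"
    show "l2_inner (u \<xi>) (power_apply Hs j (\<lambda>x. 0)) = l2_inner (u \<xi>) (\<lambda>x. 0)"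
      unfolding power_apply_coefficient[OF zero_test \<xi>] by (simp add: l2_inner_def)
  qed (auto simp: power_apply_L2 zero_test)
  then show ?thesis by (simp add: test_norm_def image_constant_conv)
qed

lemma test_norm_triangle:
  assumes "\<phi> \<in> test" "\<psi> \<in> test" "\<omega> \<in> test"
  shows "test_norm Hs k (\<lambda>x. \<phi> x - \<omega> x) \<le> test_norm Hs k (\<lambda>x. \<phi> x - \<psi> x) + test_norm Hs k (\<lambda>x. \<psi> x - \<omega> x)"
  unfolding test_norm_le_iff
proof (intro allI impI)
  fix j assume j: "j \<le> k"
  let ?p = "power_apply Hs j"
  have t: "(\<lambda>x. \<phi> x - \<omega> x) \<in> test" "(\<lambda>x. \<phi> x - \<psi> x) \<in> test" "(\<lambda>x. \<psi> x - \<omega> x) \<in> test"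
    using assms test_diff by auto
  have "l2_norm (?p (\<lambda>x. \<phi> x - \<omega> x)) = l2_norm (\<lambda>x. ?p (\<lambda>x. \<phi> x - \<psi> x) x + ?p (\<lambda>x. \<psi> x - \<omega> x) x)"
  proof (rule l2_norm_eqI)
    fix \<xi> assume \<xi>: "\<xi> \<in> I"
    have *: "l2_inner (u \<xi>) (\<lambda>x. f x - g x) = l2_inner (u \<xi>) f - l2_inner (u \<xi>) g" if "f \<in> test" "g \<in> test" for f g
      using l2_inner_diff_right[OF test_L2 test_L2 u_L2] that \<xi> by blast
    show "l2_inner (u \<xi>) (?p (\<lambda>x. \<phi> x - \<omega> x)) = l2_inner (u \<xi>) (\<lambda>x. ?p (\<lambda>x. \<phi> x - \<psi> x) x + ?p (\<lambda>x. \<psi> x - \<omega> x) x)"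
      using assms \<xi> t
      by (simp add: l2_inner_add_right power_apply_L2 u_L2 power_apply_coefficient * right_diff_distrib del: of_real_power)
  qed (auto intro!: L2_add power_apply_L2 t)
  also have "\<dots> \<le> l2_norm (?p (\<lambda>x. \<phi> x - \<psi> x)) + l2_norm (?p (\<lambda>x. \<psi> x - \<omega> x))"
    by (intro l2_norm_triangle power_apply_L2 t)
  also have "\<dots> \<le> test_norm Hs k (\<lambda>x. \<phi> x - \<psi> x) + test_norm Hs k (\<lambda>x. \<psi> x - \<omega> x)"
    by (intro add_mono test_norm_ge j)
  finally show "l2_norm (?p (\<lambda>x. \<phi> x - \<omega> x)) \<le> test_norm Hs k (\<lambda>x. \<phi> x - \<psi> x) + test_norm Hs k (\<lambda>x. \<psi> x - \<omega> x)" .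
qed

text \<open>
  The norms increase with \<open>k\<close>, so the balls that generate the topology contain a ball around each point
  of a finite intersection and form a base.
\<close>

lemma openin_test_topology:
  "openin (test_topology Hs) U \<longleftrightarrow> U \<subseteq> test \<and>
     (\<forall>\<phi>\<in>U. \<exists>k. \<exists>r>0. \<forall>\<psi>\<in>test. test_norm Hs k (\<lambda>x. \<psi> x - \<phi> x) < r \<longrightarrow> \<psi> \<in> U)"
proof safe
  let ?ball = "\<lambda>\<phi> k r. {\<psi> \<in> test. test_norm Hs k (\<lambda>x. \<psi> x - \<phi> x) < r}"
  define \<S> where "\<S> = {?ball \<phi> k r | \<phi> k r. \<phi> \<in> test \<and> r > 0}"
  have top: "openin (test_topology Hs) V \<longleftrightarrow> generate_topology_on \<S> V" for V
    unfolding test_topology_def \<S>_def by (rule openin_topology_generated_by_iff)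
  have base: "V \<subseteq> test \<and> (\<forall>\<phi>\<in>V. \<exists>k. \<exists>r>0. ?ball \<phi> k r \<subseteq> V)" if "generate_topology_on \<S> V" for V
    using that
  proof induction
    case Empty
    then show ?case by auto
  next
    case (Int a b)
    show ?case
    proof (intro conjI ballI)
      fix \<phi> assume "\<phi> \<in> a \<inter> b"
      then obtain k r k' r' where "r > 0" "r' > 0" "?ball \<phi> k r \<subseteq> a" "?ball \<phi> k' r' \<subseteq> b"
        using Int.IH by blast
      moreover have "?ball \<phi> (max k k') (min r r') \<subseteq> ?ball \<phi> k r \<inter> ?ball \<phi> k' r'"
        using test_norm_mono[of k "max k k'"] test_norm_mono[of k' "max k k'"]
        by (auto intro: le_less_trans)
      ultimately show "\<exists>k. \<exists>r>0. ?ball \<phi> k r \<subseteq> a \<inter> b"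
        by (intro exI[of _ "max k k'"] exI[of _ "min r r'"]) auto
    qed (use Int.IH in auto)
  next
    case (UN K)
    show ?case
    proof (intro conjI ballI)
      fix \<phi> assume "\<phi> \<in> \<Union>K"
      then obtain V where "V \<in> K" "\<phi> \<in> V" by blast
      then obtain k r where "r > 0" "?ball \<phi> k r \<subseteq> V" using UN.IH by blast
      then show "\<exists>k. \<exists>r>0. ?ball \<phi> k r \<subseteq> \<Union>K" using \<open>V \<in> K\<close> by blast
    qed (use UN.IH in auto)
  next
    case (Basis s)
    then obtain \<phi>0 k r where s: "s = ?ball \<phi>0 k r" "\<phi>0 \<in> test" "r > 0" by (auto simp: \<S>_def)
    show ?case
    proof (intro conjI ballI)
      fix \<phi> assume \<phi>: "\<phi> \<in> s"
      show "\<exists>k. \<exists>r>0. ?ball \<phi> k r \<subseteq> s"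
      proof (intro exI[of _ k] exI[of _ "r - test_norm Hs k (\<lambda>x. \<phi> x - \<phi>0 x)"] conjI subsetI)
        show "r - test_norm Hs k (\<lambda>x. \<phi> x - \<phi>0 x) > 0" using \<phi> s by auto
        fix \<psi> assume "\<psi> \<in> ?ball \<phi> k (r - test_norm Hs k (\<lambda>x. \<phi> x - \<phi>0 x))"
        then show "\<psi> \<in> s" using test_norm_triangle[of \<psi> \<phi> \<phi>0 k] \<phi> s by auto
      qed
    qed (use s in auto)
  qed
  show "\<phi> \<in> test" if "openin (test_topology Hs) U" "\<phi> \<in> U" for \<phi>
    using base that unfolding top by blast
  show "\<exists>k. \<exists>r>0. \<forall>\<psi>\<in>test. test_norm Hs k (\<lambda>x. \<psi> x - \<phi> x) < r \<longrightarrow> \<psi> \<in> U"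
    if U: "openin (test_topology Hs) U" "\<phi> \<in> U" for \<phi>
  proof -
    obtain k r where "r > 0" "?ball \<phi> k r \<subseteq> U" using base U unfolding top by blast
    then show ?thesis by blast
  qed
  assume U: "U \<subseteq> test"
    and loc: "\<forall>\<phi>\<in>U. \<exists>k. \<exists>r>0. \<forall>\<psi>\<in>test. test_norm Hs k (\<lambda>x. \<psi> x - \<phi> x) < r \<longrightarrow> \<psi> \<in> U"
  show "openin (test_topology Hs) U"
  proof (subst openin_subopen, intro ballI)
    fix \<phi> assume \<phi>: "\<phi> \<in> U"
    then obtain k r where kr: "r > 0" "?ball \<phi> k r \<subseteq> U" using loc by blast
    have "openin (test_topology Hs) (?ball \<phi> k r)"
      unfolding top by (rule generate_topology_on.Basis) (unfold \<S>_def, use kr U \<phi> in blast)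
    moreover have "\<phi> \<in> ?ball \<phi> k r" using kr U \<phi> by auto
    ultimately show "\<exists>T. openin (test_topology Hs) T \<and> \<phi> \<in> T \<and> T \<subseteq> U" using kr by blast
  qed
qed

lemma topspace_test_topology: "topspace (test_topology Hs) = test"
proof
  have "openin (test_topology Hs) (topspace (test_topology Hs))" by simp
  then show "topspace (test_topology Hs) \<subseteq> test" unfolding openin_test_topology by blast
  have "openin (test_topology Hs) test"
    unfolding openin_test_topology by (auto intro: exI[of _ 1])
  then show "test \<subseteq> topspace (test_topology Hs)" by (rule openin_subset)
qed

lemma continuous_test_iff:
  fixes w :: "'a cfun \<Rightarrow> complex"
  shows "continuous_map (test_topology Hs) euclidean w \<longleftrightarrow>
    (\<forall>\<phi>\<in>test. \<forall>e>0. \<exists>k. \<exists>r>0. \<forall>\<psi>\<in>test. test_norm Hs k (\<lambda>x. \<psi> x - \<phi> x) < r \<longrightarrow> cmod (w \<psi> - w \<phi>) < e)"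
    (is "?L \<longleftrightarrow> ?R")
proof
  assume L: ?L
  show ?R
  proof (intro ballI allI impI)
    fix \<phi> and e :: real assume \<phi>: "\<phi> \<in> test" and e: "e > 0"
    have "openin (test_topology Hs) {\<psi> \<in> test. w \<psi> \<in> ball (w \<phi>) e}"
      using openin_continuous_map_preimage[OF L, of "ball (w \<phi>) e"] by (simp add: topspace_test_topology)
    then show "\<exists>k. \<exists>r>0. \<forall>\<psi>\<in>test. test_norm Hs k (\<lambda>x. \<psi> x - \<phi> x) < r \<longrightarrow> cmod (w \<psi> - w \<phi>) < e"
      unfolding openin_test_topology using \<phi> e by (auto simp: dist_norm norm_minus_commute)
  qed
next
  assume R: ?R
  show ?L
    unfolding continuous_map_def topspace_test_topology
  proof (intro conjI allI impI)
    fix V :: "complex set" assume "openin euclidean V"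
    then have V: "open V" by simp
    show "openin (test_topology Hs) {\<phi> \<in> test. w \<phi> \<in> V}"
      unfolding openin_test_topology
    proof (intro conjI ballI)
      fix \<phi> assume \<phi>: "\<phi> \<in> {\<phi> \<in> test. w \<phi> \<in> V}"
      then obtain e where e: "e > 0" "ball (w \<phi>) e \<subseteq> V" using V by (auto elim: openE)
      obtain k r where kr: "r > 0" "\<And>\<psi>. \<psi> \<in> test \<Longrightarrow> test_norm Hs k (\<lambda>x. \<psi> x - \<phi> x) < r \<Longrightarrow> cmod (w \<psi> - w \<phi>) < e"
        using R \<phi> e(1) by blast
      have "\<forall>\<psi>\<in>test. test_norm Hs k (\<lambda>x. \<psi> x - \<phi> x) < r \<longrightarrow> \<psi> \<in> {\<phi> \<in> test. w \<phi> \<in> V}"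
        using kr(2) e(2) by (auto simp: dist_norm norm_minus_commute subset_iff)
      then show "\<exists>k. \<exists>r>0. \<forall>\<psi>\<in>test. test_norm Hs k (\<lambda>x. \<psi> x - \<phi> x) < r \<longrightarrow> \<psi> \<in> {\<phi> \<in> test. w \<phi> \<in> V}"
        using kr(1) by blast
    qed auto
  qed auto
qed

lemma distribution_linear:
  assumes "w \<in> distributions Hs" "\<phi> \<in> test" "\<psi> \<in> test"
  shows "w (\<lambda>x. \<phi> x + c * \<psi> x) = w \<phi> + cnj c * w \<psi>"
  using assms by (auto simp: distributions_def)

lemma distribution_zero:
  assumes "w \<in> distributions Hs"
  shows "w (\<lambda>x. 0) = 0"
  using distribution_linear[OF assms zero_test zero_test, of 1] by simp

lemma distribution_v_comb:
  assumes w: "w \<in> distributions Hs" and F: "finite F" "F \<subseteq> I"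
  shows "w (\<lambda>x. \<Sum>\<xi>\<in>F. b \<xi> * v \<xi> x) = (\<Sum>\<xi>\<in>F. cnj (b \<xi>) * w (v \<xi>))"
  using F
proof (induction F rule: finite_induct)
  case (insert \<eta> F)
  then show ?case
    using distribution_linear[OF w v_comb_test v_test, of F \<eta> b "b \<eta>"] by (simp add: add.commute)
qed (simp add: distribution_zero[OF w])

lemma v_comb_coefficient:
  assumes F: "finite F" "F \<subseteq> I" and \<eta>: "\<eta> \<in> I"
  shows "l2_inner (u \<eta>) (\<lambda>x. \<Sum>\<xi>\<in>F. b \<xi> * v \<xi> x) = (if \<eta> \<in> F then cnj (b \<eta>) else 0)"
proof -
  have "l2_inner (\<lambda>x. \<Sum>\<xi>\<in>F. b \<xi> * v \<xi> x) (u \<eta>) = (if \<eta> \<in> F then b \<eta> else 0)"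
    using F \<eta> v_L2 u_L2 biorth_swap by (intro finite_combination_coefficient) auto
  then show ?thesis unfolding l2_inner_cnj[of "u \<eta>"] by auto
qed

text \<open>
  The powers of the adjoint map the partial sums of \<open>\<phi>\<close> to those of \<open>power_apply Hs j \<phi>\<close>, so that each
  of the finitely many norms involved tends to zero by \<open>expansion_v\<close>.
\<close>

lemma v_expansion_test_norm:
  assumes \<phi>: "\<phi> \<in> test"
  shows "((\<lambda>F. test_norm Hs k (\<lambda>x. (\<Sum>\<xi>\<in>F. l2_inner \<phi> (u \<xi>) * v \<xi> x) - \<phi> x)) \<longlongrightarrow> 0) (finite_subsets_at_top I)"
proof (rule tendstoI)
  fix e :: real assume e: "e > 0"
  let ?p = "\<lambda>j. power_apply Hs j"
  let ?S = "\<lambda>F x. \<Sum>\<xi>\<in>F. l2_inner \<phi> (u \<xi>) * v \<xi> x"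
  have ev: "\<forall>\<^sub>F F in finite_subsets_at_top I. \<forall>j\<in>{..k}.
      l2_norm (\<lambda>x. ?p j \<phi> x - (\<Sum>\<xi>\<in>F. l2_inner (?p j \<phi>) (u \<xi>) * v \<xi> x)) < e"
  proof (rule eventually_ball_finite)
    show "\<forall>j\<in>{..k}. \<forall>\<^sub>F F in finite_subsets_at_top I.
        l2_norm (\<lambda>x. ?p j \<phi> x - (\<Sum>\<xi>\<in>F. l2_inner (?p j \<phi>) (u \<xi>) * v \<xi> x)) < e"
      using tendstoD[OF expansion_v[OF power_apply_L2[OF \<phi>]] e] by simp
  qed simp
  show "\<forall>\<^sub>F F in finite_subsets_at_top I. dist (test_norm Hs k (\<lambda>x. ?S F x - \<phi> x)) 0 < e"
    using ev eventually_finite_subset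
  proof eventually_elim
    case (elim F)
    then have F: "finite F" "F \<subseteq> I" by auto
    have S: "?S F \<in> test" by (rule v_comb_test[OF F(2)])
    have d: "(\<lambda>x. ?S F x - \<phi> x) \<in> test" by (rule test_diff[OF S \<phi>])
    have lt: "l2_norm (?p j (\<lambda>x. ?S F x - \<phi> x)) < e" if j: "j \<le> k" for j
    proof -
      let ?T = "\<lambda>x. \<Sum>\<xi>\<in>F. l2_inner (?p j \<phi>) (u \<xi>) * v \<xi> x"
      have T: "?T \<in> L2" by (rule v_comb_L2[OF F(2)])
      have "l2_norm (?p j (\<lambda>x. ?S F x - \<phi> x)) = l2_norm (\<lambda>x. ?T x - ?p j \<phi> x)"
      proof (rule l2_norm_eqI)
        fix \<xi> assume \<xi>: "\<xi> \<in> I"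
        have "l2_inner (u \<xi>) (?p j (\<lambda>x. ?S F x - \<phi> x)) =
            of_real (\<mu> \<xi> ^ j) * (l2_inner (u \<xi>) (?S F) - l2_inner (u \<xi>) \<phi>)"
          unfolding power_apply_coefficient[OF d \<xi>] l2_inner_diff_right[OF test_L2[OF S] test_L2[OF \<phi>] u_L2[OF \<xi>]] ..
        also have "\<dots> = l2_inner (u \<xi>) ?T - l2_inner (u \<xi>) (?p j \<phi>)"
          unfolding v_comb_coefficient[OF F \<xi>] power_apply_coefficient[OF \<phi> \<xi>]
            l2_inner_cnj[of "u \<xi>" "?p j \<phi>", symmetric] l2_inner_cnj[of "u \<xi>" \<phi>, symmetric]
          by (simp add: power_apply_coefficient[OF \<phi> \<xi>])
        also have "\<dots> = l2_inner (u \<xi>) (\<lambda>x. ?T x - ?p j \<phi> x)"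
          by (rule l2_inner_diff_right[OF T power_apply_L2[OF \<phi>] u_L2[OF \<xi>], symmetric])
        finally show "l2_inner (u \<xi>) (?p j (\<lambda>x. ?S F x - \<phi> x)) = l2_inner (u \<xi>) (\<lambda>x. ?T x - ?p j \<phi> x)" .
      qed (auto intro!: L2_diff T power_apply_L2 \<phi> d)
      also have "\<dots> < e" using elim j l2_norm_minus_commute[of ?T "?p j \<phi>"] by auto
      finally show ?thesis .
    qed
    have "test_norm Hs k (\<lambda>x. ?S F x - \<phi> x) < e"
      unfolding test_norm_less_iff using lt by blast
    moreover have "0 \<le> test_norm Hs k (\<lambda>x. ?S F x - \<phi> x)"
      using test_norm_ge[of 0 k "\<lambda>x. ?S F x - \<phi> x"] l2_norm_nonneg order_trans by blast
    ultimately show ?case by simp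
  qed
qed

text \<open>
  Antilinearity gives the value of \<open>w\<close> on the partial sums of the \<open>v\<close>-expansion, continuity the limit.
\<close>

lemma distribution_expansion:
  assumes w: "w \<in> distributions Hs" and \<phi>: "\<phi> \<in> test"
  shows "((\<lambda>\<xi>. fourier v w \<xi> * l2_inner (u \<xi>) \<phi>) has_sum w \<phi>) I"
  unfolding has_sum_def
proof (rule tendstoI)
  fix e :: real assume e: "e > 0"
  let ?S = "\<lambda>F x. \<Sum>\<xi>\<in>F. l2_inner \<phi> (u \<xi>) * v \<xi> x"
  have "continuous_map (test_topology Hs) euclidean w" using w by (simp add: distributions_def)
  then obtain k r where r: "r > 0"
    "\<And>\<psi>. \<psi> \<in> test \<Longrightarrow> test_norm Hs k (\<lambda>x. \<psi> x - \<phi> x) < r \<Longrightarrow> cmod (w \<psi> - w \<phi>) < e"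
    unfolding continuous_test_iff using \<phi> e by meson
  show "\<forall>\<^sub>F F in finite_subsets_at_top I. dist (\<Sum>\<xi>\<in>F. fourier v w \<xi> * l2_inner (u \<xi>) \<phi>) (w \<phi>) < e"
    using tendstoD[OF v_expansion_test_norm[OF \<phi>, of k] r(1)] eventually_finite_subset
  proof eventually_elim
    case (elim F)
    then have F: "finite F" "F \<subseteq> I" by auto
    have "w (?S F) = (\<Sum>\<xi>\<in>F. cnj (l2_inner \<phi> (u \<xi>)) * w (v \<xi>))"
      by (rule distribution_v_comb[OF w F])
    also have "\<dots> = (\<Sum>\<xi>\<in>F. fourier v w \<xi> * l2_inner (u \<xi>) \<phi>)"
      by (simp add: l2_inner_cnj[symmetric] fourier_def mult.commute)
    finally have "w (?S F) = (\<Sum>\<xi>\<in>F. fourier v w \<xi> * l2_inner (u \<xi>) \<phi>)" .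
    moreover have "cmod (w (?S F) - w \<phi>) < e"
      using elim by (intro r(2) v_comb_test[OF F(2)]) auto
    ultimately show ?case by (simp add: dist_norm)
  qed
qed

section \<open>Sobolev spaces as weighted sequence spaces\<close>

definition series_dist :: "('i \<Rightarrow> complex) \<Rightarrow> 'a dist" where
  "series_dist c = (\<lambda>\<phi>\<in>test. \<Sum>\<^sub>\<infinity>\<xi>\<in>I. c \<xi> * l2_inner (u \<xi>) \<phi>)"

definition sobolev_coefficients :: "real \<Rightarrow> ('i \<Rightarrow> complex) \<Rightarrow> bool" where
  "sobolev_coefficients r c \<longleftrightarrow> (\<lambda>\<xi>. \<mu> \<xi> powr r * (cmod (c \<xi>))\<^sup>2) summable_on I"

text \<open>
  The coefficients \<open>c\<close> may grow, but for large \<open>k\<close> the sequence \<open>c / \<mu> ^ k\<close> is square summable and belongs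
  to some \<open>g\<close> in \<open>L\<^sup>2\<close>; the factor \<open>\<mu> ^ k\<close> is absorbed by the test function. The pairing with
  \<open>g\<close> shows that the series converges and that it is continuous in \<open>\<phi>\<close>.
\<close>

lemma series_pairing:
  assumes c: "sobolev_coefficients r c"
  obtains k g where "g \<in> L2"
    "\<And>\<phi>. \<phi> \<in> test \<Longrightarrow> ((\<lambda>\<xi>. c \<xi> * l2_inner (u \<xi>) \<phi>) has_sum l2_inner g (power_apply Hs k \<phi>)) I"
proof -
  define k where "k = nat \<lceil>\<bar>r\<bar>\<rceil>"
  have k: "\<bar>r\<bar> \<le> real k" unfolding k_def by linarith
  define d where "d \<xi> = of_real (inverse (\<mu> \<xi> ^ k)) * c \<xi>" for \<xi>
  have "(\<lambda>\<xi>. (cmod (d \<xi>))\<^sup>2) summable_on I"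
  proof (rule summable_on_comparison_test)
    show "(\<lambda>\<xi>. m0 powr (- 2 * real k - r) * (\<mu> \<xi> powr r * (cmod (c \<xi>))\<^sup>2)) summable_on I"
      using c unfolding sobolev_coefficients_def by (rule summable_on_cmult_right)
    fix \<xi> assume \<xi>: "\<xi> \<in> I"
    have "(cmod (d \<xi>))\<^sup>2 = (inverse (\<mu> \<xi> ^ k))\<^sup>2 * (cmod (c \<xi>))\<^sup>2"
      using \<mu>_pos[OF \<xi>] by (simp add: d_def norm_mult norm_inverse norm_power power_mult_distrib)
    also have "(inverse (\<mu> \<xi> ^ k))\<^sup>2 = \<mu> \<xi> powr (- 2 * real k)"
      using \<mu>_pos[OF \<xi>] by (simp add: powr_minus powr_realpow[symmetric] power_mult[symmetric] powr_powr power_inverse mult.commute flip: powr_realpow)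
    also have "\<dots> = \<mu> \<xi> powr (- 2 * real k - r) * \<mu> \<xi> powr r"
      by (simp add: powr_add[symmetric])
    also have "\<dots> \<le> m0 powr (- 2 * real k - r) * \<mu> \<xi> powr r"
      using m0 \<mu>[OF \<xi>] k by (intro mult_right_mono powr_mono2') auto
    finally show "(cmod (d \<xi>))\<^sup>2 \<le> m0 powr (- 2 * real k - r) * (\<mu> \<xi> powr r * (cmod (c \<xi>))\<^sup>2)"
      by (simp add: mult_right_mono mult.assoc[symmetric])
  qed auto
  then obtain g where g: "g \<in> L2" "\<And>\<xi>. \<xi> \<in> I \<Longrightarrow> l2_inner g (v \<xi>) = d \<xi>"
    using synthesis_u[of d] by metis
  show ?thesis
  proof (rule that[OF g(1), of k])
    fix \<phi> assume \<phi>: "\<phi> \<in> test"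
    have eq: "l2_inner g (v \<xi>) * l2_inner (u \<xi>) (power_apply Hs k \<phi>) = c \<xi> * l2_inner (u \<xi>) \<phi>" if "\<xi> \<in> I" for \<xi>
      using \<mu>_pos[OF that] by (simp add: g(2)[OF that] power_apply_coefficient[OF \<phi> that] d_def)
    have "((\<lambda>\<xi>. l2_inner g (v \<xi>) * l2_inner (u \<xi>) (power_apply Hs k \<phi>)) has_sum l2_inner g (power_apply Hs k \<phi>)) I"
      by (rule parseval[OF g(1) power_apply_L2[OF \<phi>]])
    then show "((\<lambda>\<xi>. c \<xi> * l2_inner (u \<xi>) \<phi>) has_sum l2_inner g (power_apply Hs k \<phi>)) I"
      by (subst has_sum_cong[where g = "\<lambda>\<xi>. l2_inner g (v \<xi>) * l2_inner (u \<xi>) (power_apply Hs k \<phi>)"]) (auto simp: eq)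
  qed
qed

lemma series_dist_has_sum:
  assumes c: "sobolev_coefficients r c" and \<phi>: "\<phi> \<in> test"
  shows "((\<lambda>\<xi>. c \<xi> * l2_inner (u \<xi>) \<phi>) has_sum series_dist c \<phi>) I"
proof -
  obtain k g where "((\<lambda>\<xi>. c \<xi> * l2_inner (u \<xi>) \<phi>) has_sum l2_inner g (power_apply Hs k \<phi>)) I"
    using series_pairing[OF c] \<phi> by metis
  then show ?thesis using \<phi> by (simp add: series_dist_def infsumI)
qed

lemma series_dist_distribution:
  assumes c: "sobolev_coefficients r c"
  shows "series_dist c \<in> distributions Hs"
proof -
  obtain k g where g: "g \<in> L2"
    "\<And>\<phi>. \<phi> \<in> test \<Longrightarrow> ((\<lambda>\<xi>. c \<xi> * l2_inner (u \<xi>) \<phi>) has_sum l2_inner g (power_apply Hs k \<phi>)) I"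
    using series_pairing[OF c] by metis
  have val: "series_dist c \<phi> = l2_inner g (power_apply Hs k \<phi>)" if "\<phi> \<in> test" for \<phi>
    using has_sum_unique[OF series_dist_has_sum[OF c that] g(2)[OF that]] .
  have lin: "series_dist c (\<lambda>x. \<phi> x + b * \<psi> x) = series_dist c \<phi> + cnj b * series_dist c \<psi>"
    if t: "\<phi> \<in> test" "\<psi> \<in> test" for \<phi> \<psi> b
  proof (rule has_sum_unique)
    show "((\<lambda>\<xi>. c \<xi> * l2_inner (u \<xi>) (\<lambda>x. \<phi> x + b * \<psi> x)) has_sum series_dist c (\<lambda>x. \<phi> x + b * \<psi> x)) I"
      by (rule series_dist_has_sum[OF c test_linear[OF t]])
    have eq: "c \<xi> * l2_inner (u \<xi>) (\<lambda>x. \<phi> x + b * \<psi> x) =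
        c \<xi> * l2_inner (u \<xi>) \<phi> + cnj b * (c \<xi> * l2_inner (u \<xi>) \<psi>)" if "\<xi> \<in> I" for \<xi>
      using t u_L2[OF that] by (simp add: l2_inner_add_right test_L2 L2_scale l2_inner_scale_right algebra_simps)
    have "((\<lambda>\<xi>. c \<xi> * l2_inner (u \<xi>) \<phi> + cnj b * (c \<xi> * l2_inner (u \<xi>) \<psi>)) has_sum
        series_dist c \<phi> + cnj b * series_dist c \<psi>) I"
      by (intro has_sum_add has_sum_cmult_right series_dist_has_sum[OF c] t)
    then show "((\<lambda>\<xi>. c \<xi> * l2_inner (u \<xi>) (\<lambda>x. \<phi> x + b * \<psi> x)) has_sum
        series_dist c \<phi> + cnj b * series_dist c \<psi>) I"
      by (subst has_sum_cong[OF eq])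
  qed
  have "\<exists>k. \<exists>r>0. \<forall>\<psi>\<in>test. test_norm Hs k (\<lambda>x. \<psi> x - \<phi> x) < r \<longrightarrow> cmod (series_dist c \<psi> - series_dist c \<phi>) < e"
    if \<phi>: "\<phi> \<in> test" and e: "e > 0" for \<phi> e
  proof (intro exI[of _ k] exI[of _ "e / (l2_norm g + 1)"] conjI ballI impI)
    have pos: "l2_norm g + 1 > 0" by (simp add: add_nonneg_pos)
    then show "e / (l2_norm g + 1) > 0" using e by simp
    fix \<psi> assume \<psi>: "\<psi> \<in> test" "test_norm Hs k (\<lambda>x. \<psi> x - \<phi> x) < e / (l2_norm g + 1)"
    have d: "(\<lambda>x. \<psi> x - \<phi> x) \<in> test" by (rule test_diff[OF \<psi>(1) \<phi>])
    have "cmod (series_dist c \<psi> - series_dist c \<phi>) = cmod (series_dist c (\<lambda>x. \<psi> x - \<phi> x))"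
      using lin[OF \<psi>(1) \<phi>, of "- 1"] by simp
    also have "\<dots> \<le> l2_norm g * l2_norm (power_apply Hs k (\<lambda>x. \<psi> x - \<phi> x))"
      unfolding val[OF d] by (rule l2_cauchy_schwarz[OF g(1) power_apply_L2[OF d]])
    also have "\<dots> \<le> (l2_norm g + 1) * test_norm Hs k (\<lambda>x. \<psi> x - \<phi> x)"
      by (intro mult_mono test_norm_ge) auto
    also have "\<dots> < e" using \<psi>(2) pos by (simp add: field_simps)
    finally show "cmod (series_dist c \<psi> - series_dist c \<phi>) < e" .
  qed
  then have "continuous_map (test_topology Hs) euclidean (series_dist c)"
    unfolding continuous_test_iff by blast
  then show ?thesis
    using lin by (auto simp: distributions_def) (simp add: series_dist_def)
qed

lemma fourier_series_dist:
  assumes c: "sobolev_coefficients r c" and \<eta>: "\<eta> \<in> I"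
  shows "fourier v (series_dist c) \<eta> = c \<eta>"
proof -
  have "((\<lambda>\<xi>. c \<xi> * l2_inner (u \<xi>) (v \<eta>)) has_sum c \<eta> * l2_inner (u \<eta>) (v \<eta>)) I"
    by (rule has_sum_single_index) (use \<eta> biorth in auto)
  then show ?thesis
    using has_sum_unique[OF series_dist_has_sum[OF c v_test[OF \<eta>]]] biorth[OF \<eta> \<eta>] by (simp add: fourier_def)
qed

lemma series_dist_sobolev:
  assumes c: "sobolev_coefficients r c"
  shows "series_dist c \<in> Sob r"
proof -
  define d where "d \<xi> = of_real (\<mu> \<xi> powr (r / 2)) * c \<xi>" for \<xi>
  have "(\<lambda>\<xi>. (cmod (d \<xi>))\<^sup>2) summable_on I"
    using c by (simp add: d_def norm_mult power_mult_distrib powr_half_square sobolev_coefficients_def)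
  then obtain g where g: "g \<in> L2" "\<And>\<xi>. \<xi> \<in> I \<Longrightarrow> l2_inner g (v \<xi>) = d \<xi>"
    using synthesis_u[of d] by metis
  have "H_power I u v \<mu> (r / 2) (series_dist c) \<phi> = dist_of Hs g \<phi>" for \<phi>
  proof (cases "\<phi> \<in> test")
    case True
    have "((\<lambda>\<xi>. of_real (\<mu> \<xi> powr (r / 2)) * fourier v (series_dist c) \<xi> * l2_inner (u \<xi>) \<phi>) has_sum l2_inner g \<phi>) I"
      by (subst has_sum_cong[where g = "\<lambda>\<xi>. l2_inner g (v \<xi>) * l2_inner (u \<xi>) \<phi>"])
        (auto simp: g fourier_series_dist[OF c] d_def parseval[OF g(1) test_L2[OF True]])
    then show ?thesis using True by (simp add: H_power_def dist_of_def infsumI)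
  qed (simp add: H_power_def dist_of_def)
  then show ?thesis
    using g(1) series_dist_distribution[OF c] by (auto simp: sobolev_def)
qed

text \<open>
  Evaluation at \<open>v \<eta>\<close> identifies the coefficients of every \<open>g\<close> that represents \<open>H\<^sup>r\<^sup>/\<^sup>2 w\<close>, in
  particular of the one selected in the definition of the norm.
\<close>

lemma sobolev_norm_bounds:
  assumes w: "w \<in> Sob r"
  shows "sobolev_coefficients r (fourier v w)"
    and "A * (\<Sum>\<^sub>\<infinity>\<xi>\<in>I. \<mu> \<xi> powr r * (cmod (fourier v w \<xi>))\<^sup>2) \<le> (Snorm r w)\<^sup>2"
    and "(Snorm r w)\<^sup>2 \<le> B * (\<Sum>\<^sub>\<infinity>\<xi>\<in>I. \<mu> \<xi> powr r * (cmod (fourier v w \<xi>))\<^sup>2)"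
proof -
  define g where "g = (SOME g. g \<in> L2 \<and> H_power I u v \<mu> (r / 2) w = dist_of Hs g)"
  have g: "g \<in> L2" "H_power I u v \<mu> (r / 2) w = dist_of Hs g"
    using someI_ex[of "\<lambda>g. g \<in> L2 \<and> H_power I u v \<mu> (r / 2) w = dist_of Hs g"] w
    unfolding g_def sobolev_def by blast+
  have norm: "Snorm r w = l2_norm g"
    by (simp add: sobolev_norm_def g_def)
  have coeff: "l2_inner g (v \<eta>) = of_real (\<mu> \<eta> powr (r / 2)) * fourier v w \<eta>" if \<eta>: "\<eta> \<in> I" for \<eta>
  proof -
    have "((\<lambda>\<xi>. of_real (\<mu> \<xi> powr (r / 2)) * fourier v w \<xi> * l2_inner (u \<xi>) (v \<eta>)) has_sum
        of_real (\<mu> \<eta> powr (r / 2)) * fourier v w \<eta> * l2_inner (u \<eta>) (v \<eta>)) I"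
      by (rule has_sum_single_index) (use \<eta> biorth in auto)
    then have "H_power I u v \<mu> (r / 2) w (v \<eta>) = of_real (\<mu> \<eta> powr (r / 2)) * fourier v w \<eta>"
      using v_test[OF \<eta>] biorth[OF \<eta> \<eta>] by (simp add: H_power_def infsumI)
    then show ?thesis using v_test[OF \<eta>] by (simp add: g(2) dist_of_def)
  qed
  have sq: "(cmod (l2_inner g (v \<xi>)))\<^sup>2 = \<mu> \<xi> powr r * (cmod (fourier v w \<xi>))\<^sup>2" if "\<xi> \<in> I" for \<xi>
    using coeff[OF that] by (simp add: norm_mult power_mult_distrib powr_half_square)
  have sums: "(\<Sum>\<^sub>\<infinity>\<xi>\<in>I. (cmod (l2_inner g (v \<xi>)))\<^sup>2) = (\<Sum>\<^sub>\<infinity>\<xi>\<in>I. \<mu> \<xi> powr r * (cmod (fourier v w \<xi>))\<^sup>2)"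
    by (rule infsum_cong[OF sq])
  show "sobolev_coefficients r (fourier v w)"
    unfolding sobolev_coefficients_def using summable_coefficients_v[OF g(1)]
    by (subst (asm) summable_on_cong[OF sq])
  show "A * (\<Sum>\<^sub>\<infinity>\<xi>\<in>I. \<mu> \<xi> powr r * (cmod (fourier v w \<xi>))\<^sup>2) \<le> (Snorm r w)\<^sup>2"
    using norm_lower_bound[OF g(1)] by (simp add: norm sums)
  show "(Snorm r w)\<^sup>2 \<le> B * (\<Sum>\<^sub>\<infinity>\<xi>\<in>I. \<mu> \<xi> powr r * (cmod (fourier v w \<xi>))\<^sup>2)"
    using norm_upper_bound[OF g(1)] by (simp add: norm sums)
qed

lemma distribution_eqI:
  assumes w: "w \<in> distributions Hs" "w' \<in> distributions Hs"
    and eq: "\<And>\<xi>. \<xi> \<in> I \<Longrightarrow> fourier v w \<xi> = fourier v w' \<xi>"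
  shows "w = w'"
proof (rule extensionalityI)
  show "w \<in> extensional test" "w' \<in> extensional test"
    using w by (auto simp: distributions_def)
  fix \<phi> assume \<phi>: "\<phi> \<in> test"
  have "((\<lambda>\<xi>. fourier v w \<xi> * l2_inner (u \<xi>) \<phi>) has_sum w' \<phi>) I"
    using distribution_expansion[OF w(2) \<phi>] by (subst has_sum_cong[where g = "\<lambda>\<xi>. fourier v w' \<xi> * l2_inner (u \<xi>) \<phi>"]) (auto simp: eq)
  then show "w \<phi> = w' \<phi>"
    using distribution_expansion[OF w(1) \<phi>] has_sum_unique by blast
qed

lemma sobolev_distribution: "w \<in> Sob r \<Longrightarrow> w \<in> distributions Hs"
  by (simp add: sobolev_def)

lemma sobolev_eq_series:
  assumes w: "w \<in> Sob r"
  shows "w = series_dist (fourier v w)"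
  by (rule distribution_eqI[OF sobolev_distribution[OF w] series_dist_distribution[OF sobolev_norm_bounds(1)[OF w]]])
    (simp add: fourier_series_dist[OF sobolev_norm_bounds(1)[OF w]])

lemma sobolev_coefficients_diff:
  assumes "sobolev_coefficients r b" "sobolev_coefficients r c"
  shows "sobolev_coefficients r (\<lambda>\<xi>. b \<xi> - c \<xi>)"
  unfolding sobolev_coefficients_def
proof (rule summable_on_comparison_test)
  show "(\<lambda>\<xi>. 2 * (\<mu> \<xi> powr r * (cmod (b \<xi>))\<^sup>2) + 2 * (\<mu> \<xi> powr r * (cmod (c \<xi>))\<^sup>2)) summable_on I"
    using assms unfolding sobolev_coefficients_def by (intro summable_on_add summable_on_cmult_right)
  fix \<xi>
  have "(cmod (b \<xi> - c \<xi>))\<^sup>2 \<le> (cmod (b \<xi>) + cmod (c \<xi>))\<^sup>2"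
    by (intro power_mono norm_triangle_ineq4) auto
  also have "\<dots> \<le> 2 * (cmod (b \<xi>))\<^sup>2 + 2 * (cmod (c \<xi>))\<^sup>2"
    using sum_squares_bound[of "cmod (b \<xi>)" "cmod (c \<xi>)"] unfolding power2_sum by linarith
  finally have "\<mu> \<xi> powr r * (cmod (b \<xi> - c \<xi>))\<^sup>2 \<le> \<mu> \<xi> powr r * (2 * (cmod (b \<xi>))\<^sup>2 + 2 * (cmod (c \<xi>))\<^sup>2)"
    by (intro mult_left_mono) auto
  then show "\<mu> \<xi> powr r * (cmod (b \<xi> - c \<xi>))\<^sup>2 \<le> 2 * (\<mu> \<xi> powr r * (cmod (b \<xi>))\<^sup>2) + 2 * (\<mu> \<xi> powr r * (cmod (c \<xi>))\<^sup>2)"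
    by (simp add: algebra_simps)
qed auto

lemma sobolev_coefficients_scale:
  assumes "sobolev_coefficients r b"
  shows "sobolev_coefficients r (\<lambda>\<xi>. of_real k * b \<xi>)"
  using summable_on_cmult_right[OF assms[unfolded sobolev_coefficients_def], of "k\<^sup>2"]
  by (simp add: sobolev_coefficients_def norm_mult power_mult_distrib mult.left_commute)

lemma dist_diff_series:
  assumes "sobolev_coefficients r b" "sobolev_coefficients r c"
  shows "Diff (series_dist b) (series_dist c) = series_dist (\<lambda>\<xi>. b \<xi> - c \<xi>)"
proof (rule extensionalityI[of _ test])
  fix \<phi> assume \<phi>: "\<phi> \<in> test"
  have "((\<lambda>\<xi>. b \<xi> * l2_inner (u \<xi>) \<phi> + (- 1) * (c \<xi> * l2_inner (u \<xi>) \<phi>)) has_sum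
      series_dist b \<phi> + (- 1) * series_dist c \<phi>) I"
    by (intro has_sum_add has_sum_cmult_right series_dist_has_sum[OF assms(1) \<phi>] series_dist_has_sum[OF assms(2) \<phi>])
  then have "((\<lambda>\<xi>. (b \<xi> - c \<xi>) * l2_inner (u \<xi>) \<phi>) has_sum series_dist b \<phi> - series_dist c \<phi>) I"
    by (simp add: left_diff_distrib)
  then show "Diff (series_dist b) (series_dist c) \<phi> = series_dist (\<lambda>\<xi>. b \<xi> - c \<xi>) \<phi>"
    using has_sum_unique[OF series_dist_has_sum[OF sobolev_coefficients_diff[OF assms] \<phi>]] \<phi>
    by (simp add: dist_diff_def)
qed (auto simp: dist_diff_def series_dist_def)

lemma dist_scale_series:
  assumes "sobolev_coefficients r b"
  shows "Scale k (series_dist b) = series_dist (\<lambda>\<xi>. of_real k * b \<xi>)"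
proof (rule extensionalityI[of _ test])
  fix \<phi> assume \<phi>: "\<phi> \<in> test"
  have "((\<lambda>\<xi>. of_real k * b \<xi> * l2_inner (u \<xi>) \<phi>) has_sum of_real k * series_dist b \<phi>) I"
    unfolding mult.assoc by (intro has_sum_cmult_right series_dist_has_sum[OF assms \<phi>])
  then show "Scale k (series_dist b) \<phi> = series_dist (\<lambda>\<xi>. of_real k * b \<xi>) \<phi>"
    using has_sum_unique[OF series_dist_has_sum[OF sobolev_coefficients_scale[OF assms] \<phi>]] \<phi>
    by (simp add: dist_scale_def)
qed (auto simp: dist_scale_def series_dist_def)

end

context riesz_operator
begin

lemma sobolev_norm_nonneg [simp]: "Snorm r w \<ge> 0"
  by (simp add: sobolev_norm_def)

lemma sobolev_coefficients_dominated:
  assumes "g summable_on I" "\<And>\<xi>. \<xi> \<in> I \<Longrightarrow> \<mu> \<xi> powr r * (cmod (c \<xi>))\<^sup>2 \<le> g \<xi>"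
  shows "sobolev_coefficients r c"
  unfolding sobolev_coefficients_def by (rule summable_on_comparison_test[OF assms]) auto

lemma series_dist_norm_le:
  assumes c: "sobolev_coefficients r c"
  shows "(Snorm r (series_dist c))\<^sup>2 \<le> B * (\<Sum>\<^sub>\<infinity>\<xi>\<in>I. \<mu> \<xi> powr r * (cmod (c \<xi>))\<^sup>2)"
proof -
  have "(\<Sum>\<^sub>\<infinity>\<xi>\<in>I. \<mu> \<xi> powr r * (cmod (fourier v (series_dist c) \<xi>))\<^sup>2) = (\<Sum>\<^sub>\<infinity>\<xi>\<in>I. \<mu> \<xi> powr r * (cmod (c \<xi>))\<^sup>2)"
    by (rule infsum_cong) (simp add: fourier_series_dist[OF c])
  then show ?thesis using sobolev_norm_bounds(3)[OF series_dist_sobolev[OF c]] by simp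
qed

text \<open>
  Dominated convergence for the sum over \<open>I\<close>: outside a finite set the majorant is small, uniformly
  in \<open>\<tau>\<close>, and on the finite set the coefficients tend to zero.
\<close>

lemma series_dist_norm_tendsto_zero:
  assumes g: "g summable_on I"
    and bound: "\<forall>\<^sub>F \<tau> in F. \<forall>\<xi>\<in>I. \<mu> \<xi> powr r * (cmod (c \<tau> \<xi>))\<^sup>2 \<le> g \<xi>"
    and lim: "\<And>\<xi>. \<xi> \<in> I \<Longrightarrow> ((\<lambda>\<tau>. c \<tau> \<xi>) \<longlongrightarrow> 0) F"
  shows "((\<lambda>\<tau>. Snorm r (series_dist (c \<tau>))) \<longlongrightarrow> 0) F"
proof (rule tendstoI)
  fix e :: real assume e: "e > 0"
  define \<delta> where "\<delta> = e\<^sup>2 / (4 * B)"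
  have \<delta>: "\<delta> > 0" "B * (\<delta> + \<delta>) < e\<^sup>2" using e B by (auto simp: \<delta>_def field_simps)
  obtain F0 where F0: "finite F0" "F0 \<subseteq> I" "\<And>G. finite G \<Longrightarrow> G \<subseteq> I - F0 \<Longrightarrow> sum g G < \<delta>"
    using summable_on_small_tail[OF g \<delta>(1)] by metis
  have "((\<lambda>\<tau>. \<Sum>\<xi>\<in>F0. \<mu> \<xi> powr r * (cmod (c \<tau> \<xi>))\<^sup>2) \<longlongrightarrow> (\<Sum>\<xi>\<in>F0. \<mu> \<xi> powr r * (cmod 0)\<^sup>2)) F"
    using lim F0(2) by (intro tendsto_intros) auto
  then have "\<forall>\<^sub>F \<tau> in F. (\<Sum>\<xi>\<in>F0. \<mu> \<xi> powr r * (cmod (c \<tau> \<xi>))\<^sup>2) < \<delta>"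
    using \<delta>(1) by (intro order_tendstoD(2)) auto
  then show "\<forall>\<^sub>F \<tau> in F. dist (Snorm r (series_dist (c \<tau>))) 0 < e"
    using bound
  proof eventually_elim
    case (elim \<tau>)
    let ?h = "\<lambda>\<xi>. \<mu> \<xi> powr r * (cmod (c \<tau> \<xi>))\<^sup>2"
    have c: "sobolev_coefficients r (c \<tau>)"
      by (rule sobolev_coefficients_dominated[OF g]) (use elim in auto)
    have "infsum ?h I \<le> \<delta> + \<delta>"
    proof (rule infsum_le_finite_sums)
      show "?h summable_on I" using c by (simp add: sobolev_coefficients_def)
      fix G assume G: "finite G" "G \<subseteq> I"
      have "sum ?h G \<le> sum ?h (F0 \<union> (G - F0))"
        using G F0 by (intro sum_mono2) auto
      also have "\<dots> = sum ?h F0 + sum ?h (G - F0)"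
        using G F0 by (intro sum.union_disjoint) auto
      also have "sum ?h (G - F0) \<le> sum g (G - F0)"
        using elim G by (intro sum_mono) auto
      also have "sum g (G - F0) < \<delta>" using G by (intro F0(3)) auto
      finally show "sum ?h G \<le> \<delta> + \<delta>" using elim by linarith
    qed
    then have "B * infsum ?h I \<le> B * (\<delta> + \<delta>)" using B by (intro mult_left_mono) auto
    then have "(Snorm r (series_dist (c \<tau>)))\<^sup>2 < e\<^sup>2"
      using series_dist_norm_le[OF c] \<delta>(2) by linarith
    then have "Snorm r (series_dist (c \<tau>)) < e"
      using e by (intro power_less_imp_less_base[of _ 2 e]) auto
    then show ?case by simp
  qed
qed

lemma eventually_at_within: "\<forall>\<^sub>F \<tau> in at t within S. \<tau> \<in> S"
  by (simp add: eventually_at_filter)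

lemma weighted_norm_diff_le:
  assumes \<xi>: "\<xi> \<in> I" and x: "\<mu> \<xi> powr r * (cmod x)\<^sup>2 \<le> k" and y: "\<mu> \<xi> powr r * (cmod y)\<^sup>2 \<le> k"
  shows "\<mu> \<xi> powr r * (cmod (x - y))\<^sup>2 \<le> 4 * k"
proof -
  have "(cmod (x - y))\<^sup>2 \<le> (cmod x + cmod y)\<^sup>2"
    by (intro power_mono norm_triangle_ineq4) auto
  also have "\<dots> \<le> 2 * (cmod x)\<^sup>2 + 2 * (cmod y)\<^sup>2"
    using sum_squares_bound[of "cmod x" "cmod y"] unfolding power2_sum by linarith
  finally have "\<mu> \<xi> powr r * (cmod (x - y))\<^sup>2 \<le> \<mu> \<xi> powr r * (2 * (cmod x)\<^sup>2 + 2 * (cmod y)\<^sup>2)"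
    by (intro mult_left_mono) auto
  then show ?thesis using x y by (simp add: algebra_simps)
qed

text \<open>
  Since the majorant \<open>k\<close> is the same for all times, continuity of the single coefficients is enough.
\<close>

lemma C_sobolev_series:
  assumes k: "k summable_on I"
    and c_le: "\<And>\<xi> t. \<xi> \<in> I \<Longrightarrow> t \<in> {0..T} \<Longrightarrow> \<mu> \<xi> powr r * (cmod (c \<xi> t))\<^sup>2 \<le> k \<xi>"
    and c_lim: "\<And>\<xi> t. \<xi> \<in> I \<Longrightarrow> t \<in> {0..T} \<Longrightarrow> (c \<xi> \<longlongrightarrow> c \<xi> t) (at t within {0..T})"
  shows "C_sobolev I u v \<mu> T r (\<lambda>t. series_dist (\<lambda>\<xi>. c \<xi> t))"
  unfolding C_sobolev_def
proof (intro ballI conjI)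
  fix t assume t: "t \<in> {0..T}"
  have cc: "sobolev_coefficients r (\<lambda>\<xi>. c \<xi> \<tau>)" if "\<tau> \<in> {0..T}" for \<tau>
    by (rule sobolev_coefficients_dominated[OF k c_le[OF _ that]])
  show "series_dist (\<lambda>\<xi>. c \<xi> t) \<in> Sob r"
    by (rule series_dist_sobolev[OF cc[OF t]])
  have "((\<lambda>\<tau>. Snorm r (series_dist (\<lambda>\<xi>. c \<xi> \<tau> - c \<xi> t))) \<longlongrightarrow> 0) (at t within {0..T})"
  proof (rule series_dist_norm_tendsto_zero)
    show "(\<lambda>\<xi>. 4 * k \<xi>) summable_on I" by (rule summable_on_cmult_right[OF k])
    show "\<forall>\<^sub>F \<tau> in at t within {0..T}. \<forall>\<xi>\<in>I. \<mu> \<xi> powr r * (cmod (c \<xi> \<tau> - c \<xi> t))\<^sup>2 \<le> 4 * k \<xi>"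
      using eventually_at_within by eventually_elim (use weighted_norm_diff_le c_le t in blast)
    show "((\<lambda>\<tau>. c \<xi> \<tau> - c \<xi> t) \<longlongrightarrow> 0) (at t within {0..T})" if "\<xi> \<in> I" for \<xi>
      using c_lim[OF that t] by (simp add: LIM_zero)
  qed
  moreover have "\<forall>\<^sub>F \<tau> in at t within {0..T}. Snorm r (series_dist (\<lambda>\<xi>. c \<xi> \<tau> - c \<xi> t)) =
      Snorm r (Diff (series_dist (\<lambda>\<xi>. c \<xi> \<tau>)) (series_dist (\<lambda>\<xi>. c \<xi> t)))"
    using eventually_at_within by eventually_elim (simp add: dist_diff_series[OF cc cc[OF t]])
  ultimately show "((\<lambda>\<tau>. Snorm r (Diff (series_dist (\<lambda>\<xi>. c \<xi> \<tau>))
      (series_dist (\<lambda>\<xi>. c \<xi> t)))) \<longlongrightarrow> 0) (at t within {0..T})"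
    by (rule Lim_transform_eventually)
qed

text \<open>
  The difference quotients of \<open>Y \<xi>\<close> are bounded by the supremum of \<open>P \<xi>\<close>, so that they have the same
  majorant as the derivatives.
\<close>

lemma difference_quotient_series:
  assumes k: "k summable_on I"
    and Y_der: "\<And>\<xi> t. \<xi> \<in> I \<Longrightarrow> t \<in> {0..T} \<Longrightarrow> (Y \<xi> has_vector_derivative P \<xi> t) (at t within {0..T})"
    and Yc: "\<And>t. t \<in> {0..T} \<Longrightarrow> sobolev_coefficients r (\<lambda>\<xi>. Y \<xi> t)"
    and P_le: "\<And>\<xi> t. \<xi> \<in> I \<Longrightarrow> t \<in> {0..T} \<Longrightarrow> \<mu> \<xi> powr r * (cmod (P \<xi> t))\<^sup>2 \<le> k \<xi>"
    and t: "t \<in> {0..T}"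
  shows "((\<lambda>\<tau>. Snorm r (Diff (Scale (1 / (\<tau> - t)) (Diff (series_dist (\<lambda>\<xi>. Y \<xi> \<tau>)) (series_dist (\<lambda>\<xi>. Y \<xi> t))))
      (series_dist (\<lambda>\<xi>. P \<xi> t)))) \<longlongrightarrow> 0) (at t within {0..T})"
proof -
  have Pc: "sobolev_coefficients r (\<lambda>\<xi>. P \<xi> t)"
    by (rule sobolev_coefficients_dominated[OF k P_le[OF _ t]])
  define d where "d \<tau> \<xi> = of_real (1 / (\<tau> - t)) * (Y \<xi> \<tau> - Y \<xi> t)" for \<tau> \<xi>
  have "((\<lambda>\<tau>. Snorm r (series_dist (\<lambda>\<xi>. d \<tau> \<xi> - P \<xi> t))) \<longlongrightarrow> 0) (at t within {0..T})"
  proof (rule series_dist_norm_tendsto_zero)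
    show "(\<lambda>\<xi>. 4 * k \<xi>) summable_on I" by (rule summable_on_cmult_right[OF k])
    show "\<forall>\<^sub>F \<tau> in at t within {0..T}. \<forall>\<xi>\<in>I. \<mu> \<xi> powr r * (cmod (d \<tau> \<xi> - P \<xi> t))\<^sup>2 \<le> 4 * k \<xi>"
      using eventually_at_within
    proof eventually_elim
      case (elim \<tau>)
      show ?case
      proof (intro ballI weighted_norm_diff_le)
        fix \<xi> assume \<xi>: "\<xi> \<in> I"
        have m: "\<mu> \<xi> powr r > 0" using \<mu>_pos[OF \<xi>] by simp
        define K where "K = sqrt (k \<xi> / \<mu> \<xi> powr r)"
        have "0 \<le> k \<xi>" using P_le[OF \<xi> t] by (meson mult_nonneg_nonneg order_trans powr_ge_zero zero_le_power2)
        then have K: "K \<ge> 0" "\<mu> \<xi> powr r * K\<^sup>2 = k \<xi>" using m by (auto simp: K_def)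
        have on: "onorm (\<lambda>h. h *\<^sub>R P \<xi> x) \<le> K" if x: "x \<in> {0..T}" for x
        proof (rule onorm_le)
          fix h :: real
          have "(cmod (P \<xi> x))\<^sup>2 \<le> k \<xi> / \<mu> \<xi> powr r"
            using P_le[OF \<xi> x] m by (simp add: field_simps)
          then have "cmod (P \<xi> x) \<le> K" unfolding K_def by (rule real_le_rsqrt)
          then show "cmod (h *\<^sub>R P \<xi> x) \<le> K * norm h"
            using mult_left_mono[of "cmod (P \<xi> x)" K "\<bar>h\<bar>"] by (simp add: mult.commute)
        qed
        have "cmod (Y \<xi> \<tau> - Y \<xi> t) \<le> K * norm (\<tau> - t)"
          using Y_der[OF \<xi>] on elim t
          by (intro differentiable_bound[of "{0..T}" "Y \<xi>" "\<lambda>x h. h *\<^sub>R P \<xi> x"])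
            (auto simp: has_vector_derivative_def)
        then have "cmod (d \<tau> \<xi>) \<le> K"
          using K(1) by (cases "\<tau> = t") (auto simp: d_def norm_mult norm_divide divide_simps simp flip: of_real_diff)
        then have "(cmod (d \<tau> \<xi>))\<^sup>2 \<le> K\<^sup>2" by (intro power_mono) auto
        then have "\<mu> \<xi> powr r * (cmod (d \<tau> \<xi>))\<^sup>2 \<le> \<mu> \<xi> powr r * K\<^sup>2" by (intro mult_left_mono) auto
        then show "\<mu> \<xi> powr r * (cmod (d \<tau> \<xi>))\<^sup>2 \<le> k \<xi>" using K(2) by simp
        show "\<mu> \<xi> powr r * (cmod (P \<xi> t))\<^sup>2 \<le> k \<xi>" by (rule P_le[OF \<xi> t])
      qed
    qed
    show "((\<lambda>\<tau>. d \<tau> \<xi> - P \<xi> t) \<longlongrightarrow> 0) (at t within {0..T})" if \<xi>: "\<xi> \<in> I" for \<xi>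
    proof -
      let ?R = "\<lambda>\<tau>. (1 / norm (\<tau> - t)) *\<^sub>R (Y \<xi> \<tau> - (Y \<xi> t + (\<tau> - t) *\<^sub>R P \<xi> t))"
      have "(?R \<longlongrightarrow> 0) (at t within {0..T})"
        using Y_der[OF \<xi> t] by (simp add: has_vector_derivative_def has_derivative_within)
      then have "((\<lambda>\<tau>. cmod (?R \<tau>)) \<longlongrightarrow> 0) (at t within {0..T})"
        by (rule tendsto_norm_zero)
      moreover have "\<forall>\<^sub>F \<tau> in at t within {0..T}. cmod (?R \<tau>) = cmod (d \<tau> \<xi> - P \<xi> t)"
      proof -
        have "cmod (?R \<tau>) = cmod (d \<tau> \<xi> - P \<xi> t)" if "\<tau> \<noteq> t" for \<tau>
        proof -
          have "d \<tau> \<xi> - P \<xi> t = (1 / (\<tau> - t)) *\<^sub>R (Y \<xi> \<tau> - (Y \<xi> t + (\<tau> - t) *\<^sub>R P \<xi> t))"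
            using that by (simp add: d_def scaleR_conv_of_real right_diff_distrib distrib_left diff_diff_eq flip: of_real_diff)
          then show ?thesis by simp
        qed
        then show ?thesis by (simp add: eventually_at_filter)
      qed
      ultimately have "((\<lambda>\<tau>. cmod (d \<tau> \<xi> - P \<xi> t)) \<longlongrightarrow> 0) (at t within {0..T})"
        by (rule Lim_transform_eventually)
      then show ?thesis by (rule tendsto_norm_zero_cancel)
    qed
  qed
  moreover have "\<forall>\<^sub>F \<tau> in at t within {0..T}. Snorm r (series_dist (\<lambda>\<xi>. d \<tau> \<xi> - P \<xi> t)) =
      Snorm r (Diff (Scale (1 / (\<tau> - t)) (Diff (series_dist (\<lambda>\<xi>. Y \<xi> \<tau>)) (series_dist (\<lambda>\<xi>. Y \<xi> t)))) (series_dist (\<lambda>\<xi>. P \<xi> t)))"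
    using eventually_at_within
  proof eventually_elim
    case (elim \<tau>)
    have dc: "sobolev_coefficients r (\<lambda>\<xi>. Y \<xi> \<tau> - Y \<xi> t)"
      by (rule sobolev_coefficients_diff[OF Yc[OF elim] Yc[OF t]])
    have "Scale (1 / (\<tau> - t)) (Diff (series_dist (\<lambda>\<xi>. Y \<xi> \<tau>)) (series_dist (\<lambda>\<xi>. Y \<xi> t))) = series_dist (d \<tau>)"
      unfolding dist_diff_series[OF Yc[OF elim] Yc[OF t]] dist_scale_series[OF dc] d_def ..
    moreover have "sobolev_coefficients r (d \<tau>)"
      unfolding d_def by (rule sobolev_coefficients_scale[OF dc])
    ultimately show ?case by (simp add: dist_diff_series[OF _ Pc])
  qed
  ultimately show ?thesis by (rule Lim_transform_eventually)
qed

text \<open>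
  A coefficient is dominated by the norm, so the coefficients of the approximating simple functions
  converge to those of \<open>f t\<close>, and \<open>h\<close> is their measurable limit. The last bound is the pointwise lower
  Riesz bound, restricted to finitely many indices and integrated in time.
\<close>

lemma source_coefficients:
  assumes f: "L2_sobolev I u v \<mu> T s f"
  shows "\<exists>h. (\<forall>\<xi>\<in>I. h \<xi> \<in> borel_measurable (lebesgue_on {0..T}) \<and>
      (AE t in lebesgue_on {0..T}. h \<xi> t = fourier v (f t) \<xi>) \<and>
      (\<lambda>t. (cmod (h \<xi> t))\<^sup>2) integrable_on {0..T}) \<and>
    (\<forall>F. finite F \<and> F \<subseteq> I \<longrightarrow>
      A * (\<Sum>\<xi>\<in>F. \<mu> \<xi> powr s * integral {0..T} (\<lambda>t. (cmod (h \<xi> t))\<^sup>2)) \<le> (L2Snorm T s f)\<^sup>2)"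
proof -
  let ?M = "lebesgue_on {0..T}"
  obtain S where S: "\<And>k. simple_function ?M (S k)" "\<And>k. S k ` {0..T} \<subseteq> Sob s"
    and conv: "AE t in ?M. (\<lambda>k. Snorm s (Diff (S k t) (f t))) \<longlonglongrightarrow> 0"
    and fS: "AE t in ?M. f t \<in> Sob s"
    and int: "integrable ?M (\<lambda>t. (Snorm s (f t))\<^sup>2)"
    using f by (auto simp: L2_sobolev_def)
  define h where "h \<xi> t = lim (\<lambda>k. fourier v (S k t) \<xi>)" for \<xi> t
  have S_meas: "(\<lambda>t. fourier v (S k t) \<xi>) \<in> borel_measurable ?M" for k \<xi>
    by (rule borel_measurable_simple_function[OF simple_function_compose1[OF S(1)]])
  have h_meas: "h \<xi> \<in> borel_measurable ?M" for \<xi>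
    unfolding h_def by (rule borel_measurable_lim_metric[OF S_meas])
  have inI: "AE t in ?M. t \<in> {0..T}" by (rule AE_I2) simp
  have pointwise: "\<mu> \<xi> powr s * (cmod (fourier v w \<xi>))\<^sup>2 \<le> (Snorm s w)\<^sup>2 / A"
    if w: "w \<in> Sob s" and \<xi>: "\<xi> \<in> I" for w \<xi>
  proof -
    have "(\<Sum>\<xi>\<in>{\<xi>}. \<mu> \<xi> powr s * (cmod (fourier v w \<xi>))\<^sup>2) \<le> (\<Sum>\<^sub>\<infinity>\<xi>\<in>I. \<mu> \<xi> powr s * (cmod (fourier v w \<xi>))\<^sup>2)"
      using sobolev_norm_bounds(1)[OF w] \<xi> unfolding sobolev_coefficients_def
      by (intro finite_sum_le_infsum) auto
    also have "\<dots> \<le> (Snorm s w)\<^sup>2 / A"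
      using sobolev_norm_bounds(2)[OF w] A by (simp add: field_simps)
    finally show ?thesis by simp
  qed
  have h_eq: "AE t in ?M. h \<xi> t = fourier v (f t) \<xi>" if \<xi>: "\<xi> \<in> I" for \<xi>
    using conv fS inI
  proof eventually_elim
    case (elim t)
    have St: "S k t \<in> Sob s" for k using S(2)[of k] elim(3) by auto
    have diff: "Diff (S k t) (f t) \<in> Sob s"
      "fourier v (Diff (S k t) (f t)) \<xi> = fourier v (S k t) \<xi> - fourier v (f t) \<xi>" for k
    proof -
      note c = sobolev_norm_bounds(1)[OF St[of k]] sobolev_norm_bounds(1)[OF elim(2)]
      have eq: "Diff (S k t) (f t) = series_dist (\<lambda>\<xi>. fourier v (S k t) \<xi> - fourier v (f t) \<xi>)"
        using dist_diff_series[OF c] sobolev_eq_series[OF St[of k]] sobolev_eq_series[OF elim(2)] by simp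
      show "Diff (S k t) (f t) \<in> Sob s"
        unfolding eq by (rule series_dist_sobolev[OF sobolev_coefficients_diff[OF c]])
      show "fourier v (Diff (S k t) (f t)) \<xi> = fourier v (S k t) \<xi> - fourier v (f t) \<xi>"
        unfolding eq by (rule fourier_series_dist[OF sobolev_coefficients_diff[OF c] \<xi>])
    qed
    have "(\<lambda>k. fourier v (S k t) \<xi> - fourier v (f t) \<xi>) \<longlonglongrightarrow> 0"
    proof (rule Lim_null_comparison)
      show "(\<lambda>k. Snorm s (Diff (S k t) (f t)) * (1 / sqrt (A * \<mu> \<xi> powr s))) \<longlonglongrightarrow> 0"
        using tendsto_mult_left_zero[OF elim(1)] .
      have "cmod (fourier v (S k t) \<xi> - fourier v (f t) \<xi>) \<le>
          Snorm s (Diff (S k t) (f t)) * (1 / sqrt (A * \<mu> \<xi> powr s))" for k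
      proof (rule power2_le_imp_le)
        show "(cmod (fourier v (S k t) \<xi> - fourier v (f t) \<xi>))\<^sup>2 \<le>
            (Snorm s (Diff (S k t) (f t)) * (1 / sqrt (A * \<mu> \<xi> powr s)))\<^sup>2"
          using pointwise[OF diff(1)[of k] \<xi>] A \<mu>_pos[OF \<xi>]
          by (simp add: diff(2) power_mult_distrib power_divide field_simps)
      qed (use A in auto)
      then show "\<forall>\<^sub>F k in sequentially. norm (fourier v (S k t) \<xi> - fourier v (f t) \<xi>) \<le>
          Snorm s (Diff (S k t) (f t)) * (1 / sqrt (A * \<mu> \<xi> powr s))"
        by (intro always_eventually) auto
    qed
    then have "(\<lambda>k. fourier v (S k t) \<xi>) \<longlonglongrightarrow> fourier v (f t) \<xi>"
      by (simp add: LIM_zero_iff)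
    then show ?case by (simp add: h_def limI)
  qed
  have h2_int: "integrable ?M (\<lambda>t. (cmod (h \<xi> t))\<^sup>2)" if \<xi>: "\<xi> \<in> I" for \<xi>
  proof (rule Bochner_Integration.integrable_bound)
    show "integrable ?M (\<lambda>t. (Snorm s (f t))\<^sup>2 / (A * \<mu> \<xi> powr s))" using int by simp
    show "(\<lambda>t. (cmod (h \<xi> t))\<^sup>2) \<in> borel_measurable ?M" using h_meas[of \<xi>] by measurable
    show "AE t in ?M. norm ((cmod (h \<xi> t))\<^sup>2) \<le> norm ((Snorm s (f t))\<^sup>2 / (A * \<mu> \<xi> powr s))"
      using h_eq[OF \<xi>] fS
    proof eventually_elim
      case (elim t)
      then show ?case using pointwise[OF elim(2) \<xi>] A \<mu>_pos[OF \<xi>] by (simp add: field_simps)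
    qed
  qed
  have sums: "A * (\<Sum>\<xi>\<in>F. \<mu> \<xi> powr s * integral {0..T} (\<lambda>t. (cmod (h \<xi> t))\<^sup>2)) \<le> (L2Snorm T s f)\<^sup>2"
    if F: "finite F" "F \<subseteq> I" for F
  proof -
    have "A * (\<Sum>\<xi>\<in>F. \<mu> \<xi> powr s * integral {0..T} (\<lambda>t. (cmod (h \<xi> t))\<^sup>2)) =
        (LINT t|?M. A * (\<Sum>\<xi>\<in>F. \<mu> \<xi> powr s * (cmod (h \<xi> t))\<^sup>2))"
      using F h2_int by (simp add: Bochner_Integration.integral_sum lebesgue_integral_eq_integral subset_iff)
    also have "\<dots> \<le> (LINT t|?M. (Snorm s (f t))\<^sup>2)"
    proof (rule integral_mono_AE[OF _ int])
      show "integrable ?M (\<lambda>t. A * (\<Sum>\<xi>\<in>F. \<mu> \<xi> powr s * (cmod (h \<xi> t))\<^sup>2))"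
        using F h2_int by (auto intro!: integrable_mult_right Bochner_Integration.integrable_sum)
      have "AE t in ?M. \<forall>\<xi>\<in>F. h \<xi> t = fourier v (f t) \<xi>"
        using F h_eq by (intro AE_finite_allI) auto
      then show "AE t in ?M. A * (\<Sum>\<xi>\<in>F. \<mu> \<xi> powr s * (cmod (h \<xi> t))\<^sup>2) \<le> (Snorm s (f t))\<^sup>2"
        using fS
      proof eventually_elim
        case (elim t)
        have "(\<Sum>\<xi>\<in>F. \<mu> \<xi> powr s * (cmod (h \<xi> t))\<^sup>2) = (\<Sum>\<xi>\<in>F. \<mu> \<xi> powr s * (cmod (fourier v (f t) \<xi>))\<^sup>2)"
          using elim(1) by (intro sum.cong) auto
        also have "\<dots> \<le> (\<Sum>\<^sub>\<infinity>\<xi>\<in>I. \<mu> \<xi> powr s * (cmod (fourier v (f t) \<xi>))\<^sup>2)"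
          using sobolev_norm_bounds(1)[OF elim(2)] F unfolding sobolev_coefficients_def
          by (intro finite_sum_le_infsum) auto
        finally have "A * (\<Sum>\<xi>\<in>F. \<mu> \<xi> powr s * (cmod (h \<xi> t))\<^sup>2) \<le>
            A * (\<Sum>\<^sub>\<infinity>\<xi>\<in>I. \<mu> \<xi> powr s * (cmod (fourier v (f t) \<xi>))\<^sup>2)"
          using A by (intro mult_left_mono) auto
        then show ?case using sobolev_norm_bounds(2)[OF elim(2)] by linarith
      qed
    qed
    also have "\<dots> = (L2Snorm T s f)\<^sup>2"
      by (simp add: L2_sobolev_norm_def)
    finally show ?thesis .
  qed
  show ?thesis
    using h_meas h_eq integrable_on_lebesgue_on[OF h2_int] sums by (intro exI[of _ h]) simp
qed

end

section \<open>The Cauchy problem\<close>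

locale cauchy_setting = riesz_operator I u v A B \<mu> m0
  for I :: "'i set" and u v :: "'i \<Rightarrow> 'a::euclidean_space cfun" and A B :: real and \<mu> and m0 +
  fixes T a0 L Q s :: real and a a' q :: "real \<Rightarrow> real"
  assumes T: "T > 0"
    and a_der: "\<And>t. t \<in> {0..T} \<Longrightarrow> (a has_real_derivative a' t) (at t within {0..T})"
    and a'_le: "\<And>t. t \<in> {0..T} \<Longrightarrow> \<bar>a' t\<bar> \<le> L"
    and a_ge: "\<And>t. t \<in> {0..T} \<Longrightarrow> a t \<ge> a0" and a0: "a0 > 0"
    and q_meas: "q \<in> borel_measurable (lebesgue_on {0..T})"
    and q_le: "AE t in lebesgue_on {0..T}. \<bar>q t\<bar> \<le> Q" and Q: "Q \<ge> 0"
begin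

text \<open>
  The Gronwall factor, enlarged so that the weight \<open>a\<close> can be removed from the energy at both times.
\<close>

definition growth :: real where
  "growth = exp ((L / a0 + 1 + Q + Q / (a0 * m0)) * T) * max 1 (a 0) / min 1 a0"

lemma growth_pos: "growth > 0"
  using a0 by (simp add: growth_def)

lemma ode_pair_bound:
  assumes \<xi>: "\<xi> \<in> I" and h: "(\<lambda>t. (cmod (h t))\<^sup>2) integrable_on {0..T}"
    and ode: "ode_pair T a q (\<mu> \<xi>) h y0 y1 y p" and t: "t \<in> {0..T}"
  shows "\<mu> \<xi> * (cmod (y t))\<^sup>2 + (cmod (p t))\<^sup>2 \<le>
    growth * (\<mu> \<xi> * (cmod y0)\<^sup>2 + (cmod y1)\<^sup>2 + integral {0..T} (\<lambda>t. (cmod (h t))\<^sup>2))"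
proof -
  define M where "M = exp ((L / a0 + 1 + Q + Q / (a0 * m0)) * T)"
  define E where "E = integral {0..T} (\<lambda>t. (cmod (h t))\<^sup>2)"
  have E: "E \<ge> 0" unfolding E_def by (rule integral_nonneg[OF h]) auto
  have b: "min 1 a0 > 0" using a0 by simp
  have m: "\<mu> \<xi> > 0" by (rule \<mu>_pos[OF \<xi>])
  have "min 1 a0 * (\<mu> \<xi> * (cmod (y t))\<^sup>2) \<le> a t * (\<mu> \<xi> * (cmod (y t))\<^sup>2)"
    using a_ge[OF t] m by (intro mult_right_mono) auto
  moreover have "min 1 a0 * (cmod (p t))\<^sup>2 \<le> 1 * (cmod (p t))\<^sup>2"
    by (intro mult_right_mono) auto
  ultimately have "min 1 a0 * (\<mu> \<xi> * (cmod (y t))\<^sup>2 + (cmod (p t))\<^sup>2) \<le>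
      a t * \<mu> \<xi> * (cmod (y t))\<^sup>2 + (cmod (p t))\<^sup>2"
    by (simp add: distrib_left mult.assoc)
  also have "\<dots> \<le> M * (a 0 * \<mu> \<xi> * (cmod y0)\<^sup>2 + (cmod y1)\<^sup>2 + E)"
    unfolding M_def E_def
    by (rule energy_estimate[OF a_der a'_le a_ge a0 q_le \<mu>[OF \<xi>] m0 Q h ode t])
  also have "\<dots> \<le> M * (max 1 (a 0) * (\<mu> \<xi> * (cmod y0)\<^sup>2 + (cmod y1)\<^sup>2 + E))"
  proof (rule mult_left_mono)
    have "a 0 * (\<mu> \<xi> * (cmod y0)\<^sup>2) \<le> max 1 (a 0) * (\<mu> \<xi> * (cmod y0)\<^sup>2)"
      using m by (intro mult_right_mono) auto
    moreover have "1 * ((cmod y1)\<^sup>2 + E) \<le> max 1 (a 0) * ((cmod y1)\<^sup>2 + E)"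
      using E by (intro mult_right_mono) auto
    ultimately show "a 0 * \<mu> \<xi> * (cmod y0)\<^sup>2 + (cmod y1)\<^sup>2 + E \<le>
        max 1 (a 0) * (\<mu> \<xi> * (cmod y0)\<^sup>2 + (cmod y1)\<^sup>2 + E)"
      by (simp add: distrib_left mult.assoc)
  qed (simp add: M_def)
  finally have "\<mu> \<xi> * (cmod (y t))\<^sup>2 + (cmod (p t))\<^sup>2 \<le>
      M * (max 1 (a 0) * (\<mu> \<xi> * (cmod y0)\<^sup>2 + (cmod y1)\<^sup>2 + E)) / min 1 a0"
    using b by (simp add: pos_le_divide_eq mult.commute)
  then show ?thesis by (simp add: growth_def M_def E_def mult.assoc)
qed

lemma ode_pair_unique:
  assumes \<xi>: "\<xi> \<in> I" and ode: "ode_pair T a q (\<mu> \<xi>) h y0 y1 y p" "ode_pair T a q (\<mu> \<xi>) h y0 y1 z r"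
    and t: "t \<in> {0..T}"
  shows "y t = z t"
proof -
  have "(\<lambda>t. (cmod (h t - h t))\<^sup>2) integrable_on {0..T}" by (simp add: integrable_0)
  from ode_pair_bound[OF \<xi> this ode_pair_diff[OF ode] t]
  have "\<mu> \<xi> * (cmod (y t - z t))\<^sup>2 + (cmod (p t - r t))\<^sup>2 \<le> 0" by simp
  then have "\<mu> \<xi> * (cmod (y t - z t))\<^sup>2 \<le> 0" using zero_le_power2[of "cmod (p t - r t)"] by linarith
  then show ?thesis using \<mu>_pos[OF \<xi>] by (simp add: mult_le_0_iff)
qed

lemma cauchy_solution_unique:
  assumes "cauchy_solution I u v \<mu> T s a q f v0 v1 y y'" "cauchy_solution I u v \<mu> T s a q f v0 v1 w w'"
    and t: "t \<in> {0..T}"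
  shows "y t = w t"
proof (rule distribution_eqI)
  show "y t \<in> distributions Hs" "w t \<in> distributions Hs"
    using assms by (auto simp: cauchy_solution_def C_sobolev_def intro: sobolev_distribution)
  fix \<xi> assume \<xi>: "\<xi> \<in> I"
  then obtain p r where
    "ode_pair T a q (\<mu> \<xi>) (\<lambda>t. fourier v (f t) \<xi>) (fourier v v0 \<xi>) (fourier v v1 \<xi>) (\<lambda>t. fourier v (y t) \<xi>) p"
    "ode_pair T a q (\<mu> \<xi>) (\<lambda>t. fourier v (f t) \<xi>) (fourier v v0 \<xi>) (fourier v v1 \<xi>) (\<lambda>t. fourier v (w t) \<xi>) r"
    using assms unfolding cauchy_solution_def ode_solution_iff_ode_pair by blast
  from ode_pair_unique[OF \<xi> this t] show "fourier v (y t) \<xi> = fourier v (w t) \<xi>" .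
qed

text \<open>
  The solution is the series of the scalar solutions. The scalar estimate, multiplied by \<open>\<mu> powr s\<close>, bounds
  the terms of both norms by a sequence \<open>g\<close> that is summable and independent of time. Its
  sum yields the estimate, and \<open>g\<close> itself is the majorant for continuity and differentiability in time.
\<close>

lemma cauchy_solution_exists:
  assumes f: "L2_sobolev I u v \<mu> T s f"
    and v0: "v0 \<in> Sob (1 + s)" and v1: "v1 \<in> Sob s"
  shows "\<exists>w w'. cauchy_solution I u v \<mu> T s a q f v0 v1 w w' \<and>
    (\<forall>t\<in>{0..T}. (Snorm (1 + s) (w t))\<^sup>2 + (Snorm s (w' t))\<^sup>2 \<le>
      2 * B * growth / A * ((Snorm (1 + s) v0)\<^sup>2 + (Snorm s v1)\<^sup>2
        + (L2Snorm T s f)\<^sup>2))"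
proof -
  obtain h where h: "\<forall>\<xi>\<in>I. h \<xi> \<in> borel_measurable (lebesgue_on {0..T}) \<and>
      (AE t in lebesgue_on {0..T}. h \<xi> t = fourier v (f t) \<xi>) \<and>
      (\<lambda>t. (cmod (h \<xi> t))\<^sup>2) integrable_on {0..T}"
    and h_sum: "\<forall>F. finite F \<and> F \<subseteq> I \<longrightarrow>
      A * (\<Sum>\<xi>\<in>F. \<mu> \<xi> powr s * integral {0..T} (\<lambda>t. (cmod (h \<xi> t))\<^sup>2)) \<le> (L2Snorm T s f)\<^sup>2"
    using source_coefficients[OF f] by (elim exE conjE)
  have h_meas: "h \<xi> \<in> borel_measurable (lebesgue_on {0..T})"
    and h_eq: "AE t in lebesgue_on {0..T}. h \<xi> t = fourier v (f t) \<xi>"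
    and h2: "(\<lambda>t. (cmod (h \<xi> t))\<^sup>2) integrable_on {0..T}" if "\<xi> \<in> I" for \<xi>
    using h that by auto
  have a_cont: "continuous_on {0..T} a"
    using a_der DERIV_continuous by (blast intro: continuous_on_eq_continuous_within[THEN iffD2])
  have "\<forall>\<xi>\<in>I. \<exists>y p. ode_pair T a q (\<mu> \<xi>) (h \<xi>) (fourier v v0 \<xi>) (fourier v v1 \<xi>) y p"
    using ode_pair_exists[OF T a_cont q_meas q_le h_meas h2] by blast
  then obtain Y P where ode: "\<And>\<xi>. \<xi> \<in> I \<Longrightarrow>
      ode_pair T a q (\<mu> \<xi>) (h \<xi>) (fourier v v0 \<xi>) (fourier v v1 \<xi>) (Y \<xi>) (P \<xi>)"
    by metis
  define E where "E \<xi> = integral {0..T} (\<lambda>t. (cmod (h \<xi> t))\<^sup>2)" for \<xi>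
  have E: "E \<xi> \<ge> 0" if "\<xi> \<in> I" for \<xi>
    unfolding E_def by (rule integral_nonneg[OF h2[OF that]]) auto
  define g0 where "g0 \<xi> = \<mu> \<xi> powr (1 + s) * (cmod (fourier v v0 \<xi>))\<^sup>2" for \<xi>
  define g1 where "g1 \<xi> = \<mu> \<xi> powr s * (cmod (fourier v v1 \<xi>))\<^sup>2" for \<xi>
  define g2 where "g2 \<xi> = \<mu> \<xi> powr s * E \<xi>" for \<xi>
  define g where "g \<xi> = growth * (g0 \<xi> + g1 \<xi> + g2 \<xi>)" for \<xi>
  have g0: "g0 summable_on I" "A * infsum g0 I \<le> (Snorm (1 + s) v0)\<^sup>2"
    using sobolev_norm_bounds(1,2)[OF v0] by (simp_all add: sobolev_coefficients_def g0_def[abs_def])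
  have g1: "g1 summable_on I" "A * infsum g1 I \<le> (Snorm s v1)\<^sup>2"
    using sobolev_norm_bounds(1,2)[OF v1] by (simp_all add: sobolev_coefficients_def g1_def[abs_def])
  have g2_le: "sum g2 F \<le> (L2Snorm T s f)\<^sup>2 / A" if "finite F" "F \<subseteq> I" for F
    using h_sum[rule_format, of F] that A by (simp add: g2_def E_def field_simps)
  have g2_sum: "g2 summable_on I"
    using g2_le E by (intro nonneg_bdd_above_summable_on bdd_aboveI2) (auto simp: g2_def)
  have "infsum g2 I \<le> (L2Snorm T s f)\<^sup>2 / A"
    by (rule infsum_le_finite_sums[OF g2_sum g2_le])
  then have g2: "A * infsum g2 I \<le> (L2Snorm T s f)\<^sup>2"
    using A by (simp add: field_simps)
  have g_sum: "g summable_on I"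
    unfolding g_def by (intro summable_on_cmult_right summable_on_add g0 g1 g2_sum)
  have "infsum g I = growth * (infsum g0 I + infsum g1 I + infsum g2 I)"
    unfolding g_def using g0 g1 g2_sum
    by (simp add: infsum_cmult_right' infsum_add summable_on_add)
  then have "A * infsum g I = growth * (A * infsum g0 I + A * infsum g1 I + A * infsum g2 I)"
    by (simp add: algebra_simps)
  also have "\<dots> \<le> growth * ((Snorm (1 + s) v0)\<^sup>2 + (Snorm s v1)\<^sup>2
      + (L2Snorm T s f)\<^sup>2)"
    using growth_pos g0(2) g1(2) g2 by (intro mult_left_mono) auto
  finally have g_inf: "infsum g I \<le> growth / A * ((Snorm (1 + s) v0)\<^sup>2 + (Snorm s v1)\<^sup>2
      + (L2Snorm T s f)\<^sup>2)"
    using A by (simp add: field_simps)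
  have powr_Suc: "\<mu> \<xi> powr (1 + s) = \<mu> \<xi> powr s * \<mu> \<xi>" if "\<xi> \<in> I" for \<xi>
    using \<mu>_pos[OF that] by (simp add: powr_add)
  have "\<mu> \<xi> powr (1 + s) * (cmod (Y \<xi> t))\<^sup>2 + \<mu> \<xi> powr s * (cmod (P \<xi> t))\<^sup>2 \<le> g \<xi>"
    if \<xi>: "\<xi> \<in> I" and t: "t \<in> {0..T}" for \<xi> t
  proof -
    have "\<mu> \<xi> powr s * (\<mu> \<xi> * (cmod (Y \<xi> t))\<^sup>2 + (cmod (P \<xi> t))\<^sup>2) \<le>
        \<mu> \<xi> powr s * (growth * (\<mu> \<xi> * (cmod (fourier v v0 \<xi>))\<^sup>2 + (cmod (fourier v v1 \<xi>))\<^sup>2 + E \<xi>))"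
      unfolding E_def by (intro mult_left_mono ode_pair_bound[OF \<xi> h2[OF \<xi>] ode[OF \<xi>] t]) auto
    then show ?thesis
      unfolding g_def g0_def g1_def g2_def powr_Suc[OF \<xi>] by (simp add: algebra_simps)
  qed
  moreover have "0 \<le> \<mu> \<xi> powr r * (cmod z)\<^sup>2" for \<xi> r z by simp
  ultimately have Y_le: "\<mu> \<xi> powr (1 + s) * (cmod (Y \<xi> t))\<^sup>2 \<le> g \<xi>"
    and P_le: "\<mu> \<xi> powr s * (cmod (P \<xi> t))\<^sup>2 \<le> g \<xi>" if "\<xi> \<in> I" "t \<in> {0..T}" for \<xi> t
    using that by (smt (verit))+
  have Y_le': "\<mu> \<xi> powr s * (cmod (Y \<xi> t))\<^sup>2 \<le> g \<xi> / m0" if \<xi>: "\<xi> \<in> I" and t: "t \<in> {0..T}" for \<xi> t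
  proof -
    have "m0 * (\<mu> \<xi> powr s * (cmod (Y \<xi> t))\<^sup>2) \<le> \<mu> \<xi> * (\<mu> \<xi> powr s * (cmod (Y \<xi> t))\<^sup>2)"
      by (intro mult_right_mono \<mu>[OF \<xi>]) auto
    also have "\<dots> \<le> g \<xi>" using Y_le[OF \<xi> t] by (simp add: powr_Suc[OF \<xi>] mult_ac)
    finally show ?thesis using m0 by (simp add: field_simps)
  qed
  define w where "w t = series_dist (\<lambda>\<xi>. Y \<xi> t)" for t
  define w' where "w' t = series_dist (\<lambda>\<xi>. P \<xi> t)" for t
  have g_m0: "(\<lambda>\<xi>. g \<xi> / m0) summable_on I"
    using summable_on_cmult_right[OF g_sum, of "1 / m0"] by simp
  have Yc1: "sobolev_coefficients (1 + s) (\<lambda>\<xi>. Y \<xi> t)" if "t \<in> {0..T}" for t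
    by (rule sobolev_coefficients_dominated[OF g_sum Y_le[OF _ that]])
  have Yc: "sobolev_coefficients s (\<lambda>\<xi>. Y \<xi> t)" if "t \<in> {0..T}" for t
    by (rule sobolev_coefficients_dominated[OF g_m0 Y_le'[OF _ that]])
  have Pc: "sobolev_coefficients s (\<lambda>\<xi>. P \<xi> t)" if "t \<in> {0..T}" for t
    by (rule sobolev_coefficients_dominated[OF g_sum P_le[OF _ that]])
  have Y_der: "(Y \<xi> has_vector_derivative P \<xi> t) (at t within {0..T})" if "\<xi> \<in> I" "t \<in> {0..T}" for \<xi> t
    using ode[OF that(1)] that(2) by (simp add: ode_pair_def)
  have Y_lim: "(Y \<xi> \<longlongrightarrow> Y \<xi> t) (at t within {0..T})" if "\<xi> \<in> I" "t \<in> {0..T}" for \<xi> t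
    using has_vector_derivative_continuous[OF Y_der[OF that]] by (simp add: continuous_within)
  have P_lim: "(P \<xi> \<longlongrightarrow> P \<xi> t) (at t within {0..T})" if "\<xi> \<in> I" "t \<in> {0..T}" for \<xi> t
    using absolutely_continuous_on_imp_continuous[of 0 T "P \<xi>"] ode[OF that(1)] that(2)
    by (simp add: ode_pair_def continuous_on)
  have w_C1: "C_sobolev I u v \<mu> T (1 + s) w"
    unfolding w_def by (rule C_sobolev_series[OF g_sum Y_le Y_lim])
  have w_C: "C_sobolev I u v \<mu> T s w"
    unfolding w_def by (rule C_sobolev_series[OF g_m0 Y_le' Y_lim])
  have w'_C: "C_sobolev I u v \<mu> T s w'"
    unfolding w'_def by (rule C_sobolev_series[OF g_sum P_le P_lim])
  have der: "((\<lambda>\<tau>. Snorm s (Diff (Scale (1 / (\<tau> - t)) (Diff (w \<tau>) (w t))) (w' t))) \<longlongrightarrow> 0) (at t within {0..T})"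
    if "t \<in> {0..T}" for t
    unfolding w_def w'_def by (rule difference_quotient_series[OF g_sum Y_der Yc P_le that])
  have "ode_solution T a q (\<mu> \<xi>) (\<lambda>t. fourier v (f t) \<xi>) (fourier v v0 \<xi>) (fourier v v1 \<xi>) (\<lambda>t. fourier v (w t) \<xi>)"
    if \<xi>: "\<xi> \<in> I" for \<xi>
    unfolding ode_solution_iff_ode_pair
  proof
    show "ode_pair T a q (\<mu> \<xi>) (\<lambda>t. fourier v (f t) \<xi>) (fourier v v0 \<xi>) (fourier v v1 \<xi>) (\<lambda>t. fourier v (w t) \<xi>) (P \<xi>)"
      by (rule ode_pair_cong[OF ode[OF \<xi>] _ _ h_eq[OF \<xi>]])
        (use T in \<open>auto simp: w_def fourier_series_dist[OF Yc \<xi>]\<close>)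
  qed
  then have sol: "cauchy_solution I u v \<mu> T s a q f v0 v1 w w'"
    using w_C1 w_C w'_C der by (auto simp: cauchy_solution_def C1_sobolev_def)
  have "(Snorm (1 + s) (w t))\<^sup>2 + (Snorm s (w' t))\<^sup>2 \<le> 2 * B * infsum g I"
    if t: "t \<in> {0..T}" for t
  proof -
    have "(Snorm (1 + s) (w t))\<^sup>2 \<le> B * infsum g I"
      unfolding w_def
      by (rule order_trans[OF series_dist_norm_le[OF Yc1[OF t]]])
        (use B Yc1[OF t] Y_le[OF _ t] g_sum in \<open>auto intro!: mult_left_mono infsum_mono simp: sobolev_coefficients_def\<close>)
    moreover have "(Snorm s (w' t))\<^sup>2 \<le> B * infsum g I"
      unfolding w'_def
      by (rule order_trans[OF series_dist_norm_le[OF Pc[OF t]]])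
        (use B Pc[OF t] P_le[OF _ t] g_sum in \<open>auto intro!: mult_left_mono infsum_mono simp: sobolev_coefficients_def\<close>)
    ultimately show ?thesis by linarith
  qed
  then have "(Snorm (1 + s) (w t))\<^sup>2 + (Snorm s (w' t))\<^sup>2 \<le>
      2 * B * growth / A * ((Snorm (1 + s) v0)\<^sup>2 + (Snorm s v1)\<^sup>2
        + (L2Snorm T s f)\<^sup>2)" if "t \<in> {0..T}" for t
  proof (rule order_trans)
    show "2 * B * infsum g I \<le> 2 * B * growth / A * ((Snorm (1 + s) v0)\<^sup>2
        + (Snorm s v1)\<^sup>2 + (L2Snorm T s f)\<^sup>2)"
      using mult_left_mono[OF g_inf, of "2 * B"] B by (simp add: mult.assoc)
  qed (use that in blast)
  then show ?thesis using sol by blast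
qed

end

section \<open>Well-posedness\<close>

text \<open>
  The increments of \<open>a\<close> are Henstock--Kurzweil integrals of \<open>a'\<close>, so the bound makes \<open>a\<close> Lipschitz;
  the difference quotients then carry it over to every point.
\<close>

lemma derivative_bound_of_ae_bound:
  fixes a a' :: "real \<Rightarrow> real"
  assumes T: "T > 0"
    and der: "\<And>t. t \<in> {0..T} \<Longrightarrow> (a has_real_derivative a' t) (at t within {0..T})"
    and le: "AE t in lebesgue_on {0..T}. \<bar>a' t\<bar> \<le> L"
    and t: "t \<in> {0..T}"
  shows "\<bar>a' t\<bar> \<le> L"
proof -
  define N where "N = {t \<in> {0..T}. \<not> \<bar>a' t\<bar> \<le> L}"
  have N: "negligible N" using le unfolding AE_lebesgue_on_iff_negligible N_def .
  have "\<not> negligible {0..T}" using T negligible_interval(1)[of 0 T] by simp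
  then have "\<not> {0..T} \<subseteq> N" using negligible_subset[OF N] by blast
  then obtain t0 where "t0 \<in> {0..T}" "\<bar>a' t0\<bar> \<le> L" unfolding N_def by blast
  then have L: "L \<ge> 0" by linarith
  define b where "b t = (if t \<in> N then 0 else a' t)" for t
  have b: "\<bar>b t\<bar> \<le> L" if "t \<in> {0..T}" for t using that L by (auto simp: b_def N_def)
  have lip: "\<bar>a y - a x\<bar> \<le> L * (y - x)" if xy: "x \<in> {0..T}" "y \<in> {0..T}" "x \<le> y" for x y
  proof -
    have "(a' has_integral (a y - a x)) {x..y}"
    proof (rule fundamental_theorem_of_calculus[OF xy(3)])
      fix r assume "r \<in> {x..y}"
      then show "(a has_vector_derivative a' r) (at r within {x..y})"
        using der[of r] xy has_vector_derivative_within_subset[of a "a' r" r "{0..T}" "{x..y}"]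
        by (auto simp: has_real_derivative_iff_has_vector_derivative)
    qed
    then have "(b has_integral (a y - a x)) (cbox x y)"
      by (intro has_integral_spike[OF N, of _ b a']) (auto simp: b_def)
    then have "norm (a y - a x) \<le> L * content (cbox x y)"
      by (rule has_integral_bound[OF L]) (use b xy in auto)
    then show ?thesis using xy by simp
  qed
  have quot: "((\<lambda>y. (a y - a t) / (y - t)) \<longlongrightarrow> a' t) (at t within {0..T})"
    using der[OF t] by (simp add: has_field_derivative_iff)
  have "norm (a' t) \<le> L"
  proof (rule Lim_norm_ubound[OF _ quot])
    show "at t within {0..T} \<noteq> bot" using T t by (simp add: trivial_limit_within)
    have "norm ((a y - a t) / (y - t)) \<le> L" if y: "y \<in> {0..T}" "y \<noteq> t" for y
      using lip[of y t] lip[of t y] y t by (cases "y \<le> t") (auto simp: abs_divide divide_simps abs_minus_commute)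
    then show "\<forall>\<^sub>F y in at t within {0..T}. norm ((a y - a t) / (y - t)) \<le> L"
      by (auto simp: eventually_at_filter)
  qed
  then show ?thesis by simp
qed

text \<open>
  If \<open>w\<close> is an eigenfunction for \<open>k\<close> and \<open>f\<close> is mapped to \<open>w\<close>, then \<open>w - k f\<close> is mapped to zero. So
  \<open>w = k f\<close>, and the bound \<open>K\<close> of the inverse gives \<open>\<parallel>w\<parallel> \<le> \<bar>k\<bar> K \<parallel>w\<parallel>\<close>.
\<close>

lemma eigenvalue_bounded_below:
  assumes G: "linear_operator G" and z: "0 \<in> resolvent_set G"
  shows "\<exists>m>0. \<forall>k w. (w, \<lambda>x. k * w x) \<in> G \<and> l2_norm w > 0 \<longrightarrow> m \<le> cmod k"
proof -
  have inj: "AE x in lebesgue. w x = 0" if "(w, \<lambda>x. 0) \<in> G" for w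
    using z that unfolding resolvent_set_def by simp
  have "\<exists>K. \<forall>g\<in>L2. \<exists>w. (w, g) \<in> G \<and> l2_norm w \<le> K * l2_norm g"
    using z unfolding resolvent_set_def by simp
  then obtain K where K: "\<forall>g\<in>L2. \<exists>w. (w, g) \<in> G \<and> l2_norm w \<le> K * l2_norm g"
    by (rule exE)
  have bound: "1 / (\<bar>K\<bar> + 1) \<le> cmod k" if w: "(w, \<lambda>x. k * w x) \<in> G" and pos: "l2_norm w > 0" for k w
  proof -
    have G_L2: "f \<in> L2" "g \<in> L2" if "(f, g) \<in> G" for f g
      using G that unfolding linear_operator_def by blast+
    obtain f where f: "(f, w) \<in> G" "l2_norm f \<le> K * l2_norm w"
      using bspec[OF K G_L2(1)[OF w]] by blast
    have "\<forall>f g f' g' c. (f, g) \<in> G \<and> (f', g') \<in> G \<longrightarrow> (\<lambda>x. f x + c * f' x, \<lambda>x. g x + c * g' x) \<in> G"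
      using G unfolding linear_operator_def by (elim conjE)
    from this[rule_format, OF conjI[OF w f(1)], of "- k"]
    have "(\<lambda>x. w x + (- k) * f x, \<lambda>x. k * w x + (- k) * w x) \<in> G" .
    then have "AE x in lebesgue. w x + (- k) * f x = 0"
      by (intro inj) simp
    then have "AE x in lebesgue. w x = k * f x"
      by eventually_elim (simp add: algebra_simps)
    then have "l2_norm w = cmod k * l2_norm f"
      using l2_norm_cong_AE[OF G_L2(1)[OF w] L2_scale[OF G_L2(1)[OF f(1)]]] by (simp add: l2_norm_scale)
    also have "\<dots> \<le> cmod k * ((\<bar>K\<bar> + 1) * l2_norm w)"
    proof (rule mult_left_mono)
      have "K * l2_norm w \<le> (\<bar>K\<bar> + 1) * l2_norm w" by (intro mult_right_mono) auto
      then show "l2_norm f \<le> (\<bar>K\<bar> + 1) * l2_norm w" using f(2) by linarith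
    qed simp
    finally have "1 * l2_norm w \<le> (cmod k * (\<bar>K\<bar> + 1)) * l2_norm w" by (simp add: mult.assoc)
    then have "1 \<le> cmod k * (\<bar>K\<bar> + 1)"
      using pos by (simp only: mult_le_cancel_right)
    then show ?thesis by (simp add: divide_le_eq add_nonneg_pos)
  qed
  show ?thesis
  proof (intro exI conjI allI impI)
    show "1 / (\<bar>K\<bar> + 1) > 0" by (simp add: add_nonneg_pos)
    show "1 / (\<bar>K\<bar> + 1) \<le> cmod k" if "(w, \<lambda>x. k * w x) \<in> G \<and> l2_norm w > 0" for k w
      using that by (elim conjE) (rule bound)
  qed
qed

theorem theorem2p1:
  fixes V :: "real ^ 'n \<Rightarrow> complex"
    and H\<^sub>0 :: "(real ^ 'n) graph"
    and I :: "'i::linorder set"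
    and lam :: "'i \<Rightarrow> complex"
    and u v :: "'i \<Rightarrow> real ^ 'n \<Rightarrow> complex"
    and c :: real
    and \<mu> :: "'i \<Rightarrow> real"
    and T s a\<^sub>0 :: real
    and a q :: "real \<Rightarrow> real"
  assumes "schroedinger_operator V H\<^sub>0"
    and "countable I"
    and "spectrum H\<^sub>0 = lam ` I"
    and "essential_spectrum H\<^sub>0 = {}"
    and "\<forall>\<xi>\<in>I. (u \<xi>, \<lambda>x. lam \<xi> * u \<xi> x) \<in> H\<^sub>0"
    and "riesz_basis I u"
    and "biorthogonal I u v"
    and "c > 0"
    and "\<mu> = (\<lambda>\<xi>. if 0 \<in> lam ` I then cmod (lam \<xi>) + c else cmod (lam \<xi>))"
    and "T > 0"
    and "a \<in> Linf1 T"
    and "(INF t\<in>{0..T}. a t) = a\<^sub>0" and "a\<^sub>0 > 0"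
    and "q \<in> Linf T"
  shows "\<exists>C>0. \<forall>f v\<^sub>0 v\<^sub>1.
    L2_sobolev I u v \<mu> T s f \<and> v\<^sub>0 \<in> sobolev I u v \<mu> (1 + s) \<and> v\<^sub>1 \<in> sobolev I u v \<mu> s \<longrightarrow>
    (\<exists>w w'. cauchy_solution I u v \<mu> T s a q f v\<^sub>0 v\<^sub>1 w w' \<and>
       (\<forall>y y'. cauchy_solution I u v \<mu> T s a q f v\<^sub>0 v\<^sub>1 y y' \<longrightarrow> (\<forall>t\<in>{0..T}. y t = w t)) \<and>
       (\<forall>t\<in>{0..T}.
          (sobolev_norm I u v \<mu> (1 + s) (w t))\<^sup>2 + (sobolev_norm I u v \<mu> s (w' t))\<^sup>2
          \<le> C * ((sobolev_norm I u v \<mu> (1 + s) v\<^sub>0)\<^sup>2 + (sobolev_norm I u v \<mu> s v\<^sub>1)\<^sup>2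
                 + (L2_sobolev_norm I u v \<mu> T s f)\<^sup>2)))"
proof -
  note R = assms(6)[unfolded riesz_basis_def]
  have u_L2: "\<forall>\<xi>\<in>I. u \<xi> \<in> L2" by (rule conjunct1[OF R])
  have dense: "\<forall>f\<in>L2. \<forall>e>0. \<exists>F b. finite F \<and> F \<subseteq> I \<and>
      l2_norm (\<lambda>x. f x - (\<Sum>\<xi>\<in>F. b \<xi> * u \<xi> x)) < e"
    by (rule conjunct1[OF conjunct2[OF R]])
  from conjunct2[OF conjunct2[OF R]]
  obtain A B where AB: "A > 0" "B > 0"
    and riesz: "\<forall>F b. finite F \<and> F \<subseteq> I \<longrightarrow>
        A * (\<Sum>\<xi>\<in>F. (cmod (b \<xi>))\<^sup>2) \<le> (l2_norm (\<lambda>x. \<Sum>\<xi>\<in>F. b \<xi> * u \<xi> x))\<^sup>2 \<and>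
        (l2_norm (\<lambda>x. \<Sum>\<xi>\<in>F. b \<xi> * u \<xi> x))\<^sup>2 \<le> B * (\<Sum>\<xi>\<in>F. (cmod (b \<xi>))\<^sup>2)"
    by (elim exE conjE)
  have pair: "riesz_pair I u v A B"
  proof
    show "l2_inner (u \<xi>) (v \<eta>) = (if \<xi> = \<eta> then 1 else 0)" if "\<xi> \<in> I" "\<eta> \<in> I" for \<xi> \<eta>
      using assms(7) that by (simp add: biorthogonal_def)
    show "v \<xi> \<in> L2" if "\<xi> \<in> I" for \<xi>
      using assms(7) that by (simp add: biorthogonal_def)
    show "\<exists>F b. finite F \<and> F \<subseteq> I \<and> l2_norm (\<lambda>x. f x - (\<Sum>\<xi>\<in>F. b \<xi> * u \<xi> x)) < e"
      if "f \<in> L2" "e > 0" for f e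
      using dense that by simp
  qed (use u_L2 AB riesz in simp_all)
  have "\<exists>m0>0. \<forall>\<xi>\<in>I. m0 \<le> \<mu> \<xi>"
  proof (cases "0 \<in> lam ` I")
    case True
    then show ?thesis using assms(8,9) by (intro exI[of _ c]) auto
  next
    case False
    then have "0 \<in> resolvent_set H\<^sub>0"
      using assms(3) by (auto simp: spectrum_def)
    moreover have "linear_operator H\<^sub>0"
      using assms(1) by (simp add: schroedinger_operator_def)
    ultimately obtain m where m: "m > 0"
      "\<forall>k w. (w, \<lambda>x. k * w x) \<in> H\<^sub>0 \<and> l2_norm w > 0 \<longrightarrow> m \<le> cmod k"
      by (metis (no_types) eigenvalue_bounded_below)
    have "m \<le> \<mu> \<xi>" if \<xi>: "\<xi> \<in> I" for \<xi>
    proof -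
      have "A \<le> (l2_norm (u \<xi>))\<^sup>2" using riesz[rule_format, of "{\<xi>}" "\<lambda>_. 1"] \<xi> by simp
      then have "l2_norm (u \<xi>) \<noteq> 0" using AB by auto
      then have "l2_norm (u \<xi>) > 0" by (simp add: less_le)
      with assms(5) \<xi> have "m \<le> cmod (lam \<xi>)"
        by (intro m(2)[rule_format, of "u \<xi>"] conjI) auto
      then show ?thesis using assms(9) False by simp
    qed
    then show ?thesis using m(1) by blast
  qed
  then obtain m0 where m0: "m0 > 0" "\<And>\<xi>. \<xi> \<in> I \<Longrightarrow> m0 \<le> \<mu> \<xi>" by blast
  obtain a' L where a_der: "\<And>t. t \<in> {0..T} \<Longrightarrow> (a has_real_derivative a' t) (at t within {0..T})"
    and a'_ae: "AE t in lebesgue_on {0..T}. \<bar>a' t\<bar> \<le> L"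
    using assms(11) unfolding Linf1_def Linf_def by blast
  have a'_le: "\<bar>a' t\<bar> \<le> L" if "t \<in> {0..T}" for t
    by (rule derivative_bound_of_ae_bound[OF assms(10) a_der a'_ae that])
  have "continuous_on {0..T} a"
    using a_der DERIV_continuous by (blast intro: continuous_on_eq_continuous_within[THEN iffD2])
  then have "bounded (a ` {0..T})"
    by (intro compact_imp_bounded compact_continuous_image compact_Icc)
  then have bdd: "bdd_below (a ` {0..T})" by (rule bounded_imp_bdd_below)
  have a_ge: "a t \<ge> a\<^sub>0" if "t \<in> {0..T}" for t
    using cINF_lower[OF bdd that] assms(12) by simp
  obtain Q where q: "q \<in> borel_measurable (lebesgue_on {0..T})" "AE t in lebesgue_on {0..T}. \<bar>q t\<bar> \<le> Q"
    using assms(14) by (auto simp: Linf_def)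
  have q': "AE t in lebesgue_on {0..T}. \<bar>q t\<bar> \<le> \<bar>Q\<bar>"
    using q(2) by eventually_elim auto
  interpret cauchy_setting I u v A B \<mu> m0 T a\<^sub>0 L "\<bar>Q\<bar>" s a a' q
    by (intro cauchy_setting.intro riesz_operator.intro riesz_operator_axioms.intro
      cauchy_setting_axioms.intro pair m0 assms(10,13) a_der a'_le a_ge q(1) q') auto
  \<comment> \<open>\<open>B / A\<close> comes from passing to coefficients and back, \<open>2\<close> from adding the two norms\<close>
  show ?thesis
  proof (intro exI[of _ "2 * B * growth / A"] conjI allI impI)
    show "2 * B * growth / A > 0" using growth_pos AB by simp
    fix f v\<^sub>0 v\<^sub>1
    assume *: "L2_sobolev I u v \<mu> T s f \<and> v\<^sub>0 \<in> sobolev I u v \<mu> (1 + s) \<and> v\<^sub>1 \<in> sobolev I u v \<mu> s"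
    then obtain w w' where w: "cauchy_solution I u v \<mu> T s a q f v\<^sub>0 v\<^sub>1 w w'"
      "\<forall>t\<in>{0..T}. (sobolev_norm I u v \<mu> (1 + s) (w t))\<^sup>2 + (sobolev_norm I u v \<mu> s (w' t))\<^sup>2 \<le>
        2 * B * growth / A * ((sobolev_norm I u v \<mu> (1 + s) v\<^sub>0)\<^sup>2 + (sobolev_norm I u v \<mu> s v\<^sub>1)\<^sup>2
        + (L2_sobolev_norm I u v \<mu> T s f)\<^sup>2)"
      using cauchy_solution_exists by metis
    then show "\<exists>w w'. cauchy_solution I u v \<mu> T s a q f v\<^sub>0 v\<^sub>1 w w' \<and>
       (\<forall>y y'. cauchy_solution I u v \<mu> T s a q f v\<^sub>0 v\<^sub>1 y y' \<longrightarrow> (\<forall>t\<in>{0..T}. y t = w t)) \<and>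
       (\<forall>t\<in>{0..T}.
          (sobolev_norm I u v \<mu> (1 + s) (w t))\<^sup>2 + (sobolev_norm I u v \<mu> s (w' t))\<^sup>2
          \<le> 2 * B * growth / A * ((sobolev_norm I u v \<mu> (1 + s) v\<^sub>0)\<^sup>2 + (sobolev_norm I u v \<mu> s v\<^sub>1)\<^sup>2
                 + (L2_sobolev_norm I u v \<mu> T s f)\<^sup>2))"
      using cauchy_solution_unique by blast
  qed
qed

end
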